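(* Let $(A_i,[-,-]_i,\pi_{i*})$ be a smooth Atiyah algebroid over a smooth manifold $M_i$, $i\in\{1,2\}$, with Lie algebra of smooth sections $\mathcal A_i$, and let $\mathcal K_i\subset\mathcal A_i$ be the kernel of the anchor map $\pi_{i*}:\mathcal A_i\to\mathfrak X(M_i)$. Let $\Phi:\mathcal A_1\to\mathcal A_2$ be any isomorphism of Lie algebras. Then $\Phi$ restricts to an isomorphism $\mathcal K_1\to\mathcal K_2$, and it induces an isomorphism $\widetilde\Phi:\mathfrak X(M_1)\to\mathfrak X(M_2)$ between the Lie algebras of vector fields (characterized by $\widetilde\Phi(\pi_{1*}a)=\pi_{2*}\Phi(a)$ for $a\in\mathcal A_1$), which is implemented by a diffeomorphism $\varphi:M_1\to M_2$, i.e. $\widetilde\Phi=\varphi_*$. Furthermore, for every $m\in M_1$, $\Phi(\mathcal A_{1m})=\mathcal A_{2\varphi(m)}$, where $\mathcal A_{im}=\{a\in\mathcal A_i:(\pi_{i*}a)_m=0\}$.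
   Context: All manifolds are smooth, second countable, paracompact, Hausdorff, of finite nonzero dimension. For a (right) principal $G$-bundle $\pi:P\to M$, the Atiyah algebroid is the vector bundle $A=TP/G$ over $M$, whose fiber $A_m$ consists of classes $[X_u]$ of tangent vectors $X_u\in T_uP$, $\pi(u)=m$, under $X_u\sim(T_ur_g)X_u$ ($r_g$ the right action of $g\in G$). Its anchor is $\pi_*:A\to TM$, $[X_u]\mapsto T_u\pi X_u$, and the same symbol denotes the induced map on sections. The sections $\mathcal A=\Gamma(A)$ are identified with the $G$-invariant vector fields on $P$, and the bracket of $\mathcal A$ is the bracket of vector fields; $\pi_*:\mathcal A\to\mathfrak X(M)$ is a surjective Lie algebra homomorphism. For a diffeomorphism $\varphi$, $(\varphi_*v)f=(v(f\circ\varphi))\circ\varphi^{-1}$. *)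

theory Defs
  imports "HOL-Analysis.Analysis" "HOL-Algebra.Group"
begin

section \<open>Smooth manifolds\<close>

text \<open>\<open>C_k_on k S f\<close> is meant for open \<open>S\<close> and finite-dimensional spaces. In the successor case all
  directional derivatives of \<open>f\<close> are again of class \<open>k\<close>; this is the usual class \<open>k + 1\<close>.\<close>

fun C_k_on :: "nat \<Rightarrow> 'a set \<Rightarrow> ('a::real_normed_vector \<Rightarrow> 'b::real_normed_vector) \<Rightarrow> bool" where
  "C_k_on 0 S f \<longleftrightarrow> continuous_on S f"
| "C_k_on (Suc k) S f \<longleftrightarrow>
     (\<forall>x\<in>S. f differentiable (at x)) \<and> (\<forall>v. C_k_on k S (\<lambda>x. frechet_derivative f (at x) v))"

definition smooth_on :: "'a set \<Rightarrow> ('a::real_normed_vector \<Rightarrow> 'b::real_normed_vector) \<Rightarrow> bool" where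
  "smooth_on S f \<longleftrightarrow> (\<forall>k. C_k_on k S f)"

text \<open>A chart is a pair of a domain and a coordinate map; the values of the map outside the domain
  are irrelevant.\<close>

type_synonym ('m, 'e) chart = "'m set \<times> ('m \<Rightarrow> 'e)"

definition is_chart :: "('m::topological_space, 'e::euclidean_space) chart \<Rightarrow> bool" where
  "is_chart c \<longleftrightarrow> (case c of (U, \<psi>) \<Rightarrow>
     open U \<and> open (\<psi> ` U) \<and> homeomorphism U (\<psi> ` U) \<psi> (inv_into U \<psi>))"

text \<open>The carrier of a manifold is a whole type, so it is nonempty, and the dimension of a type of
  class \<open>euclidean_space\<close> is finite and nonzero. Paracompactness follows from the other
  conditions. The atlas need not be maximal.\<close>

locale smooth_manifold =
  fixes \<A> :: "('m::{t2_space, second_countable_topology}, 'e::euclidean_space) chart set"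
  assumes charts: "c \<in> \<A> \<Longrightarrow> is_chart c"
    and covering: "(\<Union>c\<in>\<A>. fst c) = UNIV"
    and compatible: "(U, \<psi>) \<in> \<A> \<Longrightarrow> (V, \<eta>) \<in> \<A> \<Longrightarrow> smooth_on (\<psi> ` (U \<inter> V)) (\<eta> \<circ> inv_into U \<psi>)"

text \<open>The next definition is meant for open \<open>W\<close>.\<close>

definition smooth_map_on ::
  "'m set \<Rightarrow> ('m::topological_space, 'e::euclidean_space) chart set \<Rightarrow>
   ('n::topological_space, 'f::euclidean_space) chart set \<Rightarrow> ('m \<Rightarrow> 'n) \<Rightarrow> bool" where
  "smooth_map_on W \<A> \<B> f \<longleftrightarrow> continuous_on W f \<and>
     (\<forall>(U, \<psi>)\<in>\<A>. \<forall>(V, \<eta>)\<in>\<B>. smooth_on (\<psi> ` (U \<inter> W \<inter> f -` V)) (\<eta> \<circ> f \<circ> inv_into U \<psi>))"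

abbreviation smooth_map ::
  "('m::topological_space, 'e::euclidean_space) chart set \<Rightarrow>
   ('n::topological_space, 'f::euclidean_space) chart set \<Rightarrow> ('m \<Rightarrow> 'n) \<Rightarrow> bool" where
  "smooth_map \<equiv> smooth_map_on UNIV"

definition std_atlas :: "('e::euclidean_space, 'e) chart set" where
  "std_atlas = {(UNIV, id)}"

definition prod_atlas ::
  "('m, 'e) chart set \<Rightarrow> ('n, 'f) chart set \<Rightarrow> ('m \<times> 'n, 'e \<times> 'f) chart set" where
  "prod_atlas \<A> \<B> = {(U \<times> V, map_prod \<psi> \<eta>) |U \<psi> V \<eta>. (U, \<psi>) \<in> \<A> \<and> (V, \<eta>) \<in> \<B>}"

text \<open>\<open>HOL-Algebra\<close> uses the notation \<open>inv\<close> for group inverses, so the inverse of a bijection is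
  written \<open>inv_into UNIV\<close>.\<close>

definition diffeomorphism ::
  "('m::topological_space, 'e::euclidean_space) chart set \<Rightarrow>
   ('n::topological_space, 'f::euclidean_space) chart set \<Rightarrow> ('m \<Rightarrow> 'n) \<Rightarrow> bool" where
  "diffeomorphism \<A> \<B> \<phi> \<longleftrightarrow> bij \<phi> \<and> smooth_map \<A> \<B> \<phi> \<and> smooth_map \<B> \<A> (inv_into UNIV \<phi>)"

abbreviation smooth_fun :: "('m::topological_space, 'e::euclidean_space) chart set \<Rightarrow> ('m \<Rightarrow> real) \<Rightarrow> bool" where
  "smooth_fun \<A> \<equiv> smooth_map \<A> std_atlas"


section \<open>Vector fields\<close>

text \<open>Tangent vectors at \<open>p\<close> are the point derivations at \<open>p\<close> of the algebra of smooth functions.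
  They are extended by \<open>0\<close> to nonsmooth arguments, so that equal derivations are equal
  as HOL functions.\<close>

type_synonym 'm tangent_vector = "('m \<Rightarrow> real) \<Rightarrow> real"
type_synonym 'm vector_field = "'m \<Rightarrow> 'm tangent_vector"

definition tangent_space ::
  "('m::topological_space, 'e::euclidean_space) chart set \<Rightarrow> 'm \<Rightarrow> 'm tangent_vector set" where
  "tangent_space \<A> p = {x.
     (\<forall>f g. smooth_fun \<A> f \<longrightarrow> smooth_fun \<A> g \<longrightarrow> x (\<lambda>q. f q + g q) = x f + x g) \<and>
     (\<forall>c f. smooth_fun \<A> f \<longrightarrow> x (\<lambda>q. c * f q) = c * x f) \<and>
     (\<forall>f g. smooth_fun \<A> f \<longrightarrow> smooth_fun \<A> g \<longrightarrow> x (\<lambda>q. f q * g q) = x f * g p + f p * x g) \<and>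
     (\<forall>f. \<not> smooth_fun \<A> f \<longrightarrow> x f = 0)}"

text \<open>The tangent map of \<open>\<phi>\<close> at any point; \<open>\<B>\<close> is the atlas of the target manifold.\<close>

definition tangent_map ::
  "('n::topological_space, 'f::euclidean_space) chart set \<Rightarrow> ('m \<Rightarrow> 'n) \<Rightarrow>
   'm tangent_vector \<Rightarrow> 'n tangent_vector" where
  "tangent_map \<B> \<phi> x = (\<lambda>f. if smooth_fun \<B> f then x (f \<circ> \<phi>) else 0)"

definition vector_fields ::
  "('m::topological_space, 'e::euclidean_space) chart set \<Rightarrow> 'm vector_field set" where
  "vector_fields \<A> = {X. (\<forall>p. X p \<in> tangent_space \<A> p) \<and>
     (\<forall>f. smooth_fun \<A> f \<longrightarrow> smooth_fun \<A> (\<lambda>p. X p f))}"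

definition vf_add :: "'m vector_field \<Rightarrow> 'm vector_field \<Rightarrow> 'm vector_field" where
  "vf_add X Y = (\<lambda>p f. X p f + Y p f)"

definition vf_scale :: "real \<Rightarrow> 'm vector_field \<Rightarrow> 'm vector_field" where
  "vf_scale c X = (\<lambda>p f. c * X p f)"

definition vf_bracket :: "'m vector_field \<Rightarrow> 'm vector_field \<Rightarrow> 'm vector_field" where
  "vf_bracket X Y = (\<lambda>p f. X p (\<lambda>q. Y q f) - Y p (\<lambda>q. X q f))"

text \<open>Isomorphisms between real Lie algebras of vector fields. Only the values of \<open>\<Phi>\<close> on \<open>L\<close>
  matter.\<close>

definition lie_iso ::
  "'m vector_field set \<Rightarrow> 'n vector_field set \<Rightarrow> ('m vector_field \<Rightarrow> 'n vector_field) \<Rightarrow> bool" where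
  "lie_iso L L' \<Phi> \<longleftrightarrow> bij_betw \<Phi> L L' \<and>
     (\<forall>X\<in>L. \<forall>Y\<in>L. \<Phi> (vf_add X Y) = vf_add (\<Phi> X) (\<Phi> Y)) \<and>
     (\<forall>c. \<forall>X\<in>L. \<Phi> (vf_scale c X) = vf_scale c (\<Phi> X)) \<and>
     (\<forall>X\<in>L. \<forall>Y\<in>L. \<Phi> (vf_bracket X Y) = vf_bracket (\<Phi> X) (\<Phi> Y))"

text \<open>For bijective \<open>\<phi>\<close>: \<open>(\<phi>\<^sub>* v) f = (v (f \<circ> \<phi>)) \<circ> \<phi>\<^sup>-\<^sup>1\<close>.\<close>

definition pushforward :: "('m \<Rightarrow> 'n) \<Rightarrow> 'm vector_field \<Rightarrow> 'n vector_field" where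
  "pushforward \<phi> v = (\<lambda>q f. v (inv_into UNIV \<phi> q) (f \<circ> \<phi>))"


section \<open>Principal bundles\<close>

locale lie_group = smooth_manifold \<G> + group G
  for G :: "'g::{t2_space, second_countable_topology} monoid"
    and \<G> :: "('g, 'h::euclidean_space) chart set" +
  assumes carrier_UNIV: "carrier G = UNIV"
    and smooth_mult: "smooth_map (prod_atlas \<G> \<G>) \<G> (\<lambda>(g, h). g \<otimes>\<^bsub>G\<^esub> h)"
    and smooth_inv: "smooth_map \<G> \<G> (\<lambda>g. inv\<^bsub>G\<^esub> g)"

text \<open>The right action is \<open>act u g\<close>. The maps \<open>\<tau>\<close> are the equivariant local trivializations.\<close>

locale principal_bundle =
  structure_group: lie_group G \<G> + total: smooth_manifold \<P> + base: smooth_manifold \<M>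
  for G :: "'g::{t2_space, second_countable_topology} monoid"
    and \<G> :: "('g, 'h::euclidean_space) chart set"
    and \<P> :: "('p::{t2_space, second_countable_topology}, 'd::euclidean_space) chart set"
    and \<M> :: "('m::{t2_space, second_countable_topology}, 'e::euclidean_space) chart set" +
  fixes \<pi> :: "'p \<Rightarrow> 'm"
    and act :: "'p \<Rightarrow> 'g \<Rightarrow> 'p"
  assumes smooth_proj: "smooth_map \<P> \<M> \<pi>"
    and smooth_act: "smooth_map (prod_atlas \<P> \<G>) \<P> (\<lambda>(u, g). act u g)"
    and act_one: "act u \<one>\<^bsub>G\<^esub> = u"
    and act_mult: "act u (g \<otimes>\<^bsub>G\<^esub> h) = act (act u g) h"
    and locally_trivial: "\<exists>U \<tau> \<sigma>. open U \<and> m \<in> U \<and>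
          homeomorphism (U \<times> UNIV) (\<pi> -` U) \<tau> \<sigma> \<and>
          smooth_map_on (U \<times> UNIV) (prod_atlas \<M> \<G>) \<P> \<tau> \<and>
          smooth_map_on (\<pi> -` U) \<P> (prod_atlas \<M> \<G>) \<sigma> \<and>
          (\<forall>x\<in>U. \<forall>g. \<pi> (\<tau> (x, g)) = x) \<and>
          (\<forall>x\<in>U. \<forall>g h. \<tau> (x, g \<otimes>\<^bsub>G\<^esub> h) = act (\<tau> (x, g)) h)"


section \<open>The Atiyah algebroid\<close>

text \<open>A tangent vector \<open>x\<close> at \<open>u\<close> is represented by the pair \<open>(u, x)\<close>.\<close>

definition atiyah_class ::
  "('p::topological_space, 'd::euclidean_space) chart set \<Rightarrow> ('p \<Rightarrow> 'g \<Rightarrow> 'p) \<Rightarrow>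
   'p \<times> 'p tangent_vector \<Rightarrow> ('p \<times> 'p tangent_vector) set" where
  "atiyah_class \<P> act = (\<lambda>(u, x). {(act u g, tangent_map \<P> (\<lambda>w. act w g) x) |g. True})"

definition atiyah_fibre ::
  "('p::topological_space, 'd::euclidean_space) chart set \<Rightarrow> ('p \<Rightarrow> 'm) \<Rightarrow> ('p \<Rightarrow> 'g \<Rightarrow> 'p) \<Rightarrow>
   'm \<Rightarrow> ('p \<times> 'p tangent_vector) set set" where
  "atiyah_fibre \<P> \<pi> act m = {atiyah_class \<P> act (u, x) |u x. \<pi> u = m \<and> x \<in> tangent_space \<P> u}"

definition class_anchor ::
  "('m::topological_space, 'e::euclidean_space) chart set \<Rightarrow> ('p \<Rightarrow> 'm) \<Rightarrow>
   ('p \<times> 'p tangent_vector) set \<Rightarrow> 'm tangent_vector" where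
  "class_anchor \<M> \<pi> c = the_elem ((\<lambda>(u, x). tangent_map \<M> \<pi> x) ` c)"

text \<open>Sections of the Atiyah algebroid are identified with invariant vector fields \<open>X\<close> on the total
  space; the value at \<open>m\<close> of the section is the class \<open>section_value \<pi> X m\<close>.\<close>

definition atiyah_sections ::
  "('p::topological_space, 'd::euclidean_space) chart set \<Rightarrow> ('p \<Rightarrow> 'g \<Rightarrow> 'p) \<Rightarrow> 'p vector_field set" where
  "atiyah_sections \<P> act = {X \<in> vector_fields \<P>.
     \<forall>u g. X (act u g) = tangent_map \<P> (\<lambda>w. act w g) (X u)}"

definition section_value ::
  "('p \<Rightarrow> 'm) \<Rightarrow> 'p vector_field \<Rightarrow> 'm \<Rightarrow> ('p \<times> 'p tangent_vector) set" where
  "section_value \<pi> X m = {(u, X u) |u. \<pi> u = m}"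

definition anchor ::
  "('m::topological_space, 'e::euclidean_space) chart set \<Rightarrow> ('p \<Rightarrow> 'm) \<Rightarrow>
   'p vector_field \<Rightarrow> 'm vector_field" where
  "anchor \<M> \<pi> X = (\<lambda>m. class_anchor \<M> \<pi> (section_value \<pi> X m))"

definition anchor_kernel ::
  "('p::topological_space, 'd::euclidean_space) chart set \<Rightarrow>
   ('m::topological_space, 'e::euclidean_space) chart set \<Rightarrow> ('p \<Rightarrow> 'm) \<Rightarrow> ('p \<Rightarrow> 'g \<Rightarrow> 'p) \<Rightarrow>
   'p vector_field set" where
  "anchor_kernel \<P> \<M> \<pi> act = {a \<in> atiyah_sections \<P> act. anchor \<M> \<pi> a = (\<lambda>m f. 0)}"

definition isotropy_sections ::
  "('p::topological_space, 'd::euclidean_space) chart set \<Rightarrow>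
   ('m::topological_space, 'e::euclidean_space) chart set \<Rightarrow> ('p \<Rightarrow> 'm) \<Rightarrow> ('p \<Rightarrow> 'g \<Rightarrow> 'p) \<Rightarrow>
   'm \<Rightarrow> 'p vector_field set" where
  "isotropy_sections \<P> \<M> \<pi> act m = {a \<in> atiyah_sections \<P> act. anchor \<M> \<pi> a m = (\<lambda>f. 0)}"

context principal_bundle
begin

lemma trivialize_fibre:
  "\<exists>t s. (\<forall>w. \<pi> w = m \<longrightarrow> t (s w) = w) \<and> (\<forall>g. \<pi> (t g) = m) \<and>
     (\<forall>g h. t (g \<otimes>\<^bsub>G\<^esub> h) = act (t g) h)"
proof -
  obtain U \<tau> \<sigma> where m: "m \<in> U" and hom: "homeomorphism (U \<times> UNIV) (\<pi> -` U) \<tau> \<sigma>"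
    and proj: "\<And>x g. x \<in> U \<Longrightarrow> \<pi> (\<tau> (x, g)) = x"
    and equi: "\<And>x g h. x \<in> U \<Longrightarrow> \<tau> (x, g \<otimes>\<^bsub>G\<^esub> h) = act (\<tau> (x, g)) h"
    using locally_trivial[of m] by blast
  show ?thesis
  proof (intro exI[of _ "\<lambda>g. \<tau> (m, g)"] exI[of _ "\<lambda>w. snd (\<sigma> w)"] conjI allI impI)
    fix w assume "\<pi> w = m"
    then have w: "w \<in> \<pi> -` U" using m by simp
    obtain x g where xg: "\<sigma> w = (x, g)" by (cases "\<sigma> w")
    have "\<sigma> w \<in> U \<times> UNIV"
      using homeomorphism_image2[OF hom] w by (metis imageI)
    then have "x \<in> U" using xg by simp
    moreover have "\<tau> (x, g) = w" using homeomorphism_apply2[OF hom w] xg by simp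
    ultimately show "\<tau> (m, snd (\<sigma> w)) = w"
      using proj[of x g] \<open>\<pi> w = m\<close> xg by simp
  qed (rule proj[OF m] equi[OF m])+
qed

lemma proj_act: "\<pi> (act u g) = \<pi> u"
proof -
  obtain t s where t: "\<forall>w. \<pi> w = \<pi> u \<longrightarrow> t (s w) = w" "\<forall>g. \<pi> (t g) = \<pi> u"
    "\<forall>g h. t (g \<otimes>\<^bsub>G\<^esub> h) = act (t g) h"
    using trivialize_fibre[of "\<pi> u"] by blast
  have "act u g = t (s u \<otimes>\<^bsub>G\<^esub> g)" using t by simp
  then show ?thesis using t(2) by simp
qed

lemma fibre_transitive:
  assumes "\<pi> w = \<pi> u"
  shows "\<exists>g. w = act u g"
proof -
  obtain t s where t: "\<forall>w. \<pi> w = \<pi> u \<longrightarrow> t (s w) = w" "\<forall>g. \<pi> (t g) = \<pi> u"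
    "\<forall>g h. t (g \<otimes>\<^bsub>G\<^esub> h) = act (t g) h"
    using trivialize_fibre[of "\<pi> u"] by blast
  have "s u \<otimes>\<^bsub>G\<^esub> (inv\<^bsub>G\<^esub> (s u) \<otimes>\<^bsub>G\<^esub> s w) = s w"
    by (simp add: structure_group.carrier_UNIV flip: structure_group.m_assoc)
  then have "w = act u (inv\<^bsub>G\<^esub> (s u) \<otimes>\<^bsub>G\<^esub> s w)"
    using assms t(1,3) by metis
  then show ?thesis ..
qed

lemma proj_surj: "surj \<pi>"
proof -
  have "\<exists>u. m = \<pi> u" for m
    using trivialize_fibre[of m] by metis
  then show ?thesis by (simp add: surj_def)
qed

lemma section_value_in_fibre:
  assumes "X \<in> atiyah_sections \<P> act"
  shows "section_value \<pi> X (\<pi> u) = atiyah_class \<P> act (u, X u)"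
    and "section_value \<pi> X m \<in> atiyah_fibre \<P> \<pi> act m"
proof -
  show *: "section_value \<pi> X (\<pi> u) = atiyah_class \<P> act (u, X u)" for u
  proof -
    have inv: "X (act u g) = tangent_map \<P> (\<lambda>w. act w g) (X u)" for g
      using assms by (simp add: atiyah_sections_def)
    have "section_value \<pi> X (\<pi> u) = {(act u g, X (act u g)) |g. True}"
    proof (intro equalityI subsetI)
      fix z assume "z \<in> section_value \<pi> X (\<pi> u)"
      then obtain w where "z = (w, X w)" "\<pi> w = \<pi> u" by (auto simp: section_value_def)
      with fibre_transitive[of w u] show "z \<in> {(act u g, X (act u g)) |g. True}" by blast
    qed (auto simp: section_value_def proj_act)
    then show ?thesis
      by (simp add: atiyah_class_def inv)
  qed
  obtain u where u: "\<pi> u = m" using proj_surj by (metis surjD)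
  have "X u \<in> tangent_space \<P> u"
    using assms by (simp add: atiyah_sections_def vector_fields_def)
  then show "section_value \<pi> X m \<in> atiyah_fibre \<P> \<pi> act m"
    using *[of u] u unfolding atiyah_fibre_def by blast
qed

lemma anchor_proj:
  assumes "X \<in> atiyah_sections \<P> act"
  shows "anchor \<M> \<pi> X (\<pi> u) = tangent_map \<M> \<pi> (X u)"
proof -
  have nonsmooth: "X u f = 0" if "\<not> smooth_fun \<P> f" for f
    using assms that by (simp add: atiyah_sections_def vector_fields_def tangent_space_def)
  have "tangent_map \<M> \<pi> (tangent_map \<P> (\<lambda>w. act w g) (X u)) = tangent_map \<M> \<pi> (X u)" for g
    by (rule ext) (simp add: tangent_map_def o_def proj_act nonsmooth)
  then have "tangent_map \<M> \<pi> (snd z) = tangent_map \<M> \<pi> (X u)"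
    if "z \<in> atiyah_class \<P> act (u, X u)" for z
    using that by (auto simp: atiyah_class_def)
  moreover obtain z where "z \<in> atiyah_class \<P> act (u, X u)"
    by (auto simp: atiyah_class_def)
  ultimately have "(\<lambda>z. tangent_map \<M> \<pi> (snd z)) ` atiyah_class \<P> act (u, X u) = {tangent_map \<M> \<pi> (X u)}"
    by (metis (no_types, lifting) image_cong image_constant)
  then show ?thesis
    by (simp add: anchor_def class_anchor_def case_prod_unfold section_value_in_fibre(1)[OF assms])
qed

end

end

(*
  The points m of M are recovered from the Lie algebra A of sections through the isotropy subalgebras
  A_m. These are characterized, up to inclusion, by properties that every isomorphism preserves.
  Let S be a subalgebra whose core {a in S. [a, A] <= S} has, roughly, finite codimension. For a section
  a and a function f there are many polynomials p such that p(f) a lies in the core. Combining brackets of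
  such elements gives a nonzero polynomial w such that w(f) rho(a)(f)^3 multiplies A into S, where rho
  is the anchor. The functions with this property form an ideal J, stable under the derivations rho(s) with s
  in S. If rho(s) does not vanish at m for some s in S, differentiating lowers the order of vanishing of w(f) at m,
  so that some j in J has j(m) ~= 0. Hence either S <= A_m for some m, or S contains all sections with compact
  support. The second case is excluded by a countability condition: there is a sequence outside S
  meeting every ideal not contained in S. It holds for A_m, because an ideal containing an element b
  with rho(b)_m ~= 0 contains all sections supported near m.
  An isomorphism Phi therefore induces a bijection phi of the points with Phi(A_m) = A_phi(m). As
  f a - f(m) a lies in A_m, Phi(f a) agrees with (f o phi^-1) Phi(a) up to the kernel of the anchor, so
  f o phi^-1 is locally a quotient of smooth functions. The Leibniz rule for [a, f b] then shows that
  the induced map on vector fields is the push-forward along phi.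
*)

theory Submission
  imports Defs
begin

section \<open>Calculus on open sets\<close>

text \<open>\<open>\<Phi>\<close> is only real-linear, so multiplication by functions is invisible
  to it. What is to be transported must be phrased with brackets and real combinations, and
  functions re-enter through the Leibniz rule alone; this is why several arguments end by dividing
  by some rho(a)(f). Codimension is tested on the sequences f^i t a, where a linear combination is a
  polynomial in f; Wronskians p q' - q p' of two such polynomials then remove the unwanted terms.
  The cube arises as follows. A first Wronskian puts all multiples of t a into S, where t = w(f)
  rho(a)(f) for a nonzero polynomial w. A second one is run with t^2: the derivatives of t^2 keep a
  factor t, so its error terms lie among those multiples, and the Wronskian itself brings the third
  factor rho(a)(f). M need not be compact, so J may have no common zero and still be proper; this is
  the obstacle that calls for the countability condition. Since tangent vectors are derivations of
  global functions, each local argument has to be carried by bump functions, and coordinates enter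
  by Hadamard's lemma.\<close>

lemma C_k_on_subset: "C_k_on k S f \<Longrightarrow> T \<subseteq> S \<Longrightarrow> C_k_on k T f"
  by (induction k arbitrary: f) (auto intro: continuous_on_subset)

lemma C_k_on_Suc_has_derivative:
  "C_k_on (Suc k) S f \<Longrightarrow> x \<in> S \<Longrightarrow> (f has_derivative frechet_derivative f (at x)) (at x)"
  by (simp add: frechet_derivative_works)

lemma C_k_on_continuous: "C_k_on k S f \<Longrightarrow> continuous_on S f"
  by (cases k) (auto intro!: continuous_at_imp_continuous_on differentiable_imp_continuous_within)

lemma C_k_on_SucD: "C_k_on (Suc k) S f \<Longrightarrow> C_k_on k S f"
proof (induction k arbitrary: f)
  case 0
  then show ?case using C_k_on_continuous[of "Suc 0" S f] by simp
next
  case (Suc k)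
  then show ?case by (metis C_k_on.simps(2))
qed

lemma C_k_on_cong:
  assumes "open S" "\<And>x. x \<in> S \<Longrightarrow> f x = g x" "C_k_on k S f"
  shows "C_k_on k S g"
  using assms(2,3)
proof (induction k arbitrary: f g)
  case 0
  then show ?case by (simp cong: continuous_on_cong)
next
  case (Suc k)
  have g: "(g has_derivative frechet_derivative f (at x)) (at x)" if "x \<in> S" for x
    using has_derivative_transform_within_open[OF C_k_on_Suc_has_derivative[OF Suc.prems(2) that] assms(1) that]
      Suc.prems(1) by blast
  have eq: "frechet_derivative f (at x) = frechet_derivative g (at x)" if "x \<in> S" for x
    using frechet_derivative_at[OF g[OF that]] .
  have "C_k_on k S (\<lambda>x. frechet_derivative g (at x) v)" for v
    by (rule Suc.IH[of "\<lambda>x. frechet_derivative f (at x) v"]) (use Suc.prems(2) eq in auto)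
  with g show ?case by (auto simp: differentiable_def)
qed

text \<open>Allows any formula for the derivative in place of the choice made by
  \<open>frechet_derivative\<close>; the two agree at points of \<open>S\<close>, and
  \<open>C_k_on_cong\<close> transfers the class because \<open>S\<close> is open.\<close>

lemma C_k_on_SucI:
  assumes "open S" "\<And>x. x \<in> S \<Longrightarrow> (f has_derivative f' x) (at x)" "\<And>v. C_k_on k S (\<lambda>x. f' x v)"
  shows "C_k_on (Suc k) S f"
proof -
  have "C_k_on k S (\<lambda>x. frechet_derivative f (at x) v)" for v
    by (rule C_k_on_cong[OF assms(1) _ assms(3)[of v]]) (metis assms(2) frechet_derivative_at)
  with assms(2) show ?thesis by (auto simp: differentiable_def)
qed

lemma C_k_on_local:
  assumes "\<And>x. x \<in> S \<Longrightarrow> \<exists>T. open T \<and> x \<in> T \<and> C_k_on k T f"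
  shows "C_k_on k S f"
  using assms
proof (induction k arbitrary: f)
  case 0
  then show ?case
    using continuous_on_eq_continuous_at
    by (fastforce intro!: continuous_at_imp_continuous_on)
next
  case (Suc k)
  have "f differentiable (at x)" if "x \<in> S" for x
    using Suc.prems[OF that] by auto
  moreover have "C_k_on k S (\<lambda>x. frechet_derivative f (at x) v)" for v
    by (rule Suc.IH) (use Suc.prems in force)
  ultimately show ?case by simp
qed

lemma C_k_on_const: "open S \<Longrightarrow> C_k_on k S (\<lambda>x. c)"
proof (induction k arbitrary: c)
  case (Suc k)
  then show ?case by (intro C_k_on_SucI[where f' = "\<lambda>x v. 0"]) auto
qed simp

lemma C_k_on_bounded_linear:
  assumes "open S" "bounded_linear h"
  shows "C_k_on k S h"
proof (cases k)
  case 0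
  then show ?thesis using assms by (simp add: linear_continuous_on)
next
  case (Suc k)
  then show ?thesis
    using assms C_k_on_SucI[where f = h and f' = "\<lambda>x. h"] C_k_on_const bounded_linear_imp_has_derivative
    by blast
qed

lemma C_k_on_add:
  assumes "open S" "C_k_on k S f" "C_k_on k S g"
  shows "C_k_on k S (\<lambda>x. f x + g x)"
  using assms(2,3)
proof (induction k arbitrary: f g)
  case 0
  then show ?case by (simp add: continuous_on_add)
next
  case (Suc k)
  show ?case
    by (rule C_k_on_SucI[OF assms(1) has_derivative_add[OF C_k_on_Suc_has_derivative[OF Suc.prems(1)] C_k_on_Suc_has_derivative[OF Suc.prems(2)]]])
      (use Suc in auto)
qed

lemma C_k_on_scaleR:
  fixes r :: "'a::real_normed_vector \<Rightarrow> real"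
  assumes "open S" "C_k_on k S r" "C_k_on k S g"
  shows "C_k_on k S (\<lambda>x. r x *\<^sub>R g x)"
  using assms(2,3)
proof (induction k arbitrary: r g)
  case 0
  then show ?case by (simp add: continuous_on_scaleR)
next
  case (Suc k)
  show ?case
  proof (rule C_k_on_SucI[OF assms(1) has_derivative_scaleR[OF C_k_on_Suc_has_derivative[OF Suc.prems(1)] C_k_on_Suc_has_derivative[OF Suc.prems(2)]]])
    fix v
    show "C_k_on k S (\<lambda>x. r x *\<^sub>R frechet_derivative g (at x) v + frechet_derivative r (at x) v *\<^sub>R g x)"
      using Suc.prems by (intro C_k_on_add Suc.IH assms(1) C_k_on_SucD[OF Suc.prems(1)] C_k_on_SucD[OF Suc.prems(2)]) auto
  qed
qed

lemma C_k_on_mult: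
  fixes f g :: "'a::real_normed_vector \<Rightarrow> real"
  shows "open S \<Longrightarrow> C_k_on k S f \<Longrightarrow> C_k_on k S g \<Longrightarrow> C_k_on k S (\<lambda>x. f x * g x)"
  using C_k_on_scaleR[of S k f g] by simp

lemma C_k_on_sum:
  assumes "open S" "\<And>i. i \<in> I \<Longrightarrow> C_k_on k S (f i)"
  shows "C_k_on k S (\<lambda>x. \<Sum>i\<in>I. f i x)"
  using assms(2)
  by (induction I rule: infinite_finite_induct) (auto intro!: C_k_on_add C_k_on_const assms(1))

lemma C_k_on_linear_compose:
  assumes "open S" "bounded_linear h" "C_k_on k S f"
  shows "C_k_on k S (\<lambda>x. h (f x))"
  using assms(3)
proof (induction k arbitrary: f)
  case 0
  then show ?case using assms(2) by (simp add: bounded_linear.continuous_on)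
next
  case (Suc k)
  show ?case
    by (rule C_k_on_SucI[OF assms(1) bounded_linear.has_derivative[OF assms(2) C_k_on_Suc_has_derivative[OF Suc.prems(1)]]])
      (use Suc in auto)
qed

lemma linear_basis_expansion:
  fixes D :: "'a::euclidean_space \<Rightarrow> 'b::real_vector"
  assumes "linear D"
  shows "D v = (\<Sum>b\<in>Basis. (v \<bullet> b) *\<^sub>R D b)"
proof -
  have "D (\<Sum>b\<in>Basis. (v \<bullet> b) *\<^sub>R b) = (\<Sum>b\<in>Basis. (v \<bullet> b) *\<^sub>R D b)"
    by (simp only: linear_sum[OF assms] linear_cmul[OF assms])
  then show ?thesis by (simp only: euclidean_representation)
qed

text \<open>In the chain rule the direction in which \<open>g\<close> is differentiated varies with
  \<open>x\<close>. Expanding it in \<open>Basis\<close> leaves a sum of products with directional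
  derivatives of \<open>g\<close> in fixed directions, to which the induction hypothesis
  applies.\<close>

lemma C_k_on_compose:
  fixes f :: "'a::real_normed_vector \<Rightarrow> 'b::euclidean_space"
  assumes "open S" "open T" "f ` S \<subseteq> T" "C_k_on k S f" "C_k_on k T g"
  shows "C_k_on k S (\<lambda>x. g (f x))"
  using assms(4,5)
proof (induction k arbitrary: g)
  case 0
  then show ?case using assms(3) by (auto intro: continuous_on_compose2)
next
  case (Suc k)
  let ?f' = "\<lambda>x. frechet_derivative f (at x)" and ?g' = "\<lambda>y. frechet_derivative g (at y)"
  have D: "((\<lambda>x. g (f x)) has_derivative (\<lambda>v. \<Sum>b\<in>Basis. (?f' x v \<bullet> b) *\<^sub>R ?g' (f x) b)) (at x)" if "x \<in> S" for x
  proof -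
    have f: "(f has_derivative ?f' x) (at x)" and g: "(g has_derivative ?g' (f x)) (at (f x))"
      using C_k_on_Suc_has_derivative[OF Suc.prems(1) that]
        C_k_on_Suc_has_derivative[OF Suc.prems(2), of "f x"] that assms(3) by auto
    have "linear (?g' (f x))" using g has_derivative_linear by blast
    then have "?g' (f x) (?f' x v) = (\<Sum>b\<in>Basis. (?f' x v \<bullet> b) *\<^sub>R ?g' (f x) b)" for v
      by (rule linear_basis_expansion)
    with has_derivative_compose[OF f g] show ?thesis by simp
  qed
  show ?case
  proof (rule C_k_on_SucI[OF assms(1) D])
    fix v
    have "C_k_on k S (\<lambda>x. ?f' x v \<bullet> b)" for b
      using Suc.prems(1) by (auto intro!: C_k_on_linear_compose[OF assms(1) bounded_linear_inner_left])
    moreover have "C_k_on k S (\<lambda>x. ?g' (f x) b)" for b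
      using Suc.prems C_k_on_SucD[OF Suc.prems(1)] by (intro Suc.IH) auto
    ultimately show "C_k_on k S (\<lambda>x. \<Sum>b\<in>Basis. (?f' x v \<bullet> b) *\<^sub>R ?g' (f x) b)"
      by (intro C_k_on_sum C_k_on_scaleR assms(1)) auto
  qed
qed

lemma C_k_on_Pair:
  assumes "open S" "C_k_on k S f" "C_k_on k S g"
  shows "C_k_on k S (\<lambda>x. (f x, g x))"
  using assms(2,3)
proof (induction k arbitrary: f g)
  case 0
  then show ?case by (simp add: continuous_on_Pair)
next
  case (Suc k)
  show ?case
    by (rule C_k_on_SucI[OF assms(1) has_derivative_Pair[OF C_k_on_Suc_has_derivative[OF Suc.prems(1)] C_k_on_Suc_has_derivative[OF Suc.prems(2)]]])
      (use Suc in auto)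
qed

text \<open>The derivative is a polynomial in \<open>inverse\<close> itself, so the induction closes
  under products.\<close>

lemma C_k_on_inverse: "C_k_on k (- {0}) (inverse :: real \<Rightarrow> real)"
proof (induction k)
  case 0
  then show ?case by (auto intro!: continuous_intros)
next
  case (Suc k)
  show ?case
  proof (rule C_k_on_SucI)
    show "(inverse has_derivative (\<lambda>v::real. - (inverse x * inverse x) * v)) (at x)" if "x \<in> - {0}" for x
      using that by (auto intro!: derivative_eq_intros simp: power2_eq_square algebra_simps)
    show "C_k_on k (- {0}) (\<lambda>x. - (inverse x * inverse x) * v)" for v :: real
      using C_k_on_mult[OF _ C_k_on_const[of "- {0}" k "- v"] C_k_on_mult[OF _ Suc Suc]]
      by (auto simp: mult_ac open_Compl)
  qed (simp add: open_Compl)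
qed

section \<open>Closure properties of smooth functions on open sets\<close>

lemma smooth_on_subset: "smooth_on S f \<Longrightarrow> T \<subseteq> S \<Longrightarrow> smooth_on T f"
  by (auto simp: smooth_on_def intro: C_k_on_subset)

lemma smooth_on_cong: "open S \<Longrightarrow> smooth_on S f \<Longrightarrow> (\<And>x. x \<in> S \<Longrightarrow> f x = g x) \<Longrightarrow> smooth_on S g"
  unfolding smooth_on_def using C_k_on_cong[of S f g] by blast

lemma smooth_on_local:
  "(\<And>x. x \<in> S \<Longrightarrow> \<exists>T. open T \<and> x \<in> T \<and> smooth_on T f) \<Longrightarrow> smooth_on S f"
  unfolding smooth_on_def by (intro allI C_k_on_local) blast

lemma smooth_on_continuous: "smooth_on S f \<Longrightarrow> continuous_on S f"
  using C_k_on_continuous smooth_on_def by blast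

lemma smooth_on_has_derivative:
  "smooth_on S f \<Longrightarrow> x \<in> S \<Longrightarrow> (f has_derivative frechet_derivative f (at x)) (at x)"
  using C_k_on_Suc_has_derivative smooth_on_def by blast

lemma smooth_on_derivative:
  assumes "smooth_on S f"
  shows "smooth_on S (\<lambda>x. frechet_derivative f (at x) v)"
  unfolding smooth_on_def
proof
  fix k
  have "C_k_on (Suc k) S f" using assms by (simp add: smooth_on_def del: C_k_on.simps)
  then show "C_k_on k S (\<lambda>x. frechet_derivative f (at x) v)" by simp
qed

lemma smooth_on_const: "open S \<Longrightarrow> smooth_on S (\<lambda>x. c)"
  by (simp add: smooth_on_def C_k_on_const)

lemma smooth_on_bounded_linear: "open S \<Longrightarrow> bounded_linear h \<Longrightarrow> smooth_on S h"
  by (simp add: smooth_on_def C_k_on_bounded_linear)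

lemma smooth_on_id: "open S \<Longrightarrow> smooth_on S (\<lambda>x. x)"
  by (simp add: smooth_on_bounded_linear bounded_linear_ident)

lemma smooth_on_add: "open S \<Longrightarrow> smooth_on S f \<Longrightarrow> smooth_on S g \<Longrightarrow> smooth_on S (\<lambda>x. f x + g x)"
  by (simp add: smooth_on_def C_k_on_add)

lemma smooth_on_scaleR:
  fixes r :: "'a::real_normed_vector \<Rightarrow> real"
  shows "open S \<Longrightarrow> smooth_on S r \<Longrightarrow> smooth_on S g \<Longrightarrow> smooth_on S (\<lambda>x. r x *\<^sub>R g x)"
  by (simp add: smooth_on_def C_k_on_scaleR)

lemma smooth_on_mult:
  fixes f g :: "'a::real_normed_vector \<Rightarrow> real"
  shows "open S \<Longrightarrow> smooth_on S f \<Longrightarrow> smooth_on S g \<Longrightarrow> smooth_on S (\<lambda>x. f x * g x)"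
  by (simp add: smooth_on_def C_k_on_mult)

lemma smooth_on_sum:
  "open S \<Longrightarrow> (\<And>i. i \<in> I \<Longrightarrow> smooth_on S (f i)) \<Longrightarrow> smooth_on S (\<lambda>x. \<Sum>i\<in>I. f i x)"
  by (simp add: smooth_on_def C_k_on_sum)

lemma smooth_on_compose:
  fixes f :: "'a::real_normed_vector \<Rightarrow> 'b::euclidean_space"
  shows "open S \<Longrightarrow> open T \<Longrightarrow> f ` S \<subseteq> T \<Longrightarrow> smooth_on S f \<Longrightarrow> smooth_on T g \<Longrightarrow> smooth_on S (\<lambda>x. g (f x))"
  unfolding smooth_on_def using C_k_on_compose[of S T f] by blast

lemma smooth_on_Pair: "open S \<Longrightarrow> smooth_on S f \<Longrightarrow> smooth_on S g \<Longrightarrow> smooth_on S (\<lambda>x. (f x, g x))"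
  by (simp add: smooth_on_def C_k_on_Pair)

lemma smooth_on_inverse:
  fixes f :: "'a::real_normed_vector \<Rightarrow> real"
  assumes "open S" "smooth_on S f" "\<And>x. x \<in> S \<Longrightarrow> f x \<noteq> 0"
  shows "smooth_on S (\<lambda>x. inverse (f x))"
  by (rule smooth_on_compose[OF assms(1) _ _ assms(2), of "- {0}"])
    (use assms(3) C_k_on_inverse in \<open>auto simp: smooth_on_def\<close>)

lemma smooth_on_euclideanI:
  fixes f :: "'a::real_normed_vector \<Rightarrow> 'b::euclidean_space"
  assumes "open S" "\<And>b. b \<in> Basis \<Longrightarrow> smooth_on S (\<lambda>x. f x \<bullet> b)"
  shows "smooth_on S f"
proof -
  have "smooth_on S (\<lambda>x. \<Sum>b\<in>Basis. (f x \<bullet> b) *\<^sub>R b)"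
    by (intro smooth_on_sum smooth_on_scaleR assms smooth_on_const)
  then show ?thesis by (simp add: euclidean_representation)
qed

section \<open>A flat function and a smooth cutoff\<close>

text \<open>The derivatives of \<open>exp (- 1 / x)\<close> are of the form \<open>p (1 / x) * exp (- 1 / x)\<close> with \<open>p\<close> a polynomial.\<close>

definition flat_poly :: "real poly \<Rightarrow> real \<Rightarrow> real" where
  "flat_poly p x = (if x \<le> 0 then 0 else poly p (inverse x) * exp (- inverse x))"

lemma poly_exp_decay: "((\<lambda>y::real. poly p y * exp (- y)) \<longlongrightarrow> 0) at_top"
proof -
  have "((\<lambda>y::real. \<Sum>i\<le>degree p. coeff p i * (y ^ i / exp y)) \<longlongrightarrow> (\<Sum>i\<le>degree p. coeff p i * 0)) at_top"
    by (intro tendsto_intros tendsto_power_div_exp_0)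
  then show ?thesis
    by (simp add: poly_altdef sum_distrib_left exp_minus divide_inverse mult_ac)
qed

text \<open>With y = 1/x, the derivative of p(y) exp(-y) in x is y^2 (p - p')(y) exp(-y);
  \<open>monom 1 2\<close> is the factor y^2. At 0, dividing by h multiplies p by its variable,
  which the exponential still beats.\<close>

lemma flat_poly_has_derivative:
  "(flat_poly p has_real_derivative flat_poly (monom 1 2 * (p - pderiv p)) x) (at x)"
proof -
  consider "x < 0" | "x > 0" | "x = 0" by linarith
  then show ?thesis
  proof cases
    case 1
    have "((\<lambda>x. 0) has_real_derivative 0) (at x)" by simp
    then have "(flat_poly p has_real_derivative 0) (at x)"
      by (rule DERIV_cong_ev[THEN iffD1, rotated 3, OF _])
        (use 1 in \<open>auto simp: flat_poly_def eventually_nhds intro!: exI[of _ "{..<0}"]\<close>)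
    then show ?thesis using 1 by (simp add: flat_poly_def)
  next
    case 2
    have "((\<lambda>x. poly p (inverse x) * exp (- inverse x)) has_real_derivative
        flat_poly (monom 1 2 * (p - pderiv p)) x) (at x)"
      using 2 by (auto intro!: derivative_eq_intros simp: flat_poly_def poly_monom power2_eq_square algebra_simps)
    then show ?thesis
      by (rule DERIV_cong_ev[THEN iffD1, rotated 3, OF _])
        (use 2 in \<open>auto simp: flat_poly_def eventually_nhds intro!: exI[of _ "{0<..}"]\<close>)
  next
    case 3
    have "((\<lambda>h. flat_poly p h / h) \<longlongrightarrow> 0) (at_left 0)"
      by (rule tendsto_eventually) (auto simp: eventually_at_filter flat_poly_def intro!: eventuallyI)
    moreover have "((\<lambda>h. poly (pCons 0 p) (inverse h) * exp (- inverse h)) \<longlongrightarrow> 0) (at_right 0)"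
      using poly_exp_decay filterlim_inverse_at_top_right by (rule filterlim_compose)
    then have "((\<lambda>h. flat_poly p h / h) \<longlongrightarrow> 0) (at_right 0)"
      by (rule Lim_transform_eventually)
        (auto simp: eventually_at_filter flat_poly_def divide_inverse mult_ac intro!: eventuallyI)
    ultimately have "((\<lambda>h. flat_poly p h / h) \<longlongrightarrow> 0) (at 0)"
      by (simp add: filterlim_split_at)
    then show ?thesis using 3 by (simp add: DERIV_def flat_poly_def)
  qed
qed

lemma C_k_on_flat_poly: "C_k_on k UNIV (flat_poly p)"
proof (induction k arbitrary: p)
  case 0
  then show ?case
    using DERIV_isCont[OF flat_poly_has_derivative] by (simp add: continuous_at_imp_continuous_on)
next
  case (Suc k)
  show ?case
    by (rule C_k_on_SucI[OF _ flat_poly_has_derivative[unfolded has_field_derivative_def]])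
      (auto intro!: C_k_on_mult Suc C_k_on_const)
qed

definition flat :: "real \<Rightarrow> real" where
  "flat = flat_poly 1"

lemma smooth_on_flat: "smooth_on UNIV flat"
  by (simp add: smooth_on_def flat_def C_k_on_flat_poly)

lemma flat_pos_iff: "flat x > 0 \<longleftrightarrow> x > 0"
  and flat_nonneg: "flat x \<ge> 0"
  and flat_eq_0_iff: "flat x = 0 \<longleftrightarrow> x \<le> 0"
  by (auto simp: flat_def flat_poly_def)

text \<open>The denominator is positive, since 2 - t and t - 1 are never both nonpositive.\<close>

definition cutoff :: "real \<Rightarrow> real" where
  "cutoff t = flat (2 - t) * inverse (flat (2 - t) + flat (t - 1))"

lemma cutoff_eq_1: "t \<le> 1 \<Longrightarrow> cutoff t = 1"
  and cutoff_eq_0: "t \<ge> 2 \<Longrightarrow> cutoff t = 0"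
proof -
  show "t \<le> 1 \<Longrightarrow> cutoff t = 1"
    using flat_eq_0_iff[of "t - 1"] flat_eq_0_iff[of "2 - t"] by (simp add: cutoff_def)
  show "t \<ge> 2 \<Longrightarrow> cutoff t = 0"
    using flat_eq_0_iff[of "2 - t"] by (simp add: cutoff_def)
qed

lemma cutoff_nonneg: "cutoff t \<ge> 0"
  by (simp add: cutoff_def flat_nonneg)

lemma smooth_on_cutoff: "smooth_on UNIV cutoff"
proof -
  have affine: "smooth_on UNIV (\<lambda>t::real. a * t + b)" for a b
    by (intro smooth_on_add smooth_on_mult smooth_on_id smooth_on_const open_UNIV)
  have 1: "smooth_on UNIV (\<lambda>t. flat (a * t + b))" for a b
    by (rule smooth_on_compose[OF _ _ _ affine smooth_on_flat]) auto
  have "flat (- 1 * t + 2) + flat (1 * t + - 1) > 0" for t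
    using flat_nonneg[of "- 1 * t + 2"] flat_nonneg[of "1 * t + - 1"]
      flat_pos_iff[of "- 1 * t + 2"] flat_pos_iff[of "1 * t + - 1"] by linarith
  then have "smooth_on UNIV (\<lambda>t. flat (- 1 * t + 2) * inverse (flat (- 1 * t + 2) + flat (1 * t + - 1)))"
    by (intro smooth_on_mult smooth_on_inverse smooth_on_add 1 open_UNIV) (metis less_irrefl)
  then show ?thesis
    by (rule smooth_on_cong[rotated]) (auto simp: cutoff_def algebra_simps)
qed

section \<open>Hadamard's lemma\<close>

lemma segment_in_ball:
  fixes c :: "'a::euclidean_space"
  assumes "x \<in> ball c r" "t \<in> {0..1}"
  shows "c + t *\<^sub>R (x - c) \<in> ball c r"
proof -
  have "t * norm (x - c) \<le> norm (x - c)" using assms(2) by (simp add: mult_left_le_one_le)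
  then show ?thesis using assms by (simp add: dist_norm norm_minus_commute)
qed

text \<open>Each differentiation under the integral sign brings out a factor t from the inner map,
  so the induction has to run over all weights \<open>t ^ j\<close>. Hadamard's lemma uses j =
  0.\<close>

lemma C_k_on_segment_integral:
  fixes F :: "'a::euclidean_space \<Rightarrow> real"
  assumes "smooth_on (ball c r) F"
  shows "C_k_on k (ball c r) (\<lambda>x. integral {0..1} (\<lambda>t. t ^ j * F (c + t *\<^sub>R (x - c))))"
  using assms
proof (induction k arbitrary: F j)
  case 0
  have "continuous_on (ball c r \<times> cbox 0 1) (\<lambda>(x, t::real). t ^ j * F (c + t *\<^sub>R (x - c)))"
    unfolding case_prod_unfold
    by (intro continuous_intros continuous_on_compose2[OF smooth_on_continuous[OF 0]])
      (auto simp del: mem_ball intro!: segment_in_ball)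
  then show ?case
    using integral_continuous_on_param[of "ball c r" 0 1 "\<lambda>x t. t ^ j * F (c + t *\<^sub>R (x - c))"]
    by simp
next
  case (Suc k)
  let ?F' = "\<lambda>b x. frechet_derivative F (at x) b"
  let ?I = "\<lambda>b x. integral {0..1} (\<lambda>t. t ^ Suc j * ?F' b (c + t *\<^sub>R (x - c)))"
  have cont: "continuous_on (ball c r \<times> {0..1}) (\<lambda>(x, t::real). t ^ i * G (c + t *\<^sub>R (x - c)))"
    if "smooth_on (ball c r) G" for G :: "'a \<Rightarrow> real" and i
    unfolding case_prod_unfold
    by (intro continuous_intros continuous_on_compose2[OF smooth_on_continuous[OF that]])
      (auto simp del: mem_ball intro!: segment_in_ball)
  have cont1: "continuous_on {0..1} (\<lambda>t::real. t ^ i * G (c + t *\<^sub>R (x - c)))"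
    if "smooth_on (ball c r) G" "x \<in> ball c r" for G :: "'a \<Rightarrow> real" and i x
    by (intro continuous_intros continuous_on_compose2[OF smooth_on_continuous[OF that(1)]])
      (use that(2) in \<open>auto simp del: mem_ball intro!: segment_in_ball\<close>)
  \<comment> \<open>The derivative of the integrand as a bounded linear map, the form that
    \<open>leibniz_rule\<close> demands; it is written out in \<open>Basis\<close> so that its
    integral can be taken componentwise.\<close>
  define A where "A x t = (\<Sum>b\<in>Basis. (t ^ Suc j * ?F' b (c + t *\<^sub>R (x - c))) *\<^sub>R blinfun_inner_left b)"
    for x and t :: real
  have A: "blinfun_apply (A x t) v = (\<Sum>b\<in>Basis. (t ^ Suc j * ?F' b (c + t *\<^sub>R (x - c))) * (v \<bullet> b))" for x t v
    by (simp add: A_def blinfun.sum_left blinfun.scaleR_left)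
  have D: "((\<lambda>x. t ^ j * F (c + t *\<^sub>R (x - c))) has_derivative blinfun_apply (A x t)) (at x)"
    if x: "x \<in> ball c r" and t: "t \<in> {0..1}" for x t
  proof -
    let ?y = "c + t *\<^sub>R (x - c)"
    have F: "(F has_derivative frechet_derivative F (at ?y)) (at ?y)"
      using smooth_on_has_derivative[OF Suc.prems segment_in_ball[OF x t]] .
    have lin: "linear (frechet_derivative F (at ?y))" using F has_derivative_linear by blast
    have "((\<lambda>x. c + t *\<^sub>R (x - c)) has_derivative (\<lambda>v. t *\<^sub>R v)) (at x)"
      by (auto intro!: derivative_eq_intros)
    from has_derivative_compose[OF this F]
    have "((\<lambda>x. t ^ j * F (c + t *\<^sub>R (x - c))) has_derivative (\<lambda>v. t ^ j * frechet_derivative F (at ?y) (t *\<^sub>R v))) (at x)"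
      by (rule has_derivative_mult_right)
    moreover have "t ^ j * frechet_derivative F (at ?y) (t *\<^sub>R v) = blinfun_apply (A x t) v" for v
      using linear_basis_expansion[OF lin, of v]
      by (simp add: A linear_cmul[OF lin] sum_distrib_left mult_ac)
    ultimately show ?thesis by simp
  qed
  have contA: "continuous_on (ball c r \<times> {0..1}) (\<lambda>(x, t). A x t)"
    using cont[OF smooth_on_derivative[OF Suc.prems], of "Suc j"]
    unfolding A_def case_prod_unfold by (intro continuous_on_sum continuous_on_scaleR continuous_on_const) auto
  have int: "integral {0..1} (A x) = (\<Sum>b\<in>Basis. ?I b x *\<^sub>R blinfun_inner_left b)" if "x \<in> ball c r" for x
  proof -
    have "((\<lambda>t. A x t) has_integral (\<Sum>b\<in>Basis. ?I b x *\<^sub>R blinfun_inner_left b)) {0..1}"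
      unfolding A_def
      by (intro has_integral_sum has_integral_scaleR_left integrable_integral
          integrable_continuous_real[OF cont1[OF smooth_on_derivative[OF Suc.prems] that]]) simp
    then show ?thesis by (rule integral_unique)
  qed
  show ?case
  proof (rule C_k_on_SucI[where f' = "\<lambda>x v. \<Sum>b\<in>Basis. ?I b x * (v \<bullet> b)"])
    fix x assume x: "x \<in> ball c r"
    have "((\<lambda>x. integral (cbox 0 1) (\<lambda>t. t ^ j * F (c + t *\<^sub>R (x - c)))) has_derivative
        blinfun_apply (integral (cbox 0 1) (A x))) (at x within ball c r)"
    proof (rule leibniz_rule[where fx = A])
      show "(\<lambda>t. t ^ j * F (c + t *\<^sub>R (x - c))) integrable_on cbox 0 1" if "x \<in> ball c r" for x
        using cont1[OF Suc.prems that] by (simp add: integrable_continuous_real)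
      show "((\<lambda>x. t ^ j * F (c + t *\<^sub>R (x - c))) has_derivative blinfun_apply (A x t)) (at x within ball c r)"
        if "x \<in> ball c r" "t \<in> cbox 0 1" for x t
        by (rule has_derivative_at_withinI[OF D]) (use that in simp_all)
      show "continuous_on (ball c r \<times> cbox 0 1) (\<lambda>(x, t). A x t)"
        using contA by simp
    qed (fact x, fact convex_ball)
    moreover have "blinfun_apply (\<Sum>b\<in>Basis. ?I b x *\<^sub>R blinfun_inner_left b) = (\<lambda>v. \<Sum>b\<in>Basis. ?I b x * (v \<bullet> b))"
      by (rule ext) (simp add: blinfun.sum_left blinfun.scaleR_left del: power_Suc)
    ultimately show "((\<lambda>x. integral {0..1} (\<lambda>t. t ^ j * F (c + t *\<^sub>R (x - c)))) has_derivative
        (\<lambda>v. \<Sum>b\<in>Basis. ?I b x * (v \<bullet> b))) (at x)"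
      unfolding at_within_open[OF x open_ball] cbox_interval int[OF x] by (simp only:)
  next
    fix v
    show "C_k_on k (ball c r) (\<lambda>x. \<Sum>b\<in>Basis. ?I b x * (v \<bullet> b))"
      by (intro C_k_on_sum C_k_on_mult C_k_on_const Suc.IH smooth_on_derivative Suc.prems open_ball)
  qed simp
qed

text \<open>Integrate the derivative of \<open>F\<close> along the segment from \<open>c\<close> to
  \<open>x\<close>: the factor \<open>g b\<close> is the mean over the segment of the partial
  derivative in direction \<open>b\<close>.\<close>

lemma hadamard:
  fixes F :: "'a::euclidean_space \<Rightarrow> real"
  assumes "smooth_on (ball c r) F" "r > 0"
  obtains g where "\<And>b. smooth_on (ball c r) (g b)" "\<And>b. g b c = frechet_derivative F (at c) b"
    "\<And>x. x \<in> ball c r \<Longrightarrow> F x = F c + (\<Sum>b\<in>Basis. ((x - c) \<bullet> b) * g b x)"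
proof
  let ?F' = "\<lambda>b x. frechet_derivative F (at x) b"
  \<comment> \<open>The factor \<open>t ^ 0\<close> is kept in order to match
    \<open>C_k_on_segment_integral\<close>.\<close>
  let ?g = "\<lambda>b x. integral {0..1} (\<lambda>t. t ^ 0 * ?F' b (c + t *\<^sub>R (x - c)))"
  show "smooth_on (ball c r) (?g b)" for b
    unfolding smooth_on_def using C_k_on_segment_integral[OF smooth_on_derivative[OF assms(1)]] by blast
  show "?g b c = frechet_derivative F (at c) b" for b by simp
  fix x assume x: "x \<in> ball c r"
  have D: "((\<lambda>t. F (c + t *\<^sub>R (x - c))) has_real_derivative (\<Sum>b\<in>Basis. ((x - c) \<bullet> b) * ?F' b (c + t *\<^sub>R (x - c)))) (at t)"
    if t: "t \<in> {0..1}" for t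
  proof -
    let ?y = "c + t *\<^sub>R (x - c)"
    have F: "(F has_derivative frechet_derivative F (at ?y)) (at ?y)"
      using smooth_on_has_derivative[OF assms(1) segment_in_ball[OF x t]] .
    have lin: "linear (frechet_derivative F (at ?y))" using F has_derivative_linear by blast
    have "((\<lambda>t. c + t *\<^sub>R (x - c)) has_derivative (\<lambda>s. s *\<^sub>R (x - c))) (at t)"
      by (auto intro!: derivative_eq_intros)
    from has_derivative_compose[OF this F]
    have "((\<lambda>t. F (c + t *\<^sub>R (x - c))) has_derivative (\<lambda>s. frechet_derivative F (at ?y) (s *\<^sub>R (x - c)))) (at t)" .
    moreover have "frechet_derivative F (at ?y) (s *\<^sub>R (x - c)) = (\<Sum>b\<in>Basis. ((x - c) \<bullet> b) * ?F' b ?y) * s" for s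
      using linear_basis_expansion[OF lin, of "x - c"] by (simp add: linear_cmul[OF lin])
    ultimately show ?thesis by (simp add: has_field_derivative_def)
  qed
  have "((\<lambda>t. \<Sum>b\<in>Basis. ((x - c) \<bullet> b) * ?F' b (c + t *\<^sub>R (x - c))) has_integral
      F (c + 1 *\<^sub>R (x - c)) - F (c + 0 *\<^sub>R (x - c))) {0..1}"
    by (rule fundamental_theorem_of_calculus)
      (simp_all add: D[THEN has_vector_derivative_at_within[OF has_real_derivative_iff_has_vector_derivative[THEN iffD1]]])
  moreover have "((\<lambda>t. \<Sum>b\<in>Basis. ((x - c) \<bullet> b) * ?F' b (c + t *\<^sub>R (x - c))) has_integral
      (\<Sum>b\<in>Basis. ((x - c) \<bullet> b) * ?g b x)) {0..1}"
  proof (intro has_integral_sum has_integral_mult_right)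
    fix b :: 'a
    have "continuous_on {0..1} (\<lambda>t. ?F' b (c + t *\<^sub>R (x - c)))"
      by (intro continuous_intros continuous_on_compose2[OF smooth_on_continuous[OF smooth_on_derivative[OF assms(1)]]])
        (use x in \<open>auto simp del: mem_ball intro!: segment_in_ball\<close>)
    then show "((\<lambda>t. ?F' b (c + t *\<^sub>R (x - c))) has_integral ?g b x) {0..1}"
      by (simp add: integrable_integral integrable_continuous_real)
  qed simp
  ultimately have "F (c + 1 *\<^sub>R (x - c)) - F (c + 0 *\<^sub>R (x - c)) = (\<Sum>b\<in>Basis. ((x - c) \<bullet> b) * ?g b x)"
    by (rule has_integral_unique)
  moreover have "c + 1 *\<^sub>R (x - c) = x" "c + 0 *\<^sub>R (x - c) = c" by simp_all
  ultimately have "F x - F c = (\<Sum>b\<in>Basis. ((x - c) \<bullet> b) * ?g b x)"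
    by (simp only:)
  then show "F x = F c + (\<Sum>b\<in>Basis. ((x - c) \<bullet> b) * ?g b x)"
    by linarith
qed

section \<open>Smooth functions on manifolds\<close>

lemma is_chart_open: "is_chart (U, \<psi>) \<Longrightarrow> open U"
  by (simp add: is_chart_def)

lemma is_chart_inv: "is_chart (U, \<psi>) \<Longrightarrow> p \<in> U \<Longrightarrow> inv_into U \<psi> (\<psi> p) = p"
  by (auto simp: is_chart_def homeomorphism_def)

lemma is_chart_open_image:
  assumes "is_chart (U, \<psi>)" "open T"
  shows "open (\<psi> ` (U \<inter> T))"
proof -
  have "openin (top_of_set (\<psi> ` U)) (\<psi> ` (U \<inter> T))"
    using assms by (intro homeomorphism_imp_open_map[of U]) (auto simp: is_chart_def openin_open)
  moreover have "open (\<psi> ` U)" using assms by (simp add: is_chart_def)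
  ultimately show ?thesis by (simp add: openin_open_eq)
qed

lemma is_chart_continuous: "is_chart (U, \<psi>) \<Longrightarrow> continuous_on U \<psi>"
  by (auto simp: is_chart_def homeomorphism_def)

lemma is_chart_inv_continuous: "is_chart (U, \<psi>) \<Longrightarrow> continuous_on (\<psi> ` U) (inv_into U \<psi>)"
  by (auto simp: is_chart_def homeomorphism_def)

lemma smooth_map_on_subset:
  assumes "smooth_map_on W A B f" "V \<subseteq> W"
  shows "smooth_map_on V A B f"
proof -
  have "smooth_on (\<psi> ` (U \<inter> V \<inter> f -` Y)) (\<eta> \<circ> f \<circ> inv_into U \<psi>)"
    if "(U, \<psi>) \<in> A" "(Y, \<eta>) \<in> B" for U \<psi> Y \<eta>
    by (rule smooth_on_subset[of "\<psi> ` (U \<inter> W \<inter> f -` Y)"])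
      (use assms that in \<open>auto simp: smooth_map_on_def\<close>)
  then show ?thesis
    using assms by (auto simp: smooth_map_on_def intro: continuous_on_subset)
qed

lemma covering_chart:
  assumes "(\<Union>c\<in>B. fst c) = UNIV"
  obtains U \<psi> where "(U, \<psi>) \<in> B" "p \<in> U"
proof -
  have "p \<in> (\<Union>c\<in>B. fst c)" using assms by simp
  then obtain c where "c \<in> B" "p \<in> fst c" by blast
  then show thesis using that[of "fst c" "snd c"] by simp
qed

text \<open>Smoothness is checked near one point \<open>p\<close> at a time: the coordinate
  expression factors there through a chart of \<open>B\<close> at \<open>F p\<close>, which the
  covering hypothesis provides.\<close>

lemma smooth_map_on_compose:
  assumes A: "\<And>c. c \<in> A \<Longrightarrow> is_chart c"
    and B: "\<And>c. c \<in> B \<Longrightarrow> is_chart c" "(\<Union>c\<in>B. fst c) = UNIV"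
    and C: "\<And>c. c \<in> C \<Longrightarrow> open (fst c)"
    and "open W" "open V" "F ` W \<subseteq> V"
    and F: "smooth_map_on W A B F" and g: "smooth_map_on V B C g"
  shows "smooth_map_on W A C (g \<circ> F)"
proof -
  have contF: "continuous_on W F" and contg: "continuous_on V g"
    using F g by (auto simp: smooth_map_on_def)
  have contgF: "continuous_on W (g \<circ> F)"
    using contF contg \<open>F ` W \<subseteq> V\<close> by (rule continuous_on_compose[OF _ continuous_on_subset])
  have "smooth_on (\<psi> ` (U \<inter> W \<inter> (g \<circ> F) -` Y)) (\<eta> \<circ> (g \<circ> F) \<circ> inv_into U \<psi>)"
    if U: "(U, \<psi>) \<in> A" and Y: "(Y, \<eta>) \<in> C" for U \<psi> Y \<eta>
  proof (rule smooth_on_local)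
    fix x assume "x \<in> \<psi> ` (U \<inter> W \<inter> (g \<circ> F) -` Y)"
    then obtain p where p: "x = \<psi> p" "p \<in> U" "p \<in> W" "g (F p) \<in> Y" by auto
    obtain Z \<zeta> where Z: "(Z, \<zeta>) \<in> B" "F p \<in> Z" by (rule covering_chart[OF B(2)])
    have chU: "is_chart (U, \<psi>)" and chZ: "is_chart (Z, \<zeta>)" using A B(1) U Z by auto
    have "open Y" using C Y by force
    define D where "D = F -` Z \<inter> W \<inter> ((g \<circ> F) -` Y \<inter> W)"
    have D: "open D"
      unfolding D_def
      by (intro open_Int continuous_on_open_vimage[THEN iffD1, rule_format] contF contgF \<open>open W\<close> \<open>open Y\<close>
          is_chart_open[OF chZ])
    define T where "T = \<psi> ` (U \<inter> D)"
    have T: "open T" unfolding T_def using is_chart_open_image[OF chU D] .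
    let ?f = "\<zeta> \<circ> F \<circ> inv_into U \<psi>"
    have 1: "smooth_on T ?f"
    proof (rule smooth_on_subset)
      show "smooth_on (\<psi> ` (U \<inter> W \<inter> F -` Z)) ?f" using F U Z by (auto simp: smooth_map_on_def)
    qed (auto simp: T_def D_def)
    have 2: "smooth_on (\<zeta> ` (Z \<inter> V \<inter> g -` Y)) (\<eta> \<circ> g \<circ> inv_into Z \<zeta>)"
      using g Z Y by (auto simp: smooth_map_on_def)
    have "open (g -` Y \<inter> V)"
      using continuous_on_open_vimage[OF \<open>open V\<close>] contg \<open>open Y\<close> by blast
    then have 3: "open (\<zeta> ` (Z \<inter> V \<inter> g -` Y))"
      using is_chart_open_image[OF chZ] by (metis Int_assoc Int_commute)
    have "smooth_on T (\<lambda>x. (\<eta> \<circ> g \<circ> inv_into Z \<zeta>) (?f x))"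
      by (rule smooth_on_compose[OF T 3 _ 1 2])
        (use \<open>F ` W \<subseteq> V\<close> in \<open>auto simp: T_def D_def is_chart_inv[OF chU]\<close>)
    then have "smooth_on T (\<eta> \<circ> (g \<circ> F) \<circ> inv_into U \<psi>)"
      by (rule smooth_on_cong[OF T])
        (auto simp: T_def D_def is_chart_inv[OF chU] is_chart_inv[OF chZ])
    moreover have "x \<in> T" using p Z by (auto simp: T_def D_def)
    ultimately show "\<exists>T. open T \<and> x \<in> T \<and> smooth_on T (\<eta> \<circ> (g \<circ> F) \<circ> inv_into U \<psi>)"
      using T by blast
  qed
  with contgF show ?thesis by (auto simp: smooth_map_on_def)
qed

lemma std_atlas_open: "c \<in> std_atlas \<Longrightarrow> open (fst c)"
  by (simp add: std_atlas_def)

context smooth_manifold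
begin

abbreviation smooth_real :: "'m set \<Rightarrow> ('m \<Rightarrow> real) \<Rightarrow> bool" where
  "smooth_real W \<equiv> smooth_map_on W \<A> std_atlas"

lemma obtain_chart:
  obtains U \<psi> where "(U, \<psi>) \<in> \<A>" "p \<in> U" "is_chart (U, \<psi>)"
  using covering_chart[OF covering] charts by metis

lemma smooth_real_chart:
  assumes "smooth_real W f" "(U, \<psi>) \<in> \<A>"
  shows "smooth_on (\<psi> ` (U \<inter> W)) (f \<circ> inv_into U \<psi>)"
  using assms by (force simp: smooth_map_on_def std_atlas_def)

text \<open>Compatibility of the atlas reduces smoothness to one chart around each point.\<close>

lemma smooth_realI:
  assumes "open W" and "\<And>p. p \<in> W \<Longrightarrow> \<exists>U \<psi> T. (U, \<psi>) \<in> \<A> \<and> open T \<and> p \<in> T \<and> T \<subseteq> U \<and>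
    smooth_on (\<psi> ` T) (f \<circ> inv_into U \<psi>)"
  shows "smooth_real W f"
proof -
  have "isCont f p" if pW: "p \<in> W" for p
  proof -
    obtain U \<psi> T where T: "(U, \<psi>) \<in> \<A>" "open T" "p \<in> T" "T \<subseteq> U"
      and sm: "smooth_on (\<psi> ` T) (f \<circ> inv_into U \<psi>)"
      using assms(2)[OF pW] by blast
    have ch: "is_chart (U, \<psi>)" using charts T by blast
    have "continuous_on T \<psi>"
      using continuous_on_subset[OF is_chart_continuous[OF ch] T(4)] .
    then have "continuous_on T (f \<circ> inv_into U \<psi> \<circ> \<psi>)"
      using smooth_on_continuous[OF sm] by (rule continuous_on_compose)
    then have "continuous_on T f"
      by (rule continuous_on_eq) (use T is_chart_inv[OF ch] in auto)
    with T show ?thesis by (simp add: continuous_on_eq_continuous_at)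
  qed
  then have "continuous_on W f" by (simp add: continuous_at_imp_continuous_on)
  moreover have "smooth_on (\<psi> ` (U \<inter> W)) (f \<circ> inv_into U \<psi>)" if U: "(U, \<psi>) \<in> \<A>" for U \<psi>
  proof (rule smooth_on_local)
    fix x assume "x \<in> \<psi> ` (U \<inter> W)"
    then obtain p where p: "x = \<psi> p" "p \<in> U" "p \<in> W" by auto
    obtain V \<eta> T where T: "(V, \<eta>) \<in> \<A>" "open T" "p \<in> T" "T \<subseteq> V"
      and sm: "smooth_on (\<eta> ` T) (f \<circ> inv_into V \<eta>)"
      using assms(2)[OF p(3)] by blast
    have chU: "is_chart (U, \<psi>)" and chV: "is_chart (V, \<eta>)" using charts T U by blast+
    have 1: "open (\<psi> ` (U \<inter> T))" using is_chart_open_image[OF chU \<open>open T\<close>] .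
    have 2: "open (\<eta> ` T)" using is_chart_open_image[OF chV \<open>open T\<close>] T(4) by (simp add: inf_absorb2)
    have 3: "smooth_on (\<psi> ` (U \<inter> T)) (\<eta> \<circ> inv_into U \<psi>)"
      using compatible[OF U T(1)] T(4) by (auto intro: smooth_on_subset)
    have "smooth_on (\<psi> ` (U \<inter> T)) (\<lambda>x. (f \<circ> inv_into V \<eta>) ((\<eta> \<circ> inv_into U \<psi>) x))"
      by (rule smooth_on_compose[OF 1 2 _ 3 sm]) (auto simp: is_chart_inv[OF chU])
    then have "smooth_on (\<psi> ` (U \<inter> T)) (f \<circ> inv_into U \<psi>)"
      by (rule smooth_on_cong[OF 1]) (use T(4) in \<open>auto simp: is_chart_inv[OF chU] is_chart_inv[OF chV]\<close>)
    with 1 p T show "\<exists>T. open T \<and> x \<in> T \<and> smooth_on T (f \<circ> inv_into U \<psi>)" by blast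
  qed
  ultimately show ?thesis by (auto simp: smooth_map_on_def std_atlas_def)
qed

lemma smooth_real_local:
  assumes "open W" "\<And>p. p \<in> W \<Longrightarrow> \<exists>T. open T \<and> p \<in> T \<and> smooth_real T f"
  shows "smooth_real W f"
proof (rule smooth_realI[OF assms(1)])
  fix p assume "p \<in> W"
  then obtain T where T: "open T" "p \<in> T" "smooth_real T f" using assms(2) by blast
  obtain U \<psi> where U: "(U, \<psi>) \<in> \<A>" "p \<in> U" "is_chart (U, \<psi>)" by (rule obtain_chart)
  then show "\<exists>U \<psi> T. (U, \<psi>) \<in> \<A> \<and> open T \<and> p \<in> T \<and> T \<subseteq> U \<and> smooth_on (\<psi> ` T) (f \<circ> inv_into U \<psi>)"
    using T smooth_real_chart[OF T(3) U(1)] is_chart_open[OF U(3)]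
    by (intro exI[of _ U] exI[of _ \<psi>] exI[of _ "U \<inter> T"]) auto
qed

lemma smooth_real_chart_compose:
  fixes G :: "'e \<Rightarrow> real"
  assumes "(U, \<psi>) \<in> \<A>" "open W" "smooth_on (\<psi> ` (U \<inter> W)) G"
  shows "smooth_real (U \<inter> W) (\<lambda>q. G (\<psi> q))"
proof (rule smooth_realI)
  have ch: "is_chart (U, \<psi>)" using charts assms by blast
  show "open (U \<inter> W)" using is_chart_open[OF ch] assms(2) by blast
  have "smooth_on (\<psi> ` (U \<inter> W)) ((\<lambda>q. G (\<psi> q)) \<circ> inv_into U \<psi>)"
    by (rule smooth_on_cong[OF is_chart_open_image[OF ch assms(2)] assms(3)]) (auto simp: is_chart_inv[OF ch])
  then show "\<exists>U' \<psi>' T. (U', \<psi>') \<in> \<A> \<and> open T \<and> p \<in> T \<and> T \<subseteq> U' \<and>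
      smooth_on (\<psi>' ` T) ((\<lambda>q. G (\<psi> q)) \<circ> inv_into U' \<psi>')" if "p \<in> U \<inter> W" for p
    using that assms(1) \<open>open (U \<inter> W)\<close> by blast
qed

lemma smooth_real_by_charts:
  assumes "open W" "\<And>U \<psi>. (U, \<psi>) \<in> \<A> \<Longrightarrow> open (\<psi> ` (U \<inter> W)) \<Longrightarrow>
    smooth_on (\<psi> ` (U \<inter> W)) (f \<circ> inv_into U \<psi>)"
  shows "smooth_real W f"
proof (rule smooth_realI[OF assms(1)])
  fix p assume "p \<in> W"
  obtain U \<psi> where U: "(U, \<psi>) \<in> \<A>" "p \<in> U" "is_chart (U, \<psi>)" by (rule obtain_chart)
  then show "\<exists>U \<psi> T. (U, \<psi>) \<in> \<A> \<and> open T \<and> p \<in> T \<and> T \<subseteq> U \<and> smooth_on (\<psi> ` T) (f \<circ> inv_into U \<psi>)"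
    using assms is_chart_open_image[OF U(3) assms(1)] is_chart_open[OF U(3)] \<open>p \<in> W\<close>
    by (intro exI[of _ U] exI[of _ \<psi>] exI[of _ "U \<inter> W"]) auto
qed

lemma smooth_real_cong:
  assumes "open W" "smooth_real W f" "\<And>p. p \<in> W \<Longrightarrow> f p = g p"
  shows "smooth_real W g"
proof (rule smooth_real_by_charts[OF assms(1)])
  fix U \<psi> assume U: "(U, \<psi>) \<in> \<A>" and op: "open (\<psi> ` (U \<inter> W))"
  show "smooth_on (\<psi> ` (U \<inter> W)) (g \<circ> inv_into U \<psi>)"
    by (rule smooth_on_cong[OF op smooth_real_chart[OF assms(2) U]])
      (use assms(3) is_chart_inv[OF charts[OF U]] in auto)
qed

lemma smooth_real_const: "open W \<Longrightarrow> smooth_real W (\<lambda>q. c)"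
  by (rule smooth_real_by_charts) (auto simp: o_def intro: smooth_on_const)

lemma smooth_real_add:
  assumes "open W" "smooth_real W f" "smooth_real W g"
  shows "smooth_real W (\<lambda>q. f q + g q)"
  using assms smooth_on_add[OF _ smooth_real_chart[OF assms(2)] smooth_real_chart[OF assms(3)]]
  by (intro smooth_real_by_charts) (auto simp: o_def)

lemma smooth_real_mult:
  assumes "open W" "smooth_real W f" "smooth_real W g"
  shows "smooth_real W (\<lambda>q. f q * g q)"
  using assms smooth_on_mult[OF _ smooth_real_chart[OF assms(2)] smooth_real_chart[OF assms(3)]]
  by (intro smooth_real_by_charts) (auto simp: o_def)

lemma smooth_real_compose:
  assumes "open W" "smooth_real W f" "smooth_on UNIV s"
  shows "smooth_real W (\<lambda>q. s (f q))"
  using assms smooth_on_compose[OF _ open_UNIV _ smooth_real_chart[OF assms(2)] assms(3)]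
  by (intro smooth_real_by_charts) (auto simp: o_def)

lemma smooth_real_inverse:
  assumes "open W" "smooth_real W f" "\<And>p. p \<in> W \<Longrightarrow> f p \<noteq> 0"
  shows "smooth_real W (\<lambda>q. inverse (f q))"
proof (rule smooth_real_by_charts[OF assms(1)])
  fix U \<psi> assume U: "(U, \<psi>) \<in> \<A>" and op: "open (\<psi> ` (U \<inter> W))"
  show "smooth_on (\<psi> ` (U \<inter> W)) ((\<lambda>q. inverse (f q)) \<circ> inv_into U \<psi>)"
    unfolding o_def
    by (rule smooth_on_inverse[OF op smooth_real_chart[OF assms(2) U, unfolded o_def]])
      (use assms(3) is_chart_inv[OF charts[OF U]] in auto)
qed

lemma smooth_real_sum:
  "open W \<Longrightarrow> (\<And>i. i \<in> I \<Longrightarrow> smooth_real W (f i)) \<Longrightarrow> smooth_real W (\<lambda>q. \<Sum>i\<in>I. f i q)"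
  by (induction I rule: infinite_finite_induct) (auto intro: smooth_real_add smooth_real_const)

lemma smooth_real_prod:
  "open W \<Longrightarrow> (\<And>i. i \<in> I \<Longrightarrow> smooth_real W (f i)) \<Longrightarrow> smooth_real W (\<lambda>q. \<Prod>i\<in>I. f i q)"
  by (induction I rule: infinite_finite_induct) (auto intro: smooth_real_mult smooth_real_const)

lemma smooth_real_diff:
  assumes "open W" "smooth_real W f" "smooth_real W g"
  shows "smooth_real W (\<lambda>q. f q - g q)"
  using smooth_real_add[OF assms(1,2) smooth_real_mult[OF assms(1) smooth_real_const[OF assms(1), of "-1"] assms(3)]]
  by simp

lemma smooth_real_continuous: "smooth_real W f \<Longrightarrow> continuous_on W f"
  by (simp add: smooth_map_on_def)

section \<open>Bump functions, partitions of unity and proper functions\<close>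

lemma smooth_real_extend:
  assumes "smooth_real UNIV c" "smooth_real W f" "open W" "closed K" "K \<subseteq> W" "\<And>q. q \<notin> K \<Longrightarrow> c q = 0"
  shows "smooth_real UNIV (\<lambda>q. c q * f q)"
proof (rule smooth_real_local)
  fix p
  show "\<exists>T. open T \<and> p \<in> T \<and> smooth_real T (\<lambda>q. c q * f q)"
  proof (cases "p \<in> W")
    case True
    then show ?thesis
      using assms smooth_real_mult[OF \<open>open W\<close> smooth_map_on_subset[OF assms(1)]] by blast
  next
    case False
    \<comment> \<open>Near a point outside \<open>W\<close> the product is 0 because
      \<open>K\<close> is closed, whatever values \<open>f\<close> takes there.\<close>
    have op: "open (- K)" using assms(4) by (simp add: open_Compl)
    have "smooth_real (- K) (\<lambda>q. c q * f q)"
      by (rule smooth_real_cong[OF op smooth_real_const[OF op, of 0]]) (use assms(6) in auto)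
    with op False assms(5) show ?thesis by blast
  qed
qed simp

lemma bump:
  assumes "open W" "p \<in> W"
  obtains f K T where "smooth_real UNIV f" "compact K" "K \<subseteq> W" "\<And>q. q \<notin> K \<Longrightarrow> f q = 0"
    "open T" "p \<in> T" "T \<subseteq> K" "\<And>q. q \<in> T \<Longrightarrow> f q = 1" "\<And>q. f q \<ge> 0"
proof -
  obtain U \<psi> where U: "(U, \<psi>) \<in> \<A>" "p \<in> U" "is_chart (U, \<psi>)" by (rule obtain_chart)
  have "open (\<psi> ` (U \<inter> W))" using is_chart_open_image[OF U(3) assms(1)] .
  then obtain r where r: "r > 0" "cball (\<psi> p) r \<subseteq> \<psi> ` (U \<inter> W)"
    using assms(2) U(2) open_contains_cball by (metis Int_iff imageI)
  \<comment> \<open>The argument is 2 d^2 / r^2 with d the distance to the centre: at least 2 for d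
    >= r and at most 1/2 for d <= r / 2. The squared distance, unlike the distance, is smooth at the
    centre.\<close>
  define s where "s y = cutoff (2 / r\<^sup>2 * (\<Sum>b\<in>Basis. ((y - \<psi> p) \<bullet> b) * ((y - \<psi> p) \<bullet> b)))" for y :: 'e
  have s: "s y = cutoff (2 * (dist (\<psi> p) y)\<^sup>2 / r\<^sup>2)" for y
  proof -
    have "(\<Sum>b\<in>Basis. ((y - \<psi> p) \<bullet> b) * ((y - \<psi> p) \<bullet> b)) = (dist (\<psi> p) y)\<^sup>2"
      by (metis dist_commute dist_norm euclidean_inner power2_norm_eq_inner)
    then show ?thesis by (simp add: s_def)
  qed
  have "smooth_on UNIV (\<lambda>y. (y - \<psi> p) \<bullet> b)" for b
    using smooth_on_add[OF open_UNIV smooth_on_bounded_linear[OF open_UNIV bounded_linear_inner_left] smooth_on_const[OF open_UNIV], of b "- (\<psi> p \<bullet> b)"]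
    by (simp add: inner_diff_left)
  then have "smooth_on UNIV (\<lambda>y. 2 / r\<^sup>2 * (\<Sum>b\<in>Basis. ((y - \<psi> p) \<bullet> b) * ((y - \<psi> p) \<bullet> b)))"
    by (intro smooth_on_mult smooth_on_sum smooth_on_const open_UNIV)
  then have sms: "smooth_on UNIV s"
    unfolding s_def by (rule smooth_on_compose[OF open_UNIV open_UNIV _ _ smooth_on_cutoff, rotated]) auto
  have s0: "s y = 0" if "y \<notin> cball (\<psi> p) r" for y
  proof -
    have "r\<^sup>2 \<le> (dist (\<psi> p) y)\<^sup>2" using that r(1) by (intro power_mono) auto
    then show ?thesis using r(1) by (simp add: s cutoff_eq_0 field_simps)
  qed
  have s1: "s y = 1" if "y \<in> ball (\<psi> p) (r / 2)" for y
  proof -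
    have "(dist (\<psi> p) y)\<^sup>2 \<le> (r / 2)\<^sup>2" using that by (intro power_mono) auto
    moreover have "(r / 2)\<^sup>2 = r\<^sup>2 / 4" by (simp add: power_divide)
    ultimately have "2 * (dist (\<psi> p) y)\<^sup>2 \<le> r\<^sup>2"
      using zero_le_power2[of "dist (\<psi> p) y"] by linarith
    then have "2 * (dist (\<psi> p) y)\<^sup>2 / r\<^sup>2 \<le> 1"
      using r(1) by simp
    then show ?thesis by (simp add: s cutoff_eq_1)
  qed
  define K where "K = inv_into U \<psi> ` cball (\<psi> p) r"
  have K: "compact K" unfolding K_def
    by (rule compact_continuous_image[OF continuous_on_subset[OF is_chart_inv_continuous[OF U(3)]]]) (use r in auto)
  have KUW: "K \<subseteq> U \<inter> W" using r(2) is_chart_inv[OF U(3)] by (auto simp: K_def)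
  have memK: "q \<in> K \<longleftrightarrow> \<psi> q \<in> cball (\<psi> p) r" if "q \<in> U" for q
  proof
    assume "q \<in> K"
    then obtain y where y: "y \<in> cball (\<psi> p) r" "q = inv_into U \<psi> y" by (auto simp: K_def)
    then have "y \<in> \<psi> ` U" using r(2) by blast
    then show "\<psi> q \<in> cball (\<psi> p) r" using y f_inv_into_f[of y \<psi> U] by simp
  next
    assume "\<psi> q \<in> cball (\<psi> p) r"
    then show "q \<in> K" using is_chart_inv[OF U(3) that] by (force simp: K_def)
  qed
  define f where "f q = (if q \<in> U then s (\<psi> q) else 0)" for q
  have f0: "f q = 0" if "q \<notin> K" for q using that memK s0 by (auto simp: f_def)
  define T where "T = \<psi> -` ball (\<psi> p) (r / 2) \<inter> U"
  show thesis
  proof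
    show "smooth_real UNIV f"
    proof (rule smooth_real_local)
      fix q
      show "\<exists>T. open T \<and> q \<in> T \<and> smooth_real T f"
      proof (cases "q \<in> U")
        case True
        have op: "open U" using is_chart_open[OF U(3)] .
        have "smooth_real (U \<inter> UNIV) (\<lambda>q. s (\<psi> q))"
          by (rule smooth_real_chart_compose[OF U(1) open_UNIV smooth_on_subset[OF sms]]) simp
        then have "smooth_real U (\<lambda>q. s (\<psi> q))" by simp
        then have "smooth_real U f"
          by (rule smooth_real_cong[OF op]) (simp add: f_def)
        with True op show ?thesis by blast
      next
        case False
        have op: "open (- K)" using K by (simp add: compact_imp_closed open_Compl)
        have "smooth_real (- K) f"
          by (rule smooth_real_cong[OF op smooth_real_const[OF op, of 0]]) (use f0 in auto)
        with op False KUW show ?thesis by blast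
      qed
    qed simp
    show "open T" unfolding T_def
      using continuous_on_open_vimage[OF is_chart_open[OF U(3)]] is_chart_continuous[OF U(3)] by blast
    show "T \<subseteq> K" using memK r(1) by (auto simp: T_def)
  qed (use K KUW f0 U r(1) s1 cutoff_nonneg in \<open>auto simp: T_def f_def s\<close>)
qed

lemma smooth_suminf:
  assumes "\<And>k. smooth_real UNIV (f k)"
    and "\<And>p. \<exists>T n. open T \<and> p \<in> T \<and> (\<forall>k\<ge>n. \<forall>q\<in>T. f k q = 0)"
  shows "smooth_real UNIV (\<lambda>q. \<Sum>k::nat. f k q)"
proof (rule smooth_real_local)
  fix p
  obtain T n where T: "open T" "p \<in> T" "\<And>k q. k \<ge> n \<Longrightarrow> q \<in> T \<Longrightarrow> f k q = 0"
    using assms(2) by metis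
  have "smooth_real T (\<lambda>q. \<Sum>k<n. f k q)"
    using T(1) by (intro smooth_real_sum smooth_map_on_subset[OF assms(1)]) auto
  then have "smooth_real T (\<lambda>q. \<Sum>k. f k q)"
    by (rule smooth_real_cong[OF T(1)]) (rule suminf_finite[symmetric], use T(3) in auto)
  with T show "\<exists>T. open T \<and> p \<in> T \<and> smooth_real T (\<lambda>q. \<Sum>k. f k q)" by blast
qed simp

text \<open>Lindelof's theorem yields countably many bumps whose positivity sets cover the manifold.
  Local finiteness is achieved by the damping factors in \<open>g\<close> instead of an exhaustion
  by compact sets; dividing by the sum then normalizes.\<close>

lemma partition_of_unity:
  assumes "\<And>p. \<exists>U\<in>\<U>. open U \<and> p \<in> U"
  obtains \<phi> :: "nat \<Rightarrow> 'm \<Rightarrow> real" and K where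
    "\<And>k. smooth_real UNIV (\<phi> k)" "\<And>k p. \<phi> k p \<ge> 0"
    "\<And>k. compact (K k)" "\<And>k. \<exists>U\<in>\<U>. K k \<subseteq> U" "\<And>k p. p \<notin> K k \<Longrightarrow> \<phi> k p = 0"
    "\<And>p. \<exists>T n. open T \<and> p \<in> T \<and> (\<forall>k\<ge>n. \<forall>q\<in>T. \<phi> k q = 0)"
    "\<And>p. (\<Sum>k. \<phi> k p) = 1"
proof -
  have "\<exists>f K. smooth_real UNIV f \<and> (\<forall>q. f q \<ge> 0) \<and> f p > 0 \<and> compact K \<and> (\<exists>U\<in>\<U>. K \<subseteq> U) \<and>
      (\<forall>q. q \<notin> K \<longrightarrow> f q = 0)" for p
  proof -
    obtain U where U: "U \<in> \<U>" "open U" "p \<in> U" using assms by blast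
    from bump[OF U(2,3)] obtain f K T where f: "smooth_real UNIV f" "compact K" "K \<subseteq> U" "\<And>q. q \<notin> K \<Longrightarrow> f q = 0"
      "open T" "p \<in> T" "T \<subseteq> K" "\<And>q. q \<in> T \<Longrightarrow> f q = 1" "\<And>q. f q \<ge> 0" by blast
    then have "f p > 0" by simp
    with f U(1) show ?thesis by blast
  qed
  then obtain F L where F: "\<And>p. smooth_real UNIV (F p)" "\<And>p q. F p q \<ge> 0" "\<And>p. F p p > 0"
    "\<And>p. compact (L p)" "\<And>p. \<exists>U\<in>\<U>. L p \<subseteq> U" "\<And>p q. q \<notin> L p \<Longrightarrow> F p q = 0"
    by metis
  have Fcont: "continuous_on UNIV (F p)" for p using smooth_real_continuous[OF F(1)] .
  have op: "open {q. a < F p q}" for a p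
    using open_Collect_less[OF continuous_on_const Fcont] .
  obtain \<F> where \<F>: "\<F> \<subseteq> range (\<lambda>p. {q. 0 < F p q})" "countable \<F>" "\<Union>\<F> = \<Union>(range (\<lambda>p. {q. 0 < F p q}))"
    by (rule Lindelof[of "range (\<lambda>p. {q. 0 < F p q})"]) (use op in auto)
  from countable_subset_image[THEN iffD1, OF conjI[OF \<F>(2,1)]]
  obtain C where C: "countable C" "\<F> = (\<lambda>p. {q. 0 < F p q}) ` C" by (elim exE conjE) (rule that)
  have cov: "\<exists>p\<in>C. F p q > 0" for q
  proof -
    have "q \<in> {q'. 0 < F q q'}" using F(3) by simp
    then have "q \<in> \<Union>\<F>" unfolding \<F>(3) by blast
    then show ?thesis using C by auto
  qed
  then have "C \<noteq> {}" by blast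
  define f where "f k = F (from_nat_into C k)" for k
  have fpos: "\<exists>k. f k q > 0" for q
    using cov[of q] C(1) from_nat_into_surj[OF C(1)] by (metis f_def)
  have fnn: "f k q \<ge> 0" for k q using F(2) by (simp add: f_def)
  have fsm: "smooth_real UNIV (f k)" for k using F(1) by (simp add: f_def)
  define g where "g k q = f k q * (\<Prod>j<k. flat (1 + (- real k) * f j q))" for k q
  have gsm: "smooth_real UNIV (g k)" for k
    unfolding g_def
    by (intro smooth_real_mult smooth_real_prod smooth_real_compose[OF _ _ smooth_on_flat] smooth_real_add
        smooth_real_const fsm open_UNIV)
  have gnn: "g k q \<ge> 0" for k q
    unfolding g_def by (intro mult_nonneg_nonneg prod_nonneg fnn) (auto simp: flat_nonneg)
  \<comment> \<open>Near a point where \<open>f j\<close> is positive, the factor with index \<open>j\<close> vanishes for all large \<open>k\<close>.\<close>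
  have loc: "\<exists>T n. open T \<and> p \<in> T \<and> (\<forall>k\<ge>n. \<forall>q\<in>T. g k q = 0)" for p
  proof -
    obtain j where j: "f j p > 0" using fpos by blast
    define c where "c = f j p / 2"
    have c: "c > 0" using j by (simp add: c_def)
    obtain n where n: "1 / c < real n" using reals_Archimedean2 by blast
    have "g k q = 0" if k: "k \<ge> max n (Suc j)" and q: "f j q > c" for k q
    proof -
      have "1 < real n * c" using n c by (simp add: field_simps)
      also have "real n * c \<le> real k * f j q" using k q c by (intro mult_mono) auto
      finally have "flat (1 + (- real k) * f j q) = 0" by (simp add: flat_eq_0_iff)
      then show ?thesis using k by (auto simp: g_def prod_zero_iff)
    qed
    moreover have "open {q. c < f j q}" unfolding f_def by (rule op)
    moreover have "p \<in> {q. c < f j q}" using j by (simp add: c_def)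
    ultimately show ?thesis by blast
  qed
  \<comment> \<open>At the least index with \<open>f k q > 0\<close> all earlier functions vanish,
    so each damping factor equals \<open>flat 1\<close>.\<close>
  have gpos: "\<exists>k. g k q > 0" for q
  proof -
    define k where "k = (LEAST k. f k q > 0)"
    have k: "f k q > 0" unfolding k_def using fpos by (metis (mono_tags, lifting) LeastI)
    have "f j q = 0" if "j < k" for j
      using not_less_Least[of j "\<lambda>k. f k q > 0"] that fnn[of j q] by (simp add: k_def)
    then have "g k q > 0" unfolding g_def
      by (intro mult_pos_pos k prod_pos) (auto simp: flat_pos_iff)
    then show ?thesis by blast
  qed
  have summ: "summable (\<lambda>k. g k q)" for q
  proof -
    obtain n where "\<forall>k\<ge>n. g k q = 0" using loc by blast
    then show ?thesis by (intro summable_finite[of "{..<n}"]) auto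
  qed
  define G where "G q = (\<Sum>k. g k q)" for q
  have Gpos: "G q > 0" for q unfolding G_def
    using gpos[of q] suminf_pos2[OF summ gnn] by blast
  have Gsm: "smooth_real UNIV G" unfolding G_def by (rule smooth_suminf[OF gsm loc])
  show thesis
  proof (rule that[of "\<lambda>k q. g k q * inverse (G q)" "\<lambda>k. L (from_nat_into C k)"])
    show "smooth_real UNIV (\<lambda>q. g k q * inverse (G q))" for k
      using Gpos by (intro smooth_real_mult smooth_real_inverse Gsm gsm open_UNIV) (metis less_irrefl)
    show "0 \<le> g k p * inverse (G p)" for k p using gnn[of k p] Gpos[of p] by simp
    show "p \<notin> L (from_nat_into C k) \<Longrightarrow> g k p * inverse (G p) = 0" for k p
      using F(6) by (simp add: g_def f_def)
    show "\<exists>T n. open T \<and> p \<in> T \<and> (\<forall>k\<ge>n. \<forall>q\<in>T. g k q * inverse (G q) = 0)" for p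
      using loc[of p] by force
    show "(\<Sum>k. g k p * inverse (G p)) = 1" for p
      using suminf_mult2[OF summ, of p "inverse (G p)"] Gpos[of p] by (simp add: G_def)
  qed (use F in auto)
qed

text \<open>Off the supports of the first members of a partition of unity only indices above
  \<open>N\<close> contribute, so the average of the indices with weights \<phi> is at least
  \<open>N\<close>. The function measures escape to infinity in
  \<open>not_countable_ideal_type\<close>.\<close>

lemma proper_function:
  obtains h where "smooth_real UNIV h" "\<And>c. \<exists>K. compact K \<and> (\<forall>p. p \<notin> K \<longrightarrow> h p > c)"
proof -
  obtain \<phi> :: "nat \<Rightarrow> 'm \<Rightarrow> real" and K where \<phi>: "\<And>k. smooth_real UNIV (\<phi> k)" "\<And>k p. \<phi> k p \<ge> 0"
    "\<And>k. compact (K k)" "\<And>k p. p \<notin> K k \<Longrightarrow> \<phi> k p = 0"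
    "\<And>p. \<exists>T n. open T \<and> p \<in> T \<and> (\<forall>k\<ge>n. \<forall>q\<in>T. \<phi> k q = 0)"
    "\<And>p. (\<Sum>k. \<phi> k p) = 1"
    by (rule partition_of_unity[of "{UNIV}"]) auto
  let ?h = "\<lambda>p. \<Sum>k. real k * \<phi> k p"
  show thesis
  proof
    have "\<exists>T n. open T \<and> p \<in> T \<and> (\<forall>k\<ge>n. \<forall>q\<in>T. real k * \<phi> k q = 0)" for p
      using \<phi>(5)[of p] by force
    then show "smooth_real UNIV ?h"
      by (intro smooth_suminf smooth_real_mult smooth_real_const \<phi>(1) open_UNIV)
    fix c :: real
    obtain N where N: "c < real N" using reals_Archimedean2 by blast
    have "?h p > c" if "p \<notin> (\<Union>k\<le>N. K k)" for p
    proof -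
      obtain n where n: "\<forall>k\<ge>n. \<phi> k p = 0" using \<phi>(5) by blast
      have 0: "\<phi> k p = 0" if "k \<le> N" for k using \<phi>(4) \<open>p \<notin> _\<close> that by blast
      have "real N = real N * (\<Sum>k<n. \<phi> k p)"
        using \<phi>(6)[of p] suminf_finite[of "{..<n}" "\<lambda>k. \<phi> k p"] n by auto
      also have "\<dots> \<le> (\<Sum>k<n. real k * \<phi> k p)"
        unfolding sum_distrib_left
      proof (rule sum_mono)
        fix k
        show "real N * \<phi> k p \<le> real k * \<phi> k p"
          using 0[of k] \<phi>(2)[of k p] by (cases "k \<le> N") (auto intro: mult_right_mono)
      qed
      also have "\<dots> = ?h p" by (rule suminf_finite[symmetric]) (use n in auto)
      finally show ?thesis using N by simp
    qed
    then show "\<exists>K. compact K \<and> (\<forall>p. p \<notin> K \<longrightarrow> ?h p > c)"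
      using \<phi>(3) by (intro exI[of _ "\<Union>k\<le>N. K k"]) auto
  qed
qed

section \<open>Tangent vectors as derivations\<close>

lemma tangent_add: "x \<in> tangent_space \<A> p \<Longrightarrow> smooth_real UNIV f \<Longrightarrow> smooth_real UNIV g \<Longrightarrow>
    x (\<lambda>q. f q + g q) = x f + x g"
  and tangent_scale: "x \<in> tangent_space \<A> p \<Longrightarrow> smooth_real UNIV f \<Longrightarrow> x (\<lambda>q. c * f q) = c * x f"
  and tangent_mult: "x \<in> tangent_space \<A> p \<Longrightarrow> smooth_real UNIV f \<Longrightarrow> smooth_real UNIV g \<Longrightarrow>
    x (\<lambda>q. f q * g q) = x f * g p + f p * x g"
  and tangent_nonsmooth: "x \<in> tangent_space \<A> p \<Longrightarrow> \<not> smooth_real UNIV f \<Longrightarrow> x f = 0"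
  by (auto simp: tangent_space_def)

lemma tangent_const:
  assumes "x \<in> tangent_space \<A> p"
  shows "x (\<lambda>q. c) = 0"
proof -
  have "x (\<lambda>q. 1 * 1) = x (\<lambda>q. 1) * 1 + 1 * x (\<lambda>q. 1)"
    by (rule tangent_mult[OF assms]) (auto intro: smooth_real_const)
  then have "x (\<lambda>q. 1) = 0" by simp
  then show ?thesis using tangent_scale[OF assms smooth_real_const[OF open_UNIV], of c 1] by simp
qed

lemma tangent_diff:
  assumes "x \<in> tangent_space \<A> p" "smooth_real UNIV f" "smooth_real UNIV g"
  shows "x (\<lambda>q. f q - g q) = x f - x g"
proof -
  have "smooth_real UNIV (\<lambda>q. (- 1) * g q)"
    by (intro smooth_real_mult smooth_real_const assms open_UNIV)
  from tangent_add[OF assms(1,2) this] tangent_scale[OF assms(1,3), of "- 1"] show ?thesis by simp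
qed

lemma tangent_sum:
  assumes "x \<in> tangent_space \<A> p" "\<And>i. i \<in> I \<Longrightarrow> smooth_real UNIV (f i)"
  shows "x (\<lambda>q. \<Sum>i\<in>I. f i q) = (\<Sum>i\<in>I. x (f i))"
  using assms(2)
proof (induction I rule: infinite_finite_induct)
  case (insert i I)
  then show ?case
    using tangent_add[OF assms(1), of "f i" "\<lambda>q. \<Sum>i\<in>I. f i q"] smooth_real_sum[OF open_UNIV, of I f] by simp
qed (use tangent_const[OF assms(1), of 0] in auto)

text \<open>A bump \<open>c\<close> at \<open>p\<close> supported where \<open>f\<close> and
  \<open>g\<close> agree has product 0 with \<open>f - g\<close>; the Leibniz rule at
  \<open>p\<close> turns this into \<open>x (f - g) = 0\<close>.\<close>

lemma tangent_local:
  assumes x: "x \<in> tangent_space \<A> p" and f: "smooth_real UNIV f" and g: "smooth_real UNIV g"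
    and T: "open T" "p \<in> T" "\<And>q. q \<in> T \<Longrightarrow> f q = g q"
  shows "x f = x g"
proof -
  from bump[OF T(1,2)] obtain c K S where c: "smooth_real UNIV c" "K \<subseteq> T" "\<And>q. q \<notin> K \<Longrightarrow> c q = 0"
    "p \<in> S" "\<And>q. q \<in> S \<Longrightarrow> c q = 1" by metis
  let ?d = "\<lambda>q. f q - g q"
  have d: "smooth_real UNIV ?d" using smooth_real_diff[OF open_UNIV f g] .
  have "(\<lambda>q. c q * ?d q) = (\<lambda>q. 0)" using c(2,3) T(3) by (intro ext) (metis diff_self mult_eq_0_iff subsetD)
  then have "x c * ?d p + c p * x ?d = 0"
    using tangent_mult[OF x c(1) d] tangent_const[OF x, of 0] by simp
  then have "x ?d = 0" using T(2,3) c(4,5) by simp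
  then show ?thesis using tangent_diff[OF x f g] by simp
qed

lemma smooth_cut_coordinate:
  assumes U: "(U, \<psi>) \<in> \<A>" and z: "smooth_real UNIV z" "closed K" "K \<subseteq> U" "\<And>q. q \<notin> K \<Longrightarrow> z q = 0"
  shows "smooth_real UNIV (\<lambda>q. z q * (\<psi> q \<bullet> b))"
proof -
  have ch: "is_chart (U, \<psi>)" using charts U by blast
  have "smooth_real (U \<inter> UNIV) (\<lambda>q. \<psi> q \<bullet> b)"
    by (rule smooth_real_chart_compose[OF U open_UNIV smooth_on_bounded_linear[OF _ bounded_linear_inner_left]])
      (use is_chart_open_image[OF ch open_UNIV] in simp)
  then show ?thesis
    by (intro smooth_real_extend[OF z(1) _ is_chart_open[OF ch] z(2,3,4)]) auto
qed

text \<open>Hadamard's lemma writes \<open>f - f p\<close> near \<open>p\<close> as a sum of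
  coordinate differences times smooth factors, and the Leibniz rule retains the values of the
  factors at \<open>p\<close>, which are partial derivatives. As \<open>x\<close> acts on global
  functions, \<open>z\<close> cuts off the coordinates.\<close>

lemma tangent_coordinates:
  assumes U: "(U, \<psi>) \<in> \<A>" and z: "smooth_real UNIV z" "closed K" "K \<subseteq> U" "\<And>q. q \<notin> K \<Longrightarrow> z q = 0"
    and T: "open T" "T \<subseteq> U" "\<And>q. q \<in> T \<Longrightarrow> z q = 1" "p \<in> T"
    and x: "x \<in> tangent_space \<A> p" and f: "smooth_real UNIV f"
  shows "x f = (\<Sum>b\<in>Basis. x (\<lambda>q. z q * (\<psi> q \<bullet> b)) * frechet_derivative (f \<circ> inv_into U \<psi>) (at (\<psi> p)) b)"
proof -
  have ch: "is_chart (U, \<psi>)" using charts U by blast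
  have "open (\<psi> ` T)" using is_chart_open_image[OF ch T(1)] T(2) by (simp add: inf_absorb2)
  then obtain r where r: "r > 0" "ball (\<psi> p) r \<subseteq> \<psi> ` T"
    using T(4) open_contains_ball by blast
  let ?F = "f \<circ> inv_into U \<psi>"
  have "smooth_on (\<psi> ` (U \<inter> UNIV)) ?F" using smooth_real_chart[OF f U] .
  then have "smooth_on (ball (\<psi> p) r) ?F"
    by (rule smooth_on_subset) (use r T(2) in auto)
  then obtain g where g: "\<And>b. smooth_on (ball (\<psi> p) r) (g b)" "\<And>b. g b (\<psi> p) = frechet_derivative ?F (at (\<psi> p)) b"
    "\<And>y. y \<in> ball (\<psi> p) r \<Longrightarrow> ?F y = ?F (\<psi> p) + (\<Sum>b\<in>Basis. ((y - \<psi> p) \<bullet> b) * g b y)"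
    using hadamard[OF _ r(1)] by blast
  define B where "B = \<psi> -` ball (\<psi> p) r \<inter> U \<inter> T"
  have opU: "open U" using is_chart_open[OF ch] .
  have B: "open B" "p \<in> B" "B \<subseteq> T"
    unfolding B_def using continuous_on_open_vimage[OF opU] is_chart_continuous[OF ch] T r(1) by auto
  have gB: "smooth_real B (\<lambda>q. g b (\<psi> q))" for b
  proof -
    have "smooth_real (U \<inter> B) (\<lambda>q. g b (\<psi> q))"
      by (rule smooth_real_chart_compose[OF U B(1) smooth_on_subset[OF g(1)]]) (auto simp: B_def)
    moreover have "U \<inter> B = B" by (auto simp: B_def)
    ultimately show ?thesis by simp
  qed
  from bump[OF B(1,2)] obtain c L S where c: "smooth_real UNIV c" "compact L" "L \<subseteq> B" "\<And>q. q \<notin> L \<Longrightarrow> c q = 0"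
    "open S" "p \<in> S" "S \<subseteq> L" "\<And>q. q \<in> S \<Longrightarrow> c q = 1" by metis
  \<comment> \<open>Global replacements for the coordinate \<open>b\<close> and its Hadamard factor;
    they agree with these near \<open>p\<close>.\<close>
  let ?u = "\<lambda>b q. z q * (\<psi> q \<bullet> b)" and ?v = "\<lambda>b q. c q * g b (\<psi> q)"
  have u: "smooth_real UNIV (?u b)" for b by (rule smooth_cut_coordinate[OF U z])
  have v: "smooth_real UNIV (?v b)" for b
    by (rule smooth_real_extend[OF c(1) gB B(1) compact_imp_closed[OF c(2)] c(3,4)])
  have uc: "smooth_real UNIV (\<lambda>q. ?u b q - \<psi> p \<bullet> b)" for b
    by (intro smooth_real_diff u smooth_real_const open_UNIV)
  have uv: "smooth_real UNIV (\<lambda>q. (?u b q - \<psi> p \<bullet> b) * ?v b q)" for b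
    by (intro smooth_real_mult uc v open_UNIV)
  let ?f = "\<lambda>q. f p + (\<Sum>b\<in>Basis. (?u b q - \<psi> p \<bullet> b) * ?v b q)"
  have "f q = ?f q" if "q \<in> S" for q
  proof -
    have "q \<in> B" using that c by blast
    then have q: "q \<in> U" "q \<in> T" "\<psi> q \<in> ball (\<psi> p) r" by (auto simp: B_def)
    then show ?thesis
      using g(3)[of "\<psi> q"] T c(8)[OF that] is_chart_inv[OF ch] by (simp add: inner_diff_left subset_iff)
  qed
  then have "x f = x ?f"
    by (intro tangent_local[OF x f _ c(5,6)] smooth_real_add smooth_real_sum uv smooth_real_const open_UNIV)
  also have "\<dots> = x (\<lambda>q. \<Sum>b\<in>Basis. (?u b q - \<psi> p \<bullet> b) * ?v b q)"
    using tangent_add[OF x smooth_real_const[OF open_UNIV] smooth_real_sum[OF open_UNIV uv]] tangent_const[OF x]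
    by simp
  also have "\<dots> = (\<Sum>b\<in>Basis. x (\<lambda>q. (?u b q - \<psi> p \<bullet> b) * ?v b q))"
    by (rule tangent_sum[OF x uv])
  also have "\<dots> = (\<Sum>b\<in>Basis. x (?u b) * frechet_derivative ?F (at (\<psi> p)) b)"
  proof (rule sum.cong[OF refl])
    fix b :: 'e
    have "x (\<lambda>q. (?u b q - \<psi> p \<bullet> b) * ?v b q) =
        x (\<lambda>q. ?u b q - \<psi> p \<bullet> b) * ?v b p + (?u b p - \<psi> p \<bullet> b) * x (?v b)"
      by (rule tangent_mult[OF x uc v])
    moreover have "?u b p - \<psi> p \<bullet> b = 0" using T by simp
    moreover have "?v b p = frechet_derivative ?F (at (\<psi> p)) b" using c(6,8) g(2) by simp
    moreover have "x (\<lambda>q. ?u b q - \<psi> p \<bullet> b) = x (?u b)"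
      using tangent_diff[OF x u smooth_real_const[OF open_UNIV]] tangent_const[OF x] by simp
    ultimately show "x (\<lambda>q. (?u b q - \<psi> p \<bullet> b) * ?v b q) = x (?u b) * frechet_derivative ?F (at (\<psi> p)) b"
      by simp
  qed
  finally show ?thesis .
qed

end

section \<open>Products and vector fields\<close>

lemma vf_add_apply: "vf_add X Y p f = X p f + Y p f"
  and vf_scale_apply: "vf_scale c X p f = c * X p f"
  by (simp_all add: vf_add_def vf_scale_def)

lemma is_chart_prod:
  assumes "is_chart (U, \<psi>)" "is_chart (V, \<eta>)"
  shows "is_chart (U \<times> V, map_prod \<psi> \<eta>)"
proof -
  let ?i = "inv_into (U \<times> V) (map_prod \<psi> \<eta>)"
  have im: "map_prod \<psi> \<eta> ` (U \<times> V) = \<psi> ` U \<times> \<eta> ` V" by (auto simp: map_prod_def image_iff)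
  have inj: "inj_on (map_prod \<psi> \<eta>) (U \<times> V)"
    using is_chart_inv[OF assms(1)] is_chart_inv[OF assms(2)] by (auto intro!: inj_onI) metis+
  have inv: "?i (a, b) = (inv_into U \<psi> a, inv_into V \<eta> b)" if "a \<in> \<psi> ` U" "b \<in> \<eta> ` V" for a b
    using that inv_into_f_f[OF inj] is_chart_inv[OF assms(1)] is_chart_inv[OF assms(2)]
    by (auto simp: map_prod_def split_beta)
  have "continuous_on (\<psi> ` U \<times> \<eta> ` V) (\<lambda>z. (inv_into U \<psi> (fst z), inv_into V \<eta> (snd z)))"
    by (intro continuous_on_Pair continuous_on_compose2[OF is_chart_inv_continuous[OF assms(1)]]
        continuous_on_compose2[OF is_chart_inv_continuous[OF assms(2)]] continuous_on_fst continuous_on_snd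
        continuous_on_id) auto
  then have ci: "continuous_on (\<psi> ` U \<times> \<eta> ` V) ?i"
    by (rule continuous_on_eq) (auto simp: inv)
  have "continuous_on (U \<times> V) (\<lambda>z. (\<psi> (fst z), \<eta> (snd z)))"
    by (intro continuous_on_Pair continuous_on_compose2[OF is_chart_continuous[OF assms(1)]]
        continuous_on_compose2[OF is_chart_continuous[OF assms(2)]] continuous_on_fst continuous_on_snd
        continuous_on_id) auto
  then have cf: "continuous_on (U \<times> V) (map_prod \<psi> \<eta>)"
    by (simp add: map_prod_def case_prod_unfold)
  have "homeomorphism (U \<times> V) (map_prod \<psi> \<eta> ` (U \<times> V)) (map_prod \<psi> \<eta>) ?i"
    unfolding homeomorphism_def using cf ci inv_into_f_f[OF inj] f_inv_into_f inj
    by (auto simp: im[symmetric] inv_into_image_cancel)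
  with assms show ?thesis by (simp add: is_chart_def im open_Times)
qed

lemma prod_atlas_charts:
  assumes "\<And>c. c \<in> A \<Longrightarrow> is_chart c" "\<And>c. c \<in> B \<Longrightarrow> is_chart c" "c \<in> prod_atlas A B"
  shows "is_chart c"
  using assms is_chart_prod unfolding prod_atlas_def by blast

lemma prod_atlas_covering:
  assumes "(\<Union>c\<in>A. fst c) = UNIV" "(\<Union>c\<in>B. fst c) = UNIV"
  shows "(\<Union>c\<in>prod_atlas A B. fst c) = UNIV"
proof -
  have "(x, y) \<in> (\<Union>c\<in>prod_atlas A B. fst c)" for x y
  proof -
    obtain U \<psi> where U: "(U, \<psi>) \<in> A" "x \<in> U" by (rule covering_chart[OF assms(1)])
    obtain V \<eta> where V: "(V, \<eta>) \<in> B" "y \<in> V" by (rule covering_chart[OF assms(2)])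
    have "(U \<times> V, map_prod \<psi> \<eta>) \<in> prod_atlas A B" using U V by (auto simp: prod_atlas_def)
    then show ?thesis using U V by force
  qed
  then show ?thesis by auto
qed

lemma smooth_on_empty: "smooth_on {} f"
  by (rule smooth_on_local) simp

lemma (in smooth_manifold) smooth_map_slice:
  assumes "\<And>c. c \<in> B \<Longrightarrow> is_chart c"
  shows "smooth_map \<A> (prod_atlas \<A> B) (\<lambda>x. (x, g))"
proof -
  have "smooth_on (\<psi> ` (U \<inter> UNIV \<inter> (\<lambda>x. (x, g)) -` (U' \<times> V))) (map_prod \<psi>' \<eta> \<circ> (\<lambda>x. (x, g)) \<circ> inv_into U \<psi>)"
    if U: "(U, \<psi>) \<in> \<A>" and U': "(U', \<psi>') \<in> \<A>" and V: "(V, \<eta>) \<in> B" for U \<psi> U' \<psi>' V \<eta>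
  proof (cases "g \<in> V")
    case True
    have ch: "is_chart (U, \<psi>)" and ch': "is_chart (U', \<psi>')" using charts U U' by blast+
    have op: "open (\<psi> ` (U \<inter> U'))" by (rule is_chart_open_image[OF ch is_chart_open[OF ch']])
    have "smooth_on (\<psi> ` (U \<inter> U')) (\<lambda>y. ((\<psi>' \<circ> inv_into U \<psi>) y, \<eta> g))"
      by (rule smooth_on_Pair[OF op compatible[OF U U'] smooth_on_const[OF op]])
    moreover have "U \<inter> UNIV \<inter> (\<lambda>x. (x, g)) -` (U' \<times> V) = U \<inter> U'" using True by auto
    ultimately show ?thesis by (simp add: o_def)
  next
    case False
    then have "U \<inter> UNIV \<inter> (\<lambda>x. (x, g)) -` (U' \<times> V) = {}" by auto
    then show ?thesis by (simp only: image_empty smooth_on_empty)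
  qed
  then show ?thesis
    unfolding smooth_map_on_def
    by (auto simp: prod_atlas_def intro!: continuous_on_Pair continuous_on_id continuous_on_const)
qed

text \<open>\<open>frechet_derivative\<close> is a choice from the set of derivatives, and this set
  is the same for both functions; so points of nondifferentiability are covered as well.\<close>

lemma frechet_derivative_cong:
  assumes "open S" "x \<in> S" "\<And>y. y \<in> S \<Longrightarrow> f y = g y"
  shows "frechet_derivative f (at x) = frechet_derivative g (at x)"
proof -
  have "(f has_derivative D) (at x) \<longleftrightarrow> (g has_derivative D) (at x)" for D
    using has_derivative_transform_within_open[of f D x UNIV S g]
      has_derivative_transform_within_open[of g D x UNIV S f] assms by auto
  then show ?thesis by (simp add: frechet_derivative_def)
qed

context smooth_manifold
begin

lemma tangent_spaceI:
  assumes "\<And>f g. smooth_real UNIV f \<Longrightarrow> smooth_real UNIV g \<Longrightarrow> x (\<lambda>q. f q + g q) = x f + x g"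
    and "\<And>c f. smooth_real UNIV f \<Longrightarrow> x (\<lambda>q. c * f q) = c * x f"
    and "\<And>f g. smooth_real UNIV f \<Longrightarrow> smooth_real UNIV g \<Longrightarrow> x (\<lambda>q. f q * g q) = x f * g p + f p * x g"
    and "\<And>f. \<not> smooth_real UNIV f \<Longrightarrow> x f = 0"
  shows "x \<in> tangent_space \<A> p"
  using assms by (simp add: tangent_space_def)

lemma tangent_lincomb:
  assumes "\<And>i. i \<in> I \<Longrightarrow> x i \<in> tangent_space \<A> p"
  shows "(\<lambda>f. \<Sum>i\<in>I. c i * x i f) \<in> tangent_space \<A> p"
proof (rule tangent_spaceI)
  fix f g assume f: "smooth_real UNIV f" and g: "smooth_real UNIV g"
  show "(\<Sum>i\<in>I. c i * x i (\<lambda>q. f q + g q)) = (\<Sum>i\<in>I. c i * x i f) + (\<Sum>i\<in>I. c i * x i g)"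
    unfolding sum.distrib[symmetric]
    by (rule sum.cong[OF refl]) (simp add: tangent_add[OF assms f g] distrib_left)
  show "(\<Sum>i\<in>I. c i * x i (\<lambda>q. f q * g q)) = (\<Sum>i\<in>I. c i * x i f) * g p + f p * (\<Sum>i\<in>I. c i * x i g)"
    unfolding sum_distrib_left sum_distrib_right sum.distrib[symmetric]
    by (rule sum.cong[OF refl]) (simp add: tangent_mult[OF assms f g] distrib_left mult_ac)
next
  fix a f assume f: "smooth_real UNIV f"
  show "(\<Sum>i\<in>I. c i * x i (\<lambda>q. a * f q)) = a * (\<Sum>i\<in>I. c i * x i f)"
    unfolding sum_distrib_left
    by (rule sum.cong[OF refl]) (simp add: tangent_scale[OF assms f] mult_ac)
next
  fix f assume "\<not> smooth_real UNIV f"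
  then show "(\<Sum>i\<in>I. c i * x i f) = 0"
    using tangent_nonsmooth[OF assms] by (intro sum.neutral) simp
qed

lemma vf_tangent: "X \<in> vector_fields \<A> \<Longrightarrow> X p \<in> tangent_space \<A> p"
  and vf_smooth: "X \<in> vector_fields \<A> \<Longrightarrow> smooth_real UNIV f \<Longrightarrow> smooth_real UNIV (\<lambda>p. X p f)"
  by (auto simp: vector_fields_def)

lemma vector_fieldsI:
  assumes "\<And>p. X p \<in> tangent_space \<A> p" "\<And>f. smooth_real UNIV f \<Longrightarrow> smooth_real UNIV (\<lambda>p. X p f)"
  shows "X \<in> vector_fields \<A>"
  using assms by (simp add: vector_fields_def)

lemma vf_nonsmooth: "X \<in> vector_fields \<A> \<Longrightarrow> \<not> smooth_real UNIV f \<Longrightarrow> X p f = 0"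
  using tangent_nonsmooth vf_tangent by blast

lemma vf_bracket_closed:
  assumes X: "X \<in> vector_fields \<A>" and Y: "Y \<in> vector_fields \<A>"
  shows "vf_bracket X Y \<in> vector_fields \<A>"
proof (rule vector_fieldsI)
  note T = vf_tangent[OF X] vf_tangent[OF Y] and S = vf_smooth[OF X] vf_smooth[OF Y]
  show "vf_bracket X Y p \<in> tangent_space \<A> p" for p
  proof (rule tangent_spaceI)
    fix f g assume f: "smooth_real UNIV f" and g: "smooth_real UNIV g"
    show "vf_bracket X Y p (\<lambda>q. f q + g q) = vf_bracket X Y p f + vf_bracket X Y p g"
      by (simp add: vf_bracket_def tangent_add[OF T(1) f g] tangent_add[OF T(2) f g]
          tangent_add[OF T(1) S(2)[OF f] S(2)[OF g]] tangent_add[OF T(2) S(1)[OF f] S(1)[OF g]])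
    have m: "smooth_real UNIV (\<lambda>q. a q * b q)" if "smooth_real UNIV a" "smooth_real UNIV b" for a b
      using smooth_real_mult[OF open_UNIV that] .
    \<comment> \<open>The mixed terms \<open>W p f * V p g\<close> and \<open>V p f * W p g\<close>
      are exchanged when \<open>V\<close> and \<open>W\<close> are swapped, so they cancel in the
      commutator.\<close>
    have *: "V p (\<lambda>q. W q (\<lambda>q. f q * g q)) = V p (\<lambda>q. W q f) * g p + W p f * V p g + (V p f * W p g + f p * V p (\<lambda>q. W q g))"
      if V: "V \<in> vector_fields \<A>" and W: "W \<in> vector_fields \<A>" for V W
    proof -
      have "(\<lambda>q. W q (\<lambda>q. f q * g q)) = (\<lambda>q. W q f * g q + f q * W q g)"
        by (rule ext) (rule tangent_mult[OF vf_tangent[OF W] f g])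
      then show ?thesis
        by (simp only: tangent_add[OF vf_tangent[OF V] m[OF vf_smooth[OF W f] g] m[OF f vf_smooth[OF W g]]]
            tangent_mult[OF vf_tangent[OF V] vf_smooth[OF W f] g] tangent_mult[OF vf_tangent[OF V] f vf_smooth[OF W g]])
    qed
    show "vf_bracket X Y p (\<lambda>q. f q * g q) = vf_bracket X Y p f * g p + f p * vf_bracket X Y p g"
      unfolding vf_bracket_def *[OF X Y] *[OF Y X] by (simp add: algebra_simps)
  next
    fix c f assume f: "smooth_real UNIV f"
    show "vf_bracket X Y p (\<lambda>q. c * f q) = c * vf_bracket X Y p f"
      by (simp add: vf_bracket_def tangent_scale[OF T(1) f] tangent_scale[OF T(2) f]
          tangent_scale[OF T(1) S(2)[OF f]] tangent_scale[OF T(2) S(1)[OF f]] algebra_simps)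
  next
    fix f assume f: "\<not> smooth_real UNIV f"
    show "vf_bracket X Y p f = 0"
      by (simp add: vf_bracket_def vf_nonsmooth[OF X f] vf_nonsmooth[OF Y f] tangent_const[OF T(1), where c = 0]
          tangent_const[OF T(2), where c = 0])
  qed
  show "smooth_real UNIV (\<lambda>p. vf_bracket X Y p f)" if "smooth_real UNIV f" for f
    unfolding vf_bracket_def using that by (intro smooth_real_diff S open_UNIV)
qed

end

context principal_bundle
begin

section \<open>Invariant vector fields and the anchor\<close>

abbreviation sections where "sections \<equiv> atiyah_sections \<P> act"
abbreviation anc where "anc \<equiv> anchor \<M> \<pi>"
abbreviation smooth where "smooth \<equiv> base.smooth_real UNIV"
abbreviation smooth_total where "smooth_total \<equiv> total.smooth_real UNIV"

text \<open>The module structure of the sections over the functions on the base; the factor is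
  constant on fibres, so invariance survives.\<close>

definition smul :: "('m \<Rightarrow> real) \<Rightarrow> 'p vector_field \<Rightarrow> 'p vector_field" where
  "smul f X = (\<lambda>u F. f (\<pi> u) * X u F)"

lemma smul_apply: "smul f X u F = f (\<pi> u) * X u F"
  by (simp add: smul_def)

lemma smooth_comp_proj: "smooth f \<Longrightarrow> smooth_total (\<lambda>u. f (\<pi> u))"
  using smooth_map_on_compose[OF total.charts base.charts base.covering std_atlas_open open_UNIV open_UNIV subset_UNIV
    smooth_proj, where g = f] by (simp add: o_def)

lemma open_vimage_proj: "open T \<Longrightarrow> open (\<pi> -` T)"
  using smooth_proj by (simp add: smooth_map_on_def open_vimage)

lemma smooth_comp_act:
  assumes "smooth_total F"
  shows "smooth_total (\<lambda>u. F (act u g))"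
proof -
  have "smooth_map \<P> \<P> ((\<lambda>(u, g). act u g) \<circ> (\<lambda>u. (u, g)))"
    by (rule smooth_map_on_compose[OF total.charts prod_atlas_charts[OF total.charts structure_group.charts]
        prod_atlas_covering[OF total.covering structure_group.covering] _ open_UNIV open_UNIV subset_UNIV
        total.smooth_map_slice[OF structure_group.charts] smooth_act])
      (use total.charts in \<open>auto simp: is_chart_def\<close>)
  then have 1: "smooth_map \<P> \<P> (\<lambda>u. act u g)" by (simp add: o_def)
  show ?thesis
    using smooth_map_on_compose[OF total.charts total.charts total.covering std_atlas_open open_UNIV open_UNIV
        subset_UNIV 1 assms] by (simp add: o_def)
qed

lemma sections_vf: "X \<in> sections \<Longrightarrow> X \<in> vector_fields \<P>"
  and sections_act: "X \<in> sections \<Longrightarrow> X (act u g) F = (if smooth_total F then X u (\<lambda>w. F (act w g)) else 0)"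
  by (auto simp: atiyah_sections_def tangent_map_def o_def)

lemma sectionsI:
  assumes "X \<in> vector_fields \<P>"
    and "\<And>u g F. smooth_total F \<Longrightarrow> X (act u g) F = X u (\<lambda>w. F (act w g))"
  shows "X \<in> sections"
  using assms total.vf_nonsmooth[OF assms(1)]
  by (auto simp: atiyah_sections_def tangent_map_def o_def intro!: ext)

lemma sections_tangent: "X \<in> sections \<Longrightarrow> X u \<in> tangent_space \<P> u"
  and sections_smooth: "X \<in> sections \<Longrightarrow> smooth_total F \<Longrightarrow> smooth_total (\<lambda>u. X u F)"
  using sections_vf total.vf_tangent total.vf_smooth by blast+

text \<open>One closure lemma for several operations: products with functions, sums and scalar
  multiples follow from it with index sets of one or two elements.\<close>

lemma sections_lincomb:
  assumes "\<And>i. i \<in> I \<Longrightarrow> X i \<in> sections" "\<And>i. i \<in> I \<Longrightarrow> smooth (c i)"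
  shows "(\<lambda>u F. \<Sum>i\<in>I. c i (\<pi> u) * X i u F) \<in> sections"
proof (rule sectionsI)
  show "(\<lambda>u F. \<Sum>i\<in>I. c i (\<pi> u) * X i u F) \<in> vector_fields \<P>"
  proof (rule total.vector_fieldsI)
    show "(\<lambda>F. \<Sum>i\<in>I. c i (\<pi> u) * X i u F) \<in> tangent_space \<P> u" for u
      by (rule total.tangent_lincomb) (rule sections_tangent[OF assms(1)])
    show "smooth_total (\<lambda>u. \<Sum>i\<in>I. c i (\<pi> u) * X i u F)" if "smooth_total F" for F
      by (rule total.smooth_real_sum[OF open_UNIV total.smooth_real_mult[OF open_UNIV
            smooth_comp_proj[OF assms(2)] sections_smooth[OF assms(1) that]]])
  qed
  show "(\<Sum>i\<in>I. c i (\<pi> (act u g)) * X i (act u g) F) = (\<Sum>i\<in>I. c i (\<pi> u) * X i u (\<lambda>w. F (act w g)))"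
    if "smooth_total F" for u g F
    using assms(1) that by (intro sum.cong refl) (simp add: proj_act sections_act)
qed

lemma smul_closed: "X \<in> sections \<Longrightarrow> smooth f \<Longrightarrow> smul f X \<in> sections"
  using sections_lincomb[of "{()}" "\<lambda>_. X" "\<lambda>_. f"] by (simp add: smul_def)

lemma add_closed: "X \<in> sections \<Longrightarrow> Y \<in> sections \<Longrightarrow> vf_add X Y \<in> sections"
  using sections_lincomb[of "UNIV :: bool set" "\<lambda>b. if b then X else Y" "\<lambda>_ _. 1"] base.smooth_real_const[of UNIV 1]
  by (simp add: vf_add_def UNIV_bool add.commute)

lemma scale_closed: "X \<in> sections \<Longrightarrow> vf_scale c X \<in> sections"
  using smul_closed[of X "\<lambda>_. c"] base.smooth_real_const[of UNIV c] by (simp add: smul_def vf_scale_def)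

lemma bracket_closed:
  assumes X: "X \<in> sections" and Y: "Y \<in> sections"
  shows "vf_bracket X Y \<in> sections"
proof (rule sectionsI)
  show "vf_bracket X Y \<in> vector_fields \<P>"
    using assms by (intro total.vf_bracket_closed sections_vf)
  fix u g F assume F: "smooth_total F"
  show "vf_bracket X Y (act u g) F = vf_bracket X Y u (\<lambda>w. F (act w g))"
    using F sections_smooth[OF X F] sections_smooth[OF Y F] by (simp add: vf_bracket_def sections_act X Y)
qed

lemma anchor_apply:
  assumes "X \<in> sections" "smooth f"
  shows "anc X (\<pi> u) f = X u (\<lambda>w. f (\<pi> w))"
  using assms by (simp add: anchor_proj tangent_map_def o_def)

lemma proj_obtain: obtains u where "\<pi> u = m"
  using proj_surj by (metis surjD)

lemma anchor_nonsmooth: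
  assumes "X \<in> sections" "\<not> smooth f"
  shows "anc X m f = 0"
proof -
  obtain u where "\<pi> u = m" by (rule proj_obtain)
  then show ?thesis using anchor_proj[OF assms(1), of u] assms(2) by (auto simp: tangent_map_def)
qed

lemma anchor_tangent:
  assumes X: "X \<in> sections"
  shows "anc X m \<in> tangent_space \<M> m"
proof -
  obtain u where u: "\<pi> u = m" by (rule proj_obtain)
  note A = anchor_apply[OF X, of _ u, unfolded u] and T = sections_tangent[OF X, of u]
  show ?thesis
    using u
    by (intro base.tangent_spaceI)
      (simp_all add: A anchor_nonsmooth[OF X] base.smooth_real_add base.smooth_real_mult base.smooth_real_const
        total.tangent_add[OF T] total.tangent_mult[OF T] total.tangent_scale[OF T] smooth_comp_proj)
qed

lemma anchor_smul:
  assumes X: "X \<in> sections" and f: "smooth f"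
  shows "anc (smul f X) m h = f m * anc X m h"
proof (cases "smooth h")
  case True
  obtain u where u: "\<pi> u = m" by (rule proj_obtain)
  then show ?thesis
    using anchor_apply[OF smul_closed[OF X f] True, of u] anchor_apply[OF X True, of u] by (simp add: smul_apply)
qed (simp add: anchor_nonsmooth X smul_closed[OF X f])

lemma anchor_add:
  assumes X: "X \<in> sections" and Y: "Y \<in> sections"
  shows "anc (vf_add X Y) m h = anc X m h + anc Y m h"
proof (cases "smooth h")
  case True
  obtain u where u: "\<pi> u = m" by (rule proj_obtain)
  then show ?thesis
    using anchor_apply[OF add_closed[OF X Y] True, of u] anchor_apply[OF X True, of u] anchor_apply[OF Y True, of u]
    by (simp add: vf_add_apply)
qed (simp add: anchor_nonsmooth X Y add_closed[OF X Y])

lemma anchor_scale: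
  assumes X: "X \<in> sections"
  shows "anc (vf_scale c X) m h = c * anc X m h"
proof (cases "smooth h")
  case True
  obtain u where u: "\<pi> u = m" by (rule proj_obtain)
  then show ?thesis
    using anchor_apply[OF scale_closed[OF X] True, where u = u] anchor_apply[OF X True, of u] by (simp add: vf_scale_apply)
qed (simp add: anchor_nonsmooth X scale_closed[OF X])

lemma local_section:
  obtains U s where "open U" "m \<in> U" "smooth_map_on U \<M> \<P> s" "\<And>x. x \<in> U \<Longrightarrow> \<pi> (s x) = x"
proof -
  obtain U \<tau> \<sigma> where U: "open U" "m \<in> U" "smooth_map_on (U \<times> UNIV) (prod_atlas \<M> \<G>) \<P> \<tau>"
    "\<forall>x\<in>U. \<forall>g. \<pi> (\<tau> (x, g)) = x"
    using locally_trivial[of m] by blast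
  have "smooth_map_on U \<M> (prod_atlas \<M> \<G>) (\<lambda>x. (x, \<one>\<^bsub>G\<^esub>))"
    using smooth_map_on_subset[OF base.smooth_map_slice[OF structure_group.charts]] by blast
  then have "smooth_map_on U \<M> \<P> (\<tau> \<circ> (\<lambda>x. (x, \<one>\<^bsub>G\<^esub>)))"
    by (intro smooth_map_on_compose[OF base.charts prod_atlas_charts[OF base.charts structure_group.charts]
        prod_atlas_covering[OF base.covering structure_group.covering] _ U(1) _ _ _ U(3)])
      (use total.charts U(1) in \<open>auto simp: is_chart_def open_Times\<close>)
  then show thesis by (rule that[OF U(1,2)]) (use U(4) in simp)
qed

text \<open>Smoothness is known on the total space; composing with a local section of the bundle
  brings it down to the base.\<close>

lemma anchor_vector_field:
  assumes X: "X \<in> sections"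
  shows "anc X \<in> vector_fields \<M>"
proof (rule base.vector_fieldsI[OF anchor_tangent[OF X]])
  fix f assume f: "smooth f"
  show "smooth (\<lambda>m. anc X m f)"
  proof (rule base.smooth_real_local)
    fix m
    obtain U s where U: "open U" "m \<in> U" "smooth_map_on U \<M> \<P> s" "\<And>x. x \<in> U \<Longrightarrow> \<pi> (s x) = x"
      using local_section[of m] by blast
    have "smooth_total (\<lambda>u. X u (\<lambda>w. f (\<pi> w)))"
      by (rule sections_smooth[OF X smooth_comp_proj[OF f]])
    from smooth_map_on_compose[OF base.charts total.charts total.covering std_atlas_open U(1) open_UNIV subset_UNIV U(3) this]
    have "base.smooth_real U (\<lambda>x. X (s x) (\<lambda>w. f (\<pi> w)))" by (simp add: o_def)
    then have "base.smooth_real U (\<lambda>m. anc X m f)"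
      by (rule base.smooth_real_cong[OF U(1)]) (metis U(4) anchor_apply[OF X f])
    with U show "\<exists>T. open T \<and> m \<in> T \<and> base.smooth_real T (\<lambda>m. anc X m f)" by blast
  qed simp
qed

lemma anchor_smooth: "X \<in> sections \<Longrightarrow> smooth f \<Longrightarrow> smooth (\<lambda>m. anc X m f)"
  using anchor_vector_field base.vf_smooth by blast

lemma anchor_bracket:
  assumes X: "X \<in> sections" and Y: "Y \<in> sections" and f: "smooth f"
  shows "anc (vf_bracket X Y) m f = anc X m (\<lambda>q. anc Y q f) - anc Y m (\<lambda>q. anc X q f)"
proof -
  obtain u where u: "\<pi> u = m" by (rule proj_obtain)
  have "anc (vf_bracket X Y) m f = X u (\<lambda>w. Y w (\<lambda>w. f (\<pi> w))) - Y u (\<lambda>w. X w (\<lambda>w. f (\<pi> w)))"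
    using anchor_apply[OF bracket_closed[OF X Y] f, of u] u by (simp add: vf_bracket_def)
  also have "\<dots> = anc X m (\<lambda>q. anc Y q f) - anc Y m (\<lambda>q. anc X q f)"
    using u by (simp add: anchor_apply[OF X f, symmetric] anchor_apply[OF Y f, symmetric]
        anchor_apply[OF X anchor_smooth[OF Y f], symmetric] anchor_apply[OF Y anchor_smooth[OF X f], symmetric])
  finally show ?thesis .
qed

lemma bracket_smul:
  assumes X: "X \<in> sections" and Y: "Y \<in> sections" and f: "smooth f"
  shows "vf_bracket X (smul f Y) u F = f (\<pi> u) * vf_bracket X Y u F + anc X (\<pi> u) f * Y u F"
proof (cases "smooth_total F")
  case True
  have "X u (\<lambda>q. f (\<pi> q) * Y q F) = X u (\<lambda>q. f (\<pi> q)) * Y u F + f (\<pi> u) * X u (\<lambda>q. Y q F)"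
    by (rule total.tangent_mult[OF sections_tangent[OF X] smooth_comp_proj[OF f] sections_smooth[OF Y True]])
  then show ?thesis by (simp add: vf_bracket_def smul_def anchor_apply[OF X f] algebra_simps)
next
  case False
  then show ?thesis
    by (simp add: total.vf_nonsmooth[OF sections_vf] bracket_closed smul_closed X Y f)
qed

lemma bracket_antisym: "vf_bracket X Y u F = - vf_bracket Y X u F"
  by (simp add: vf_bracket_def)

end

section \<open>Lifting vector fields\<close>

context principal_bundle
begin

text \<open>Lifts of the coordinate fields of a chart of the base: differentiate along the slices of a
  local trivialization.\<close>

lemma coordinate_lift:
  obtains T U \<psi> z K A where
    "(U, \<psi>) \<in> \<M>" "smooth z" "closed K" "K \<subseteq> U" "\<And>q. q \<notin> K \<Longrightarrow> z q = 0"
    "open T" "T \<subseteq> U" "\<And>q. q \<in> T \<Longrightarrow> z q = 1" "m \<in> T"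
    "\<And>b. A b \<in> sections"
    "\<And>b q f. q \<in> T \<Longrightarrow> smooth f \<Longrightarrow>
      anc (A b) q f = frechet_derivative (f \<circ> inv_into U \<psi>) (at (\<psi> q)) b"
proof -
  obtain W \<tau> \<sigma> where W: "open W" "m \<in> W" and hom: "homeomorphism (W \<times> UNIV) (\<pi> -` W) \<tau> \<sigma>"
    and smt: "smooth_map_on (W \<times> UNIV) (prod_atlas \<M> \<G>) \<P> \<tau>"
    and sms: "smooth_map_on (\<pi> -` W) \<P> (prod_atlas \<M> \<G>) \<sigma>"
    and proj: "\<And>x g. x \<in> W \<Longrightarrow> \<pi> (\<tau> (x, g)) = x"
    and equi: "\<And>x g h. x \<in> W \<Longrightarrow> \<tau> (x, g \<otimes>\<^bsub>G\<^esub> h) = act (\<tau> (x, g)) h"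
    using locally_trivial[of m] by blast
  obtain U \<psi> where U: "(U, \<psi>) \<in> \<M>" "m \<in> U" "is_chart (U, \<psi>)" by (rule base.obtain_chart)
  define N where "N = U \<inter> W"
  have opU: "open U" using is_chart_open[OF U(3)] .
  have opO: "open N" using opU W(1) by (auto simp: N_def)
  have mO: "m \<in> N" using U W by (simp add: N_def)
  from base.bump[OF opO mO] obtain z K T where z: "smooth z" "compact K" "K \<subseteq> N"
    "\<And>q. q \<notin> K \<Longrightarrow> z q = 0" "open T" "m \<in> T" "T \<subseteq> K" "\<And>q. q \<in> T \<Longrightarrow> z q = 1" by metis
  \<comment> \<open>The group component in the trivialization; it labels the slice through
    \<open>u\<close>.\<close>
  define g where "g u = snd (\<sigma> u)" for u
  have sig: "\<sigma> u = (\<pi> u, g u)" and tau: "\<tau> (\<pi> u, g u) = u" if "\<pi> u \<in> W" for u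
  proof -
    have u: "u \<in> \<pi> -` W" using that by simp
    have "\<sigma> u \<in> W \<times> UNIV" using homeomorphism_image2[OF hom] u by blast
    then have 1: "fst (\<sigma> u) \<in> W" by auto
    have 2: "\<tau> (\<sigma> u) = u" using homeomorphism_apply2[OF hom u] .
    have "\<pi> u = fst (\<sigma> u)" using proj[OF 1, of "snd (\<sigma> u)"] 2 by simp
    then show "\<sigma> u = (\<pi> u, g u)" by (simp add: g_def)
    with 2 show "\<tau> (\<pi> u, g u) = u" by simp
  qed
  have g_act: "g (act u h) = g u \<otimes>\<^bsub>G\<^esub> h" if "\<pi> u \<in> W" for u h
  proof -
    have "\<tau> (\<pi> u, g u \<otimes>\<^bsub>G\<^esub> h) = act u h" using equi[OF that] tau[OF that] by simp
    moreover have "\<sigma> (\<tau> (\<pi> u, g u \<otimes>\<^bsub>G\<^esub> h)) = (\<pi> u, g u \<otimes>\<^bsub>G\<^esub> h)"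
      using homeomorphism_apply1[OF hom, of "(\<pi> u, g u \<otimes>\<^bsub>G\<^esub> h)"] that by simp
    ultimately show ?thesis by (simp add: g_def)
  qed
  \<comment> \<open>The restriction of \<open>F\<close> to the slice with label \<open>h\<close>,
    read in the chart of the base.\<close>
  define S where "S F h y = F (\<tau> (inv_into U \<psi> y, h))" for F :: "'p \<Rightarrow> real" and h :: 'g and y :: 'e
  have prodch: "is_chart c" if "c \<in> prod_atlas \<M> \<G>" for c
    using prod_atlas_charts[OF base.charts structure_group.charts that] .
  have opS: "open (\<psi> ` N)" unfolding N_def by (rule is_chart_open_image[OF U(3) W(1)])
  have psi_inv: "inv_into U \<psi> (\<psi> q) = q" if "q \<in> U" for q using is_chart_inv[OF U(3) that] .
  \<comment> \<open>A joint expression \<open>H\<close> in base and group coordinates is needed: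
    \<open>D\<close> below uses the slice with label \<open>g u\<close>, which itself varies with
    \<open>u\<close>.\<close>
  have local: "\<exists>H \<gamma> V. (V, \<gamma>) \<in> \<G> \<and> h \<in> V \<and> open (\<psi> ` N \<times> \<gamma> ` V) \<and> smooth_on (\<psi> ` N \<times> \<gamma> ` V) H \<and>
      (\<forall>y\<in>\<psi> ` N. \<forall>k\<in>V. H (y, \<gamma> k) = S F k y)"
    if F: "smooth_total F" for F h
  proof -
    obtain V \<gamma> where V: "(V, \<gamma>) \<in> \<G>" "h \<in> V" "is_chart (V, \<gamma>)" by (rule structure_group.obtain_chart)
    let ?k = "map_prod \<psi> \<gamma>"
    let ?H = "(F \<circ> \<tau>) \<circ> inv_into (U \<times> V) ?k"
    have ch: "(U \<times> V, ?k) \<in> prod_atlas \<M> \<G>" using U V by (auto simp: prod_atlas_def)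
    have "smooth_map_on (W \<times> UNIV) (prod_atlas \<M> \<G>) std_atlas (F \<circ> \<tau>)"
      by (rule smooth_map_on_compose[OF prodch total.charts total.covering std_atlas_open _ open_UNIV subset_UNIV smt F])
        (auto simp: open_Times W)
    then have "smooth_on (?k ` ((U \<times> V) \<inter> (W \<times> UNIV))) ?H"
      using ch by (force simp: smooth_map_on_def std_atlas_def)
    moreover have "?k ` ((U \<times> V) \<inter> (W \<times> UNIV)) = \<psi> ` N \<times> \<gamma> ` V" by (auto simp: N_def map_prod_def image_iff)
    ultimately have "smooth_on (\<psi> ` N \<times> \<gamma> ` V) ?H" by simp
    moreover have "open (\<psi> ` N \<times> \<gamma> ` V)"
      using opS is_chart_open_image[OF V(3) open_UNIV] by (simp add: open_Times)
    moreover have "?H (y, \<gamma> k) = S F k y" if y: "y \<in> \<psi> ` N" and k: "k \<in> V" for y k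
    proof -
      obtain q where q: "q \<in> N" "y = \<psi> q" using y by blast
      then have "inv_into (U \<times> V) ?k (?k (q, k)) = (q, k)"
        using is_chart_inv[OF prodch[OF ch], of "(q, k)"] k by (simp add: N_def)
      then show ?thesis using q psi_inv by (simp add: S_def N_def)
    qed
    ultimately show ?thesis using V by blast
  qed
  have derivS: "(S F h has_derivative (\<lambda>v. frechet_derivative H (at (y, \<gamma> h)) (v, 0))) (at y)"
    if "smooth_on (\<psi> ` N \<times> \<gamma> ` V) H" "\<forall>y\<in>\<psi> ` N. \<forall>k\<in>V. H (y, \<gamma> k) = S F k y" "h \<in> V" "y \<in> \<psi> ` N"
    for H :: "_ \<Rightarrow> real" and \<gamma> :: "'g \<Rightarrow> 'h" and V F h y
  proof -
    have H: "(H has_derivative frechet_derivative H (at (y, \<gamma> h))) (at (y, \<gamma> h))"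
      by (rule smooth_on_has_derivative[OF that(1)]) (use that in auto)
    have "((\<lambda>y. (y, \<gamma> h)) has_derivative (\<lambda>v. (v, 0))) (at y)"
      by (auto intro!: derivative_eq_intros)
    from has_derivative_compose[OF this H] show ?thesis
      by (rule has_derivative_transform_within_open[OF _ opS that(4)]) (use that in auto)
  qed
  have diffS: "S F h differentiable (at y)" if "smooth_total F" "y \<in> \<psi> ` N" for F h y
    using local[OF that(1), of h] derivS that(2) by (metis differentiable_def)
  define D where "D b F u = frechet_derivative (S F (g u)) (at (\<psi> (\<pi> u))) b" for b F u
  have Dsmooth: "total.smooth_real (\<pi> -` N) (D b F)" if F: "smooth_total F" for b F
  proof (rule total.smooth_real_local)
    show "open (\<pi> -` N)" by (rule open_vimage_proj[OF opO])
    fix u assume u: "u \<in> \<pi> -` N"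
    obtain H \<gamma> V where H: "(V, \<gamma>) \<in> \<G>" "g u \<in> V" "open (\<psi> ` N \<times> \<gamma> ` V)" "smooth_on (\<psi> ` N \<times> \<gamma> ` V) H"
      "\<forall>y\<in>\<psi> ` N. \<forall>k\<in>V. H (y, \<gamma> k) = S F k y"
      using local[OF F, of "g u"] by blast
    have chV: "is_chart (V, \<gamma>)" using structure_group.charts H(1) by blast
    let ?k = "map_prod \<psi> \<gamma>"
    have ch: "(U \<times> V, ?k) \<in> prod_atlas \<M> \<G>" using U H(1) by (auto simp: prod_atlas_def)
    define Q where "Q = \<sigma> -` (U \<times> V) \<inter> \<pi> -` W"
    have "open (\<pi> -` W)" by (rule open_vimage_proj[OF W(1)])
    moreover have "continuous_on (\<pi> -` W) \<sigma>" using sms by (simp add: smooth_map_on_def)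
    ultimately have opQ: "open Q"
      unfolding Q_def using continuous_on_open_vimage is_chart_open[OF prodch[OF ch]] by blast
    have Q: "\<pi> w \<in> N" "g w \<in> V" "\<sigma> w = (\<pi> w, g w)" if "w \<in> Q" for w
      using that sig[of w] by (auto simp: Q_def N_def)
    have uQ: "u \<in> Q" using u H(2) sig[of u] by (simp add: Q_def N_def)
    have DH: "D b F w = frechet_derivative H (at (?k (\<sigma> w))) (b, 0)" if "w \<in> Q" for w
      using frechet_derivative_at[OF derivS[OF H(4,5) Q(2)[OF that], of "\<psi> (\<pi> w)"]] Q[OF that]
      by (simp add: D_def) (metis imageI)
    have "total.smooth_real Q (D b F)"
    proof (rule total.smooth_real_by_charts[OF opQ])
      fix X \<xi> assume X: "(X, \<xi>) \<in> \<P>" and op: "open (\<xi> ` (X \<inter> Q))"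
      have "smooth_on (\<xi> ` (X \<inter> \<pi> -` W \<inter> \<sigma> -` (U \<times> V))) (?k \<circ> \<sigma> \<circ> inv_into X \<xi>)"
        using sms X ch unfolding smooth_map_on_def by blast
      then have 1: "smooth_on (\<xi> ` (X \<inter> Q)) (?k \<circ> \<sigma> \<circ> inv_into X \<xi>)"
        by (rule smooth_on_subset) (auto simp: Q_def)
      have "smooth_on (\<xi> ` (X \<inter> Q)) (\<lambda>y. frechet_derivative H (at ((?k \<circ> \<sigma> \<circ> inv_into X \<xi>) y)) (b, 0))"
        by (rule smooth_on_compose[OF op H(3) _ 1 smooth_on_derivative[OF H(4)]])
          (use Q is_chart_inv[OF total.charts[OF X]] in auto)
      then show "smooth_on (\<xi> ` (X \<inter> Q)) (D b F \<circ> inv_into X \<xi>)"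
        by (rule smooth_on_cong[OF op]) (use DH is_chart_inv[OF total.charts[OF X]] in auto)
    qed
    with opQ uQ show "\<exists>T. open T \<and> u \<in> T \<and> total.smooth_real T (D b F)" by blast
  qed
  \<comment> \<open>The factor \<open>z\<close> makes the lift global; over \<open>T\<close>, where
    \<open>z\<close> is 1, the coordinate field is lifted exactly.\<close>
  define A where "A b u F = (if smooth_total F \<and> \<pi> u \<in> N then z (\<pi> u) * D b F u else 0)" for b u F
  have S_at: "S F (g u) (\<psi> (\<pi> u)) = F u" if "\<pi> u \<in> N" for F u
    using that psi_inv tau[of u] by (simp add: S_def N_def)
  have A_tangent: "A b u \<in> tangent_space \<P> u" for b u
  proof (cases "\<pi> u \<in> N")
    case True
    then have y: "\<psi> (\<pi> u) \<in> \<psi> ` N" by blast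
    have d: "(S F (g u) has_derivative (\<lambda>v. frechet_derivative (S F (g u)) (at (\<psi> (\<pi> u))) v)) (at (\<psi> (\<pi> u)))"
      if "smooth_total F" for F
      using diffS[OF that y] by (simp add: frechet_derivative_works[symmetric])
    show ?thesis
    proof (rule total.tangent_spaceI)
      fix E F assume E: "smooth_total E" and F: "smooth_total F"
      have "S (\<lambda>q. E q + F q) (g u) = (\<lambda>y. S E (g u) y + S F (g u) y)" by (simp add: S_def fun_eq_iff)
      then have "D b (\<lambda>q. E q + F q) u = D b E u + D b F u"
        unfolding D_def using frechet_derivative_at[OF has_derivative_add[OF d[OF E] d[OF F]]] by metis
      then show "A b u (\<lambda>q. E q + F q) = A b u E + A b u F"
        using E F True total.smooth_real_add[OF open_UNIV E F] by (simp add: A_def distrib_left)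
      have "S (\<lambda>q. E q * F q) (g u) = (\<lambda>y. S E (g u) y * S F (g u) y)" by (simp add: S_def fun_eq_iff)
      then have "D b (\<lambda>q. E q * F q) u = E u * D b F u + D b E u * F u"
        unfolding D_def using frechet_derivative_at[OF has_derivative_mult[OF d[OF E] d[OF F]]] S_at[OF True]
        by metis
      then show "A b u (\<lambda>q. E q * F q) = A b u E * F u + E u * A b u F"
        using E F True total.smooth_real_mult[OF open_UNIV E F] by (simp add: A_def algebra_simps)
    next
      fix c F assume F: "smooth_total F"
      have "S (\<lambda>q. c * F q) (g u) = (\<lambda>y. c * S F (g u) y)" by (simp add: S_def fun_eq_iff)
      then have "D b (\<lambda>q. c * F q) u = c * D b F u"
        unfolding D_def using frechet_derivative_at[OF has_derivative_mult_right[OF d[OF F]]] by metis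
      then show "A b u (\<lambda>q. c * F q) = c * A b u F"
        using F True total.smooth_real_mult[OF open_UNIV total.smooth_real_const[OF open_UNIV, of c] F]
        by (simp add: A_def)
    qed (simp add: A_def)
  qed (auto simp: A_def intro!: total.tangent_spaceI)
  have A_sections: "A b \<in> sections" for b
  proof (rule sectionsI)
    show "A b \<in> vector_fields \<P>"
    proof (rule total.vector_fieldsI[OF A_tangent])
      fix F assume F: "smooth_total F"
      have contpi: "continuous_on UNIV \<pi>" using smooth_proj by (simp add: smooth_map_on_def)
      have "smooth_total (\<lambda>u. z (\<pi> u) * D b F u)"
      proof (rule total.smooth_real_extend[OF smooth_comp_proj[OF z(1)] Dsmooth[OF F]])
        show "open (\<pi> -` N)" by (rule open_vimage_proj[OF opO])
        show "closed (\<pi> -` K)" using compact_imp_closed[OF z(2)] contpi by (simp add: closed_vimage)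
      qed (use z(3,4) in auto)
      moreover have "A b u F = z (\<pi> u) * D b F u" for u
        using F z(3) z(4)[of "\<pi> u"] by (auto simp: A_def)
      ultimately show "smooth_total (\<lambda>u. A b u F)" by simp
    qed
    fix u h F assume F: "smooth_total F"
    \<comment> \<open>Right translation by \<open>h\<close> carries the slice through
      \<open>u\<close> to the slice through \<open>act u h\<close> and keeps base points; hence the
      lift is invariant.\<close>
    have "D b F (act u h) = D b (\<lambda>w. F (act w h)) u" if u: "\<pi> u \<in> N"
    proof -
      have uW: "\<pi> u \<in> W" using u by (simp add: N_def)
      have eq: "S F (g (act u h)) y = S (\<lambda>w. F (act w h)) (g u) y" if "y \<in> \<psi> ` N" for y
        using that psi_inv equi g_act[OF uW] by (auto simp: S_def N_def)
      have "frechet_derivative (S F (g (act u h))) (at (\<psi> (\<pi> u))) =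
          frechet_derivative (S (\<lambda>w. F (act w h)) (g u)) (at (\<psi> (\<pi> u)))"
        by (rule frechet_derivative_cong[OF opS imageI[OF u] eq])
      then show ?thesis by (simp only: D_def proj_act)
    qed
    then show "A b (act u h) F = A b u (\<lambda>w. F (act w h))"
      using F smooth_comp_act[OF F] by (simp add: A_def proj_act)
  qed
  show thesis
  proof (rule that[OF U(1) z(1) compact_imp_closed[OF z(2)] _ z(4) z(5) _ z(8) z(6) A_sections])
    show "K \<subseteq> U" "T \<subseteq> U" using z(3,7) by (auto simp: N_def)
    fix b q f assume q: "q \<in> T" and f: "smooth f"
    obtain u where u: "\<pi> u = q" by (rule proj_obtain)
    have qO: "q \<in> N" using q z by blast
    have "frechet_derivative (S (\<lambda>w. f (\<pi> w)) (g u)) (at (\<psi> q)) = frechet_derivative (f \<circ> inv_into U \<psi>) (at (\<psi> q))"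
      by (rule frechet_derivative_cong[OF opS]) (use qO proj psi_inv in \<open>auto simp: S_def N_def\<close>)
    then show "anc (A b) q f = frechet_derivative (f \<circ> inv_into U \<psi>) (at (\<psi> q)) b"
      using anchor_apply[OF A_sections f, of b u] u qO z(8)[OF q] smooth_comp_proj[OF f]
      by (simp add: A_def D_def)
  qed
qed

lemma anchor_sum:
  assumes "\<And>i. i \<in> I \<Longrightarrow> X i \<in> sections" "\<And>i. i \<in> I \<Longrightarrow> smooth (c i)"
    and f: "smooth f"
  shows "anc (\<lambda>u F. \<Sum>i\<in>I. c i (\<pi> u) * X i u F) m f = (\<Sum>i\<in>I. c i m * anc (X i) m f)"
proof -
  obtain u where u: "\<pi> u = m" by (rule proj_obtain)
  have X: "(\<lambda>u F. \<Sum>i\<in>I. c i (\<pi> u) * X i u F) \<in> sections" by (rule sections_lincomb[OF assms(1,2)])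
  show ?thesis
    using anchor_apply[OF X f, of u] u anchor_apply[OF assms(1) f, of _ u] by simp
qed

text \<open>This is \<open>coordinate_lift\<close> with the chart eliminated: only global functions
  and global sections remain, and the functions \<open>x b\<close> determine every tangent vector
  over \<open>T\<close>. The last clause shows that the anchor vanishes at no point.\<close>

lemma local_frame:
  "\<exists>(x :: 'e \<Rightarrow> 'm \<Rightarrow> real) A T. (\<forall>b. smooth (x b)) \<and> (\<forall>b. A b \<in> sections) \<and> open T \<and> m \<in> T \<and>
    (\<forall>q\<in>T. \<forall>v\<in>tangent_space \<M> q. \<forall>f. smooth f \<longrightarrow> v f = (\<Sum>b\<in>Basis. v (x b) * anc (A b) q f)) \<and>
    (\<forall>b\<in>Basis. anc (A b) m (x b) = 1)"
proof -
  obtain T U \<psi> z K A where *: "(U, \<psi>) \<in> \<M>" "smooth z" "closed K" "K \<subseteq> U" "\<And>q. q \<notin> K \<Longrightarrow> z q = 0"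
    "open T" "T \<subseteq> U" "\<And>q. q \<in> T \<Longrightarrow> z q = 1" "m \<in> T"
    and A: "\<And>b. A b \<in> sections"
    "\<And>b q f. q \<in> T \<Longrightarrow> smooth f \<Longrightarrow>
      anc (A b) q f = frechet_derivative (f \<circ> inv_into U \<psi>) (at (\<psi> q)) b"
    using coordinate_lift[of m] by metis
  have ch: "is_chart (U, \<psi>)" using base.charts *(1) by blast
  have op: "open (\<psi> ` T)" using is_chart_open_image[OF ch *(6)] *(7) by (simp add: inf_absorb2)
  define x where "x b q = z q * (\<psi> q \<bullet> b)" for b q
  have x: "smooth (x b)" for b unfolding x_def[abs_def] by (rule base.smooth_cut_coordinate[OF *(1-5)])
  have "anc (A b) m (x b) = 1" if b: "b \<in> Basis" for b
  proof -
    have "frechet_derivative (x b \<circ> inv_into U \<psi>) (at (\<psi> m)) = frechet_derivative (\<lambda>y. y \<bullet> b) (at (\<psi> m))"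
      by (rule frechet_derivative_cong[OF op]) (use * is_chart_inv[OF ch] in \<open>auto simp: x_def\<close>)
    also have "\<dots> = (\<lambda>v. v \<bullet> b)"
      by (rule frechet_derivative_at[symmetric]) (auto intro!: derivative_eq_intros)
    finally show ?thesis using A(2)[OF *(9) x, of b] b by (simp add: inner_same_Basis)
  qed
  moreover have "v f = (\<Sum>b\<in>Basis. v (x b) * anc (A b) q f)"
    if "q \<in> T" "v \<in> tangent_space \<M> q" "smooth f" for q v f
    using base.tangent_coordinates[OF *(1-8) that] A(2)[OF that(1,3)] by (simp add: x_def[abs_def])
  ultimately show ?thesis
    using x A(1) *(6,9) by (intro exI[of _ x] exI[of _ A] exI[of _ T]) simp
qed

lemma anchor_nonzero: "\<exists>a\<in>sections. \<exists>f. smooth f \<and> anc a m f \<noteq> 0"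
proof -
  obtain b :: 'e where "b \<in> Basis" using nonempty_Basis by blast
  then show ?thesis using local_frame[of m] by (metis one_neq_zero)
qed

lemma anchor_local_surj:
  assumes v: "v \<in> vector_fields \<M>"
  shows "\<exists>T. open T \<and> m \<in> T \<and> (\<exists>a. a \<in> sections \<and> (\<forall>q\<in>T. \<forall>f. smooth f \<longrightarrow> anc a q f = v q f))"
proof -
  from local_frame[of m] obtain x :: "'e \<Rightarrow> 'm \<Rightarrow> real" and A T where
    x: "\<forall>b. smooth (x b)" and A: "\<forall>b. A b \<in> sections" and T: "open T" "m \<in> T"
    and rep: "\<forall>q\<in>T. \<forall>v\<in>tangent_space \<M> q. \<forall>f. smooth f \<longrightarrow> v f = (\<Sum>b\<in>Basis. v (x b) * anc (A b) q f)"
    by (elim exE conjE) (rule that)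
  let ?a = "\<lambda>u F. \<Sum>b\<in>Basis. v (\<pi> u) (x b) * A b u F"
  have c: "smooth (\<lambda>q. v q (x b))" for b by (rule base.vf_smooth[OF v x[rule_format]])
  have "?a \<in> sections" by (rule sections_lincomb[OF A[rule_format] c])
  moreover have "anc ?a q f = v q f" if "q \<in> T" "smooth f" for q f
    using anchor_sum[where I = Basis and X = A, OF A[rule_format] c that(2)] rep[rule_format, OF that(1) base.vf_tangent[OF v] that(2)]
    by simp
  ultimately show ?thesis using T by blast
qed

text \<open>Near a point the coefficients of \<open>v\<close> in a local frame define a lift. A
  partition of unity glues the local lifts, and the result is a lift because the anchor is linear
  over functions.\<close>

lemma anchor_surj:
  assumes v: "v \<in> vector_fields \<M>"
  obtains a where "a \<in> sections" "anc a = v"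
proof -
  let ?P = "\<lambda>T a. a \<in> sections \<and> (\<forall>q\<in>T. \<forall>f. smooth f \<longrightarrow> anc a q f = v q f)"
  have cov: "\<exists>U\<in>{T. \<exists>a. ?P T a}. open U \<and> p \<in> U" for p
    using anchor_local_surj[OF v, of p] by auto
  show thesis
  proof (rule base.partition_of_unity[OF cov], goal_cases)
    case (1 \<phi> K)
    note \<phi> = 1(1,4,5,6,7)
  have "\<exists>a. a \<in> sections \<and> (\<forall>q\<in>K k. \<forall>f. smooth f \<longrightarrow> anc a q f = v q f)" for k
    using \<phi>(2)[of k] by blast
  then obtain A where A: "\<And>k. A k \<in> sections"
    "\<And>k q f. q \<in> K k \<Longrightarrow> smooth f \<Longrightarrow> anc (A k) q f = v q f" by metis
  define a where "a u F = (\<Sum>k. \<phi> k (\<pi> u) * A k u F)" for u F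
  have fin: "\<exists>n. (\<forall>F. a u F = (\<Sum>k<n. \<phi> k (\<pi> u) * A k u F)) \<and> (\<forall>k\<ge>n. \<phi> k (\<pi> u) = 0)" for u
  proof -
    obtain n where n: "\<forall>k\<ge>n. \<phi> k (\<pi> u) = 0" using \<phi>(4) by blast
    then show ?thesis unfolding a_def
      by (intro exI[of _ n] conjI allI suminf_finite) auto
  qed
  have a: "a \<in> sections"
  proof (rule sectionsI)
    show "a \<in> vector_fields \<P>"
    proof (rule total.vector_fieldsI)
      show "a u \<in> tangent_space \<P> u" for u
      proof -
        obtain n where "\<forall>F. a u F = (\<Sum>k<n. \<phi> k (\<pi> u) * A k u F)" using fin by blast
        then have "a u = (\<lambda>F. \<Sum>k<n. \<phi> k (\<pi> u) * A k u F)" by blast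
        then show ?thesis using total.tangent_lincomb[of "{..<n}" "\<lambda>k. A k u" u] sections_tangent[OF A(1)] by simp
      qed
      show "smooth_total (\<lambda>u. a u F)" if F: "smooth_total F" for F
        unfolding a_def
      proof (rule total.smooth_suminf)
        show "smooth_total (\<lambda>u. \<phi> k (\<pi> u) * A k u F)" for k
          by (rule total.smooth_real_mult[OF open_UNIV smooth_comp_proj[OF \<phi>(1)] sections_smooth[OF A(1) F]])
        fix u
        obtain T n where T: "open T" "\<pi> u \<in> T" "\<forall>k\<ge>n. \<forall>q\<in>T. \<phi> k q = 0" using \<phi>(4) by blast
        show "\<exists>T n. open T \<and> u \<in> T \<and> (\<forall>k\<ge>n. \<forall>q\<in>T. \<phi> k (\<pi> q) * A k q F = 0)"
          using T open_vimage_proj[OF T(1)] by (intro exI[of _ "\<pi> -` T"] exI[of _ n]) auto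
      qed
    qed
    show "a (act u g) F = a u (\<lambda>w. F (act w g))" if "smooth_total F" for u g F
      using that by (simp add: a_def proj_act sections_act[OF A(1)])
  qed
  have "anc a m f = v m f" for m f
  proof (cases "smooth f")
    case True
    obtain u where u: "\<pi> u = m" by (rule proj_obtain)
    obtain n where n: "\<forall>F. a u F = (\<Sum>k<n. \<phi> k (\<pi> u) * A k u F)" "\<forall>k\<ge>n. \<phi> k (\<pi> u) = 0" using fin by blast
    have "anc a m f = (\<Sum>k<n. \<phi> k m * anc (A k) m f)"
      using anchor_apply[OF a True, of u] n(1) u anchor_apply[OF A(1) True, of _ u] by simp
    also have "\<dots> = (\<Sum>k<n. \<phi> k m * v m f)"
    proof (rule sum.cong[OF refl])
      show "\<phi> k m * anc (A k) m f = \<phi> k m * v m f" for k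
        using \<phi>(3)[of m k] A(2)[of m k, OF _ True] by (cases "m \<in> K k") auto
    qed
    also have "\<dots> = v m f"
      using \<phi>(5)[of m] suminf_finite[of "{..<n}" "\<lambda>k. \<phi> k m"] n(2) u by (simp add: sum_distrib_right[symmetric])
    finally show ?thesis .
  qed (simp add: anchor_nonsmooth[OF a] base.vf_nonsmooth[OF v])
  then have "anc a = v" by blast
  with a show ?case by (rule that)
  qed
qed

end

section \<open>Subalgebras attached to points\<close>

definition lie_subalgebra :: "'m vector_field set \<Rightarrow> 'm vector_field set \<Rightarrow> bool" where
  "lie_subalgebra L S \<longleftrightarrow> S \<subseteq> L \<and> (\<forall>X\<in>S. \<forall>Y\<in>S. vf_add X Y \<in> S) \<and> (\<forall>c. \<forall>X\<in>S. vf_scale c X \<in> S) \<and>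
     (\<forall>X\<in>S. \<forall>Y\<in>S. vf_bracket X Y \<in> S)"

definition lie_ideal :: "'m vector_field set \<Rightarrow> 'm vector_field set \<Rightarrow> bool" where
  "lie_ideal L I \<longleftrightarrow> I \<subseteq> L \<and> (\<forall>X\<in>I. \<forall>Y\<in>I. vf_add X Y \<in> I) \<and> (\<forall>c. \<forall>X\<in>I. vf_scale c X \<in> I) \<and>
     (\<forall>X\<in>L. \<forall>Y\<in>I. vf_bracket X Y \<in> I)"

text \<open>For \<open>isotropy m\<close> this consists of the sections whose image under the anchor
  has vanishing 1-jet at \<open>m\<close>: bracketing with arbitrary sections detects the first
  derivatives.\<close>

definition lie_core :: "'m vector_field set \<Rightarrow> 'm vector_field set \<Rightarrow> 'm vector_field set" where
  "lie_core L S = {X \<in> S. \<forall>Y\<in>L. vf_bracket X Y \<in> S}"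

text \<open>The recursion over \<open>vf_add\<close> and \<open>vf_scale\<close> lets an isomorphism
  be moved through by induction in \<open>point_like_image\<close>.\<close>

primrec vf_lincomb :: "(nat \<Rightarrow> real) \<Rightarrow> (nat \<Rightarrow> 'm vector_field) \<Rightarrow> nat \<Rightarrow> 'm vector_field" where
  "vf_lincomb c X 0 = vf_scale (c 0) (X 0)"
| "vf_lincomb c X (Suc n) = vf_add (vf_lincomb c X n) (vf_scale (c (Suc n)) (X (Suc n)))"

text \<open>A weak form of finite codimension of the core, phrased without quotient spaces.\<close>

definition small_core :: "'m vector_field set \<Rightarrow> 'm vector_field set \<Rightarrow> bool" where
  "small_core L S \<longleftrightarrow> (\<forall>X::nat \<Rightarrow> 'm vector_field. (\<forall>i. X i \<in> L) \<longrightarrow>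
     (\<exists>p::real poly. p \<noteq> 0 \<and> vf_lincomb (coeff p) X (degree p) \<in> lie_core L S))"

text \<open>This countability condition excludes subalgebras that contain all compactly supported sections,
  that is, points at infinity.\<close>

definition countable_ideal_type :: "'m vector_field set \<Rightarrow> 'm vector_field set \<Rightarrow> bool" where
  "countable_ideal_type L S \<longleftrightarrow> (\<exists>A::nat \<Rightarrow> 'm vector_field. (\<forall>i. A i \<in> L - S) \<and>
     (\<forall>I. lie_ideal L I \<longrightarrow> \<not> I \<subseteq> S \<longrightarrow> (\<exists>i. A i \<in> I)))"

definition point_like :: "'m vector_field set \<Rightarrow> 'm vector_field set \<Rightarrow> bool" where
  "point_like L S \<longleftrightarrow> lie_subalgebra L S \<and> small_core L S \<and> countable_ideal_type L S"

lemma vf_lincomb_apply: "vf_lincomb c X n p f = (\<Sum>i\<le>n. c i * X i p f)"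
  by (induction n) (simp_all add: vf_add_apply vf_scale_apply)

lemma vf_eqI: "(\<And>p f. X p f = Y p f) \<Longrightarrow> X = (Y :: 'm vector_field)"
  by (simp add: fun_eq_iff)

section \<open>Linear conditions on polynomials, and Wronskians\<close>

text \<open>Finitely many linear conditions meet infinitely many coefficients. The vanishing order
  \<open>r\<close> serves the induction: it provides a second solution \<open>q\<close> of degree
  above that of \<open>p\<close>, so that the combination satisfying the new condition cannot be
  0.\<close>

lemma poly_kernel:
  fixes l :: "'b \<Rightarrow> nat \<Rightarrow> real"
  assumes "finite B"
  shows "\<exists>p. p \<noteq> 0 \<and> (\<forall>j<r. coeff p j = 0) \<and> (\<forall>b\<in>B. (\<Sum>i\<le>degree p. coeff p i * l b i) = 0)"
  using assms
proof (induction B arbitrary: r rule: finite_induct)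
  case empty
  show ?case by (intro exI[of _ "monom 1 r"]) auto
next
  case (insert b B)
  define E where "E c p = (\<Sum>i\<le>degree p. coeff p i * l c i)" for c p
  have E: "E c p = (\<Sum>i\<le>n. coeff p i * l c i)" if "degree p \<le> n" for c p n
    unfolding E_def using that by (intro sum.mono_neutral_left) (auto simp: coeff_eq_0)
  have E_lin: "E c (smult x p - smult y q) = x * E c p - y * E c q" for c x y p q
  proof -
    define n where "n = max (degree p) (degree q)"
    have "degree (smult x p - smult y q) \<le> n" "degree p \<le> n" "degree q \<le> n"
      unfolding n_def using degree_diff_le_max[of "smult x p" "smult y q"] degree_smult_le[of x p] degree_smult_le[of y q]
      by auto
    then show ?thesis
      by (simp add: E sum_distrib_left sum_subtractf[symmetric] algebra_simps)
  qed
  obtain p where p: "p \<noteq> 0" "\<forall>j<r. coeff p j = 0" "\<forall>c\<in>B. E c p = 0"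
    using insert.IH[of r] unfolding E_def by blast
  obtain q where q: "q \<noteq> 0" "\<forall>j<max r (Suc (degree p)). coeff q j = 0" "\<forall>c\<in>B. E c q = 0"
    using insert.IH unfolding E_def by blast
  show ?case
  proof (cases "E b p = 0")
    case True
    then show ?thesis using p unfolding E_def by blast
  next
    case False
    let ?s = "smult (E b p) q - smult (E b q) p"
    have "degree q > degree p"
    proof (rule ccontr)
      assume "\<not> degree q > degree p"
      then have "coeff q (degree q) = 0" using q(2) by auto
      then show False using q(1) by simp
    qed
    then have "coeff ?s (degree q) \<noteq> 0" using False q(1) by (simp add: coeff_eq_0)
    then have "?s \<noteq> 0" by (metis coeff_0)
    moreover have "\<forall>j<r. coeff ?s j = 0" using p(2) q(2) by auto
    moreover have "\<forall>c\<in>insert b B. E c ?s = 0" using p(3) q(3) by (auto simp: E_lin)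
    ultimately show ?thesis unfolding E_def by blast
  qed
qed

text \<open>The coefficient in degree \<open>degree p + degree q - 1\<close> is the product of the
  leading coefficients times the difference of the degrees.\<close>

lemma wronskian_nonzero:
  fixes p q :: "real poly"
  assumes "p \<noteq> 0" "degree q > degree p"
  shows "p * pderiv q - q * pderiv p \<noteq> 0"
proof -
  obtain d where d: "degree q = Suc d" using assms(2) by (cases "degree q") auto
  have pq: "coeff (p * pderiv q) (degree p + d) = lead_coeff p * (real (Suc d) * lead_coeff q)"
    using coeff_mult_degree_sum[of p "pderiv q"] d by (simp add: degree_pderiv coeff_pderiv)
  have qp: "coeff (q * pderiv p) (degree p + d) = real (degree p) * lead_coeff p * lead_coeff q"
  proof (cases "degree p")
    case 0
    then have "pderiv p = 0" by (simp add: pderiv_eq_0_iff)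
    with 0 show ?thesis by simp
  next
    case (Suc e)
    then show ?thesis
      using coeff_mult_degree_sum[of q "pderiv p"] d by (simp add: degree_pderiv coeff_pderiv add.commute)
  qed
  have "lead_coeff q \<noteq> 0" using assms(2) by (metis degree_0 leading_coeff_0_iff not_less0)
  moreover have "real (Suc d) - real (degree p) \<noteq> 0" using assms(2) d by simp
  moreover have "coeff (p * pderiv q - q * pderiv p) (degree p + d) =
      lead_coeff p * lead_coeff q * (real (Suc d) - real (degree p))"
    unfolding coeff_diff pq qp by (simp only: algebra_simps)
  ultimately have "coeff (p * pderiv q - q * pderiv p) (degree p + d) \<noteq> 0" using assms(1) by simp
  then show ?thesis by (metis coeff_0)
qed

context smooth_manifold
begin

lemma smooth_real_poly: "smooth_real UNIV f \<Longrightarrow> smooth_real UNIV (\<lambda>q. poly p (f q))"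
  by (induction p) (auto intro!: smooth_real_add[OF open_UNIV] smooth_real_mult[OF open_UNIV] smooth_real_const[OF open_UNIV])

lemma tangent_poly:
  assumes x: "x \<in> tangent_space \<A> m" and f: "smooth_real UNIV f"
  shows "x (\<lambda>q. poly p (f q)) = poly (pderiv p) (f m) * x f"
proof (induction p)
  case 0
  then show ?case using tangent_const[OF x, of 0] by simp
next
  case (pCons c p)
  have P: "smooth_real UNIV (\<lambda>q. poly p (f q))" by (rule smooth_real_poly[OF f])
  have "x (\<lambda>q. poly (pCons c p) (f q)) = x (\<lambda>q. f q * poly p (f q))"
    using tangent_add[OF x smooth_real_const[OF open_UNIV] smooth_real_mult[OF open_UNIV f P]] tangent_const[OF x]
    by simp
  then show ?case using pCons tangent_mult[OF x f P] by (simp add: pderiv_pCons algebra_simps)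
qed

end

context principal_bundle
begin

section \<open>Isotropy subalgebras are point-like\<close>

abbreviation isotropy where "isotropy \<equiv> isotropy_sections \<P> \<M> \<pi> act"

lemma smooth_mult: "smooth f \<Longrightarrow> smooth g \<Longrightarrow> smooth (\<lambda>q. f q * g q)"
  and smooth_add: "smooth f \<Longrightarrow> smooth g \<Longrightarrow> smooth (\<lambda>q. f q + g q)"
  and smooth_diff: "smooth f \<Longrightarrow> smooth g \<Longrightarrow> smooth (\<lambda>q. f q - g q)"
  and smooth_const: "smooth (\<lambda>q. c)"
  by (simp_all add: base.smooth_real_mult base.smooth_real_add base.smooth_real_diff base.smooth_real_const)

lemma smooth_power: "smooth f \<Longrightarrow> smooth (\<lambda>q. f q ^ n)"
  by (induction n) (simp_all add: smooth_mult smooth_const)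

lemma isotropy_iff: "a \<in> isotropy m \<longleftrightarrow> a \<in> sections \<and> (\<forall>f. smooth f \<longrightarrow> anc a m f = 0)"
  using anchor_nonsmooth by (auto simp: isotropy_sections_def fun_eq_iff)

lemma anchor_mult: "a \<in> sections \<Longrightarrow> smooth f \<Longrightarrow> smooth g \<Longrightarrow>
    anc a m (\<lambda>q. f q * g q) = anc a m f * g m + f m * anc a m g"
  using base.tangent_mult[OF anchor_tangent] .

lemma bracket_self: "vf_bracket a a u F = 0"
  by (simp add: vf_bracket_def)

lemma bracket_smul_left:
  assumes "X \<in> sections" "Y \<in> sections" "smooth f"
  shows "vf_bracket (smul f X) Y u F = f (\<pi> u) * vf_bracket X Y u F - anc Y (\<pi> u) f * X u F"
  using bracket_smul[OF assms(2,1,3), of u F] bracket_antisym[of "smul f X" Y u F] bracket_antisym[of X Y u F]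
  by simp

lemma bracket_smul_smul:
  assumes a: "a \<in> sections" and f: "smooth f" and g: "smooth g"
  shows "vf_bracket (smul f a) (smul g a) u F = (f (\<pi> u) * anc a (\<pi> u) g - g (\<pi> u) * anc a (\<pi> u) f) * a u F"
  by (simp add: bracket_smul[OF smul_closed[OF a f] a g] bracket_smul_left[OF a a f] bracket_self anchor_smul[OF a f]
      algebra_simps)

lemma lincomb_closed: "(\<And>i. X i \<in> sections) \<Longrightarrow> vf_lincomb c X n \<in> sections"
  by (induction n) (auto intro: add_closed scale_closed)

lemma anchor_lincomb: "(\<And>i. X i \<in> sections) \<Longrightarrow> anc (vf_lincomb c X n) m f = (\<Sum>i\<le>n. c i * anc (X i) m f)"
  by (induction n) (simp_all add: anchor_add anchor_scale lincomb_closed scale_closed)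

lemma isotropy_subalgebra: "lie_subalgebra sections (isotropy m)"
  unfolding lie_subalgebra_def
  by (auto simp: isotropy_iff anchor_add anchor_scale anchor_bracket anchor_smooth add_closed scale_closed bracket_closed)

text \<open>In a local frame, membership in the core follows from finitely many linear conditions on
  the 1-jet at \<open>m\<close> of the anchored field; \<open>poly_kernel\<close> solves them along
  any sequence.\<close>

lemma isotropy_small_core: "small_core sections (isotropy m)"
  unfolding small_core_def
proof (intro allI impI)
  fix X :: "nat \<Rightarrow> 'p vector_field" assume "\<forall>i. X i \<in> sections"
  then have X: "\<And>i. X i \<in> sections" by blast
  from local_frame[of m] obtain x :: "'e \<Rightarrow> 'm \<Rightarrow> real" and A T where
    x': "\<forall>b. smooth (x b)" and A': "\<forall>b. A b \<in> sections" and T: "m \<in> T"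
    and rep': "\<forall>q\<in>T. \<forall>v\<in>tangent_space \<M> q. \<forall>f. smooth f \<longrightarrow> v f = (\<Sum>b\<in>Basis. v (x b) * anc (A b) q f)"
    by (elim exE conjE) (rule that)
  note x = x'[rule_format] and A = A'[rule_format] and rep = rep'[rule_format, OF T]
  \<comment> \<open>\<open>None\<close> records the component \<open>b\<close> of the anchored field
    at \<open>m\<close>, and \<open>Some c\<close> its derivative along the frame section
    \<open>A c\<close>.\<close>
  define l where "l e i = (case e of (b, None) \<Rightarrow> anc (X i) m (x b)
      | (b, Some c) \<Rightarrow> anc (A c) m (\<lambda>q. anc (X i) q (x b)))" for e i
  have fin: "finite ((Basis :: 'e set) \<times> insert None (Some ` (Basis :: 'e set)))" by simp
  obtain p where p: "p \<noteq> 0"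
    "\<forall>e\<in>Basis \<times> insert None (Some ` Basis). (\<Sum>i\<le>degree p. coeff p i * l e i) = 0"
    using poly_kernel[OF fin, of 0 l] by blast
  define a where "a = vf_lincomb (coeff p) X (degree p)"
  have a: "a \<in> sections" unfolding a_def by (rule lincomb_closed[OF X])
  have 1: "anc a m (x b) = 0" if "b \<in> Basis" for b
    using p(2)[rule_format, of "(b, None)"] that by (simp add: a_def anchor_lincomb[OF X] l_def)
  have 2: "anc (A c) m (\<lambda>q. anc a q (x b)) = 0" if "b \<in> Basis" "c \<in> Basis" for b c
  proof -
    have s: "smooth (\<lambda>q. anc (X i) q (x b))" for i by (rule anchor_smooth[OF X x])
    have "anc (A c) m (\<lambda>q. anc a q (x b)) = (\<Sum>i\<le>degree p. coeff p i * anc (A c) m (\<lambda>q. anc (X i) q (x b)))"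
      by (simp add: a_def anchor_lincomb[OF X] base.tangent_sum[OF anchor_tangent[OF A]] base.tangent_scale[OF anchor_tangent[OF A] s]
          smooth_mult smooth_const s)
    then show ?thesis using p(2)[rule_format, of "(b, Some c)"] that by (simp add: l_def)
  qed
  have "anc a m f = 0" if "smooth f" for f
    using rep[OF anchor_tangent[OF a] that] 1 by simp
  then have am: "a \<in> isotropy m" using a by (simp add: isotropy_iff)
  have "vf_bracket a Y \<in> isotropy m" if Y: "Y \<in> sections" for Y
  proof -
    have "anc (vf_bracket a Y) m (x b) = 0" if b: "b \<in> Basis" for b
    proof -
      have "anc Y m (\<lambda>q. anc a q (x b)) = 0"
        using rep[OF anchor_tangent[OF Y] anchor_smooth[OF a x]] 2[OF b] by simp
      then show ?thesis
        using am by (simp add: anchor_bracket[OF a Y x] isotropy_iff anchor_smooth[OF Y x])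
    qed
    then have "anc (vf_bracket a Y) m f = 0" if "smooth f" for f
      using rep[OF anchor_tangent[OF bracket_closed[OF a Y]] that] by simp
    then show ?thesis using bracket_closed[OF a Y] by (simp add: isotropy_iff)
  qed
  with am p(1) show "\<exists>p. p \<noteq> 0 \<and> vf_lincomb (coeff p) X (degree p) \<in> lie_core sections (isotropy m)"
    unfolding lie_core_def a_def by blast
qed

text \<open>The facts \<open>s1\<close> to \<open>s4\<close> enlarge what is known of the ideal:
  from the multiples D(f) b to all multiples of D(g)^2 b, and finally to D(g)^3 times functions
  times any section. A section cut off inside the set where D(g) is nonzero is of the last
  kind.\<close>

lemma ideal_contains_local:
  assumes I: "lie_ideal sections I" and bI: "b \<in> I" and g: "smooth g" and nz: "anc b m g \<noteq> 0"
  shows "\<exists>U. open U \<and> m \<in> U \<and> (\<forall>k K c. smooth k \<longrightarrow> closed K \<longrightarrow> K \<subseteq> U \<longrightarrow>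
    (\<forall>q. q \<notin> K \<longrightarrow> k q = 0) \<longrightarrow> c \<in> sections \<longrightarrow> smul k c \<in> I)"
proof -
  have IL: "\<And>X. X \<in> I \<Longrightarrow> X \<in> sections" and add: "\<And>X Y. X \<in> I \<Longrightarrow> Y \<in> I \<Longrightarrow> vf_add X Y \<in> I"
    and scale: "\<And>c X. X \<in> I \<Longrightarrow> vf_scale c X \<in> I"
    and br: "\<And>X Y. X \<in> sections \<Longrightarrow> Y \<in> I \<Longrightarrow> vf_bracket X Y \<in> I"
    using I by (auto simp: lie_ideal_def)
  have br': "vf_bracket X Y \<in> I" if "X \<in> I" "Y \<in> sections" for X Y
  proof -
    have "vf_bracket X Y = vf_scale (-1) (vf_bracket Y X)"
      by (rule vf_eqI) (simp add: vf_scale_apply bracket_antisym[of X Y])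
    then show ?thesis using scale[OF br[OF that(2,1)]] by simp
  qed
  have b: "b \<in> sections" using IL[OF bI] .
  define D where "D f q = anc b q f" for f q
  have D: "smooth (D f)" if "smooth f" for f
    using anchor_smooth[OF b that] by (simp add: D_def[abs_def])
  have Dm: "D (\<lambda>q. f q * h q) q = D f q * h q + f q * D h q" if "smooth f" "smooth h" for f h q
    using anchor_mult[OF b that] by (simp add: D_def)
  have s1: "smul (D f) b \<in> I" if f: "smooth f" for f
  proof -
    have "smul (D f) b = vf_bracket b (smul f b)"
      by (rule vf_eqI) (simp add: bracket_smul[OF b b f] bracket_self smul_apply D_def)
    then show ?thesis using br'[OF bI smul_closed[OF b f]] by simp
  qed
  \<comment> \<open>[D(f) b, h b] has the coefficient D(f) D(h) - h D(D(f)); adding D(h D(f)) b from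
    \<open>s1\<close> leaves twice the wanted coefficient.\<close>
  have s2: "smul (\<lambda>q. D f q * D h q) b \<in> I" if f: "smooth f" and h: "smooth h" for f h
  proof -
    let ?X = "vf_bracket (smul (D f) b) (smul h b)" and ?Y = "smul (D (\<lambda>q. h q * D f q)) b"
    have "smul (\<lambda>q. D f q * D h q) b = vf_scale (1 / 2) (vf_add ?X ?Y)"
      by (rule vf_eqI) (simp add: bracket_smul_smul[OF b D[OF f] h] smul_apply vf_add_apply vf_scale_apply
          Dm[OF h D[OF f]] D_def[symmetric] algebra_simps)
    then show ?thesis
      using scale[OF add[OF br'[OF s1[OF f] smul_closed[OF b h]] s1[OF smooth_mult[OF h D[OF f]]]]] by simp
  qed
  \<comment> \<open>The identity u D(g)^2 = D(g u) D(g) - D(u) D(g^2) / 2 makes an arbitrary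
    coefficient \<open>u\<close> out of products of two derivatives.\<close>
  have s3: "smul (\<lambda>q. u q * (D g q * D g q)) b \<in> I" if u: "smooth u" for u
  proof -
    let ?X = "smul (\<lambda>q. D (\<lambda>q. g q * u q) q * D g q) b" and ?Y = "smul (\<lambda>q. D u q * D (\<lambda>q. g q * g q) q) b"
    have "smul (\<lambda>q. u q * (D g q * D g q)) b = vf_add ?X (vf_scale (- 1 / 2) ?Y)"
      by (rule vf_eqI) (simp add: smul_apply vf_add_apply vf_scale_apply Dm[OF g u] Dm[OF g g] algebra_simps)
    then show ?thesis
      using add[OF s2[OF smooth_mult[OF g u] g] scale[OF s2[OF u smooth_mult[OF g g]]]] by simp
  qed
  \<comment> \<open>In [t b, g c] - [g t b, c] the brackets of \<open>b\<close> and \<open>c\<close>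
    cancel. What is left is t D(g) c and a multiple of t b, which \<open>s3\<close>
    controls.\<close>
  have s4: "smul (\<lambda>q. u q * (D g q * D g q * D g q)) c \<in> I" if u: "smooth u" and c: "c \<in> sections" for u c
  proof -
    define t where "t q = u q * (D g q * D g q)" for q
    have t: "smooth t" unfolding t_def[abs_def] by (intro smooth_mult u D g)
    have tI: "smul (\<lambda>q. v q * t q) b \<in> I" if v: "smooth v" for v
      using s3[OF smooth_mult[OF v u]] by (simp add: t_def mult.assoc)
    have tI1: "smul t b \<in> I" using s3[OF u] by (simp add: t_def[abs_def])
    let ?X = "vf_bracket (smul t b) (smul g c)" and ?Y = "vf_bracket (smul (\<lambda>q. g q * t q) b) c"
      and ?Z = "smul (\<lambda>q. anc c q g * t q) b"
    have "smul (\<lambda>q. u q * (D g q * D g q * D g q)) c = vf_add ?X (vf_scale (-1) (vf_add ?Y ?Z))"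
      by (rule vf_eqI) (simp add: smul_apply vf_add_apply vf_scale_apply bracket_smul[OF smul_closed[OF b t] c g]
          bracket_smul_left[OF b c t] bracket_smul_left[OF b c smooth_mult[OF g t]] anchor_mult[OF c g t]
          anchor_smul[OF b t] D_def[symmetric] algebra_simps, simp add: t_def)
    moreover have "?X \<in> I" by (rule br'[OF tI1 smul_closed[OF c g]])
    moreover have "?Y \<in> I" by (rule br'[OF tI[OF g] c])
    moreover have "?Z \<in> I" by (rule tI[OF anchor_smooth[OF c g]])
    ultimately show ?thesis using add scale by simp
  qed
  let ?E = "\<lambda>q. D g q * D g q * D g q" and ?U = "{q. D g q \<noteq> 0}"
  have E: "smooth ?E" by (intro smooth_mult D g)
  show ?thesis
  proof (intro exI[of _ ?U] conjI allI impI)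
    show U: "open ?U"
      using base.smooth_real_continuous[OF D[OF g]] by (intro open_Collect_neq continuous_on_const)
    show "m \<in> ?U" using nz by (simp add: D_def)
    fix k K c assume k: "smooth k" "closed K" "K \<subseteq> ?U" "\<forall>q. q \<notin> K \<longrightarrow> k q = 0" and c: "c \<in> sections"
    have "smooth (\<lambda>q. k q * inverse (?E q))"
      by (rule base.smooth_real_extend[OF k(1) base.smooth_real_inverse[OF U smooth_map_on_subset[OF E]] U k(2,3)]) (use k(4) in auto)
    note in_I = s4[OF this c]
    have "(\<lambda>q. k q * inverse (?E q) * ?E q) = k"
    proof (rule ext)
      fix q
      show "k q * inverse (?E q) * ?E q = k q"
      proof (cases "q \<in> K")
        case True
        then have nz: "?E q \<noteq> 0" using k(3) by auto
        show ?thesis by (simp only: mult.assoc[of "k q"] left_inverse[OF nz] mult_1_right)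
      qed (simp add: k(4))
    qed
    with in_I show "smul k c \<in> I" by (simp only:)
  qed
qed

text \<open>The sequence comes from a countable neighbourhood base at \<open>m\<close>: one section
  with nonzero anchor at \<open>m\<close> is cut off inside each base set.
  \<open>ideal_contains_local\<close> then puts a member into every ideal that leaves
  \<open>isotropy m\<close>.\<close>

lemma isotropy_countable_ideal_type: "countable_ideal_type sections (isotropy m)"
proof -
  obtain c f where c: "c \<in> sections" "smooth f" "anc c m f \<noteq> 0" using anchor_nonzero[of m] by blast
  obtain B :: "nat \<Rightarrow> 'm set" where B: "\<And>i. open (B i)" "\<And>i. m \<in> B i" "\<And>S. open S \<Longrightarrow> m \<in> S \<Longrightarrow> \<exists>i. B i \<subseteq> S"
    using first_countable_basis[of m] by metis
  have "\<exists>k K. smooth k \<and> closed K \<and> K \<subseteq> B i \<and> (\<forall>q. q \<notin> K \<longrightarrow> k q = 0) \<and> k m = 1" for i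
  proof -
    from base.bump[OF B(1,2)[of i]] obtain k K T where "smooth k" "compact K" "K \<subseteq> B i" "\<And>q. q \<notin> K \<Longrightarrow> k q = 0"
      "m \<in> T" "\<And>q. q \<in> T \<Longrightarrow> k q = 1" by metis
    then show ?thesis using compact_imp_closed by blast
  qed
  then obtain k K where k: "\<And>i. smooth (k i)" "\<And>i. closed (K i)" "\<And>i. K i \<subseteq> B i"
    "\<And>i q. q \<notin> K i \<Longrightarrow> k i q = 0" "\<And>i. k i m = 1" by metis
  show ?thesis
    unfolding countable_ideal_type_def
  proof (intro exI[of _ "\<lambda>i. smul (k i) c"] conjI allI impI)
    show "smul (k i) c \<in> sections - isotropy m" for i
      using c k(1,5) by (auto simp: isotropy_iff smul_closed anchor_smul)
    fix I assume I: "lie_ideal sections I" "\<not> I \<subseteq> isotropy m"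
    then obtain b where b: "b \<in> I" "b \<notin> isotropy m" by blast
    then have "b \<in> sections" using I(1) by (auto simp: lie_ideal_def)
    then obtain g where g: "smooth g" "anc b m g \<noteq> 0" using b(2) by (auto simp: isotropy_iff)
    obtain U where U: "open U" "m \<in> U"
      "\<forall>k K c. smooth k \<longrightarrow> closed K \<longrightarrow> K \<subseteq> U \<longrightarrow> (\<forall>q. q \<notin> K \<longrightarrow> k q = 0) \<longrightarrow> c \<in> sections \<longrightarrow> smul k c \<in> I"
      using ideal_contains_local[OF I(1) b(1) g] by blast
    obtain i where "B i \<subseteq> U" using B(3)[OF U(1,2)] by blast
    then have "K i \<subseteq> U" using k(3)[of i] by blast
    then have "smul (k i) c \<in> I" using U(3) k(1,2,4) c(1) by blast
    then show "\<exists>i. smul (k i) c \<in> I" ..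
  qed
qed

lemma isotropy_point_like: "point_like sections (isotropy m)"
  by (simp add: point_like_def isotropy_subalgebra isotropy_small_core isotropy_countable_ideal_type)

section \<open>The conductor of a subalgebra with small core\<close>

lemma lincomb_power_smul:
  "vf_lincomb (coeff p) (\<lambda>i. smul (\<lambda>q. f q ^ (k + i) * t q) a) (degree p) =
    smul (\<lambda>q. poly (monom 1 k * p) (f q) * t q) a"
  by (rule vf_eqI)
    (simp add: vf_lincomb_apply smul_apply poly_monom poly_altdef[of p] power_add sum_distrib_left sum_distrib_right mult_ac)

text \<open>The hypothesis is applied to the sequences f^(k+i) t a, whose combinations are
  polynomials in f times t a. Starting at k = degree p + 1 yields the second, larger degree that a
  nonzero Wronskian requires.\<close>

lemma core_polys:
  assumes S: "small_core sections S" and a: "a \<in> sections" and f: "smooth f" and t: "smooth t"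
  obtains p q :: "real poly" where "p \<noteq> 0" "degree q > degree p"
    "smul (\<lambda>x. poly p (f x) * t x) a \<in> lie_core sections S"
    "smul (\<lambda>x. poly q (f x) * t x) a \<in> lie_core sections S"
proof -
  have ex: "\<exists>p. p \<noteq> 0 \<and> degree p \<ge> k \<and> smul (\<lambda>x. poly p (f x) * t x) a \<in> lie_core sections S" for k
  proof -
    let ?X = "\<lambda>i. smul (\<lambda>q. f q ^ (k + i) * t q) a"
    have X: "\<forall>i. ?X i \<in> sections"
      by (intro allI smul_closed a smooth_mult smooth_power f t)
    from S[unfolded small_core_def, THEN spec[of _ ?X], THEN mp, OF X]
    obtain p where p: "p \<noteq> 0" "vf_lincomb (coeff p) ?X (degree p) \<in> lie_core sections S"
      by (elim exE conjE) (rule that)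
    have "degree (monom 1 k * p) = k + degree p"
      using p(1) by (simp add: degree_mult_eq degree_monom_eq)
    then show ?thesis
      using p unfolding lincomb_power_smul by (intro exI[of _ "monom 1 k * p"]) auto
  qed
  obtain p where p: "p \<noteq> 0" "smul (\<lambda>x. poly p (f x) * t x) a \<in> lie_core sections S"
    using ex[of 0] by blast
  obtain q where q: "q \<noteq> 0" "degree q \<ge> Suc (degree p)" "smul (\<lambda>x. poly q (f x) * t x) a \<in> lie_core sections S"
    using ex[of "Suc (degree p)"] by blast
  show thesis by (rule that[OF p(1) _ p(2) q(3)]) (use q(2) in simp)
qed

lemma subalgebraD:
  assumes "lie_subalgebra sections S"
  shows "X \<in> S \<Longrightarrow> X \<in> sections" "X \<in> S \<Longrightarrow> Y \<in> S \<Longrightarrow> vf_add X Y \<in> S" "X \<in> S \<Longrightarrow> vf_scale c X \<in> S"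
    "X \<in> S \<Longrightarrow> Y \<in> S \<Longrightarrow> vf_bracket X Y \<in> S"
  using assms by (auto simp: lie_subalgebra_def)

lemma coreD: "X \<in> lie_core sections S \<Longrightarrow> Y \<in> sections \<Longrightarrow> vf_bracket X Y \<in> S"
  by (simp add: lie_core_def)

text \<open>The ideal J of the overview; the name is that of the analogous ideal for a
  subring.\<close>

definition conductor :: "'p vector_field set \<Rightarrow> ('m \<Rightarrow> real) set" where
  "conductor S = {f. smooth f \<and> (\<forall>b\<in>sections. smul f b \<in> S)}"

lemma conductor_mult: "j \<in> conductor S \<Longrightarrow> smooth g \<Longrightarrow> (\<lambda>q. j q * g q) \<in> conductor S"
proof -
  assume j: "j \<in> conductor S" and g: "smooth g"
  have "smul (\<lambda>q. j q * g q) b = smul j (smul g b)" for b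
    by (rule vf_eqI) (simp add: smul_apply)
  then show ?thesis using j g by (auto simp: conductor_def smooth_mult smul_closed)
qed

lemma conductor_add:
  assumes "lie_subalgebra sections S" "i \<in> conductor S" "j \<in> conductor S"
  shows "(\<lambda>q. i q + j q) \<in> conductor S"
proof -
  have "smul (\<lambda>q. i q + j q) b = vf_add (smul i b) (smul j b)" for b
    by (rule vf_eqI) (simp add: smul_apply vf_add_apply distrib_right)
  then show ?thesis using assms subalgebraD(2)[OF assms(1)] by (auto simp: conductor_def smooth_add)
qed

lemma conductor_diff:
  assumes "lie_subalgebra sections S" "i \<in> conductor S" "j \<in> conductor S"
  shows "(\<lambda>q. i q - j q) \<in> conductor S"
  using conductor_add[OF assms(1,2) conductor_mult[OF assms(3) smooth_const[of "- 1"]]] by simp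

text \<open>By the Leibniz rule rho(s)(j) b = [s, j b] - j [s, b], and both terms lie in
  \<open>S\<close>.\<close>

lemma conductor_anchor:
  assumes S: "lie_subalgebra sections S" and s: "s \<in> S" and j: "j \<in> conductor S"
  shows "(\<lambda>q. anc s q j) \<in> conductor S"
proof -
  note sub = subalgebraD[OF S]
  have sL: "s \<in> sections" using sub(1)[OF s] .
  have js: "smooth j" and jS: "\<And>b. b \<in> sections \<Longrightarrow> smul j b \<in> S" using j by (auto simp: conductor_def)
  have "smul (\<lambda>q. anc s q j) b \<in> S" if b: "b \<in> sections" for b
  proof -
    have "smul (\<lambda>q. anc s q j) b = vf_add (vf_bracket s (smul j b)) (vf_scale (- 1) (smul j (vf_bracket s b)))"
      by (rule vf_eqI) (simp add: smul_apply vf_add_apply vf_scale_apply bracket_smul[OF sL b js])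
    then show ?thesis using sub(2)[OF sub(4)[OF s jS[OF b]] sub(3)[OF jS[OF bracket_closed[OF sL b]]]] by simp
  qed
  then show ?thesis by (simp add: conductor_def anchor_smooth[OF sL js])
qed

lemma anchor_poly: "a \<in> sections \<Longrightarrow> smooth f \<Longrightarrow> anc a m (\<lambda>q. poly p (f q)) = poly (pderiv p) (f m) * anc a m f"
  using base.tangent_poly[OF anchor_tangent] .

text \<open>With \<open>h\<close> and \<open>h'\<close> two functions of \<open>f\<close> that multiply \<open>a\<close> into the core, the combination
  \<open>[h a, h' k a] - [h' a, h k a]\<close> is \<open>C\<^sup>\<infinity>\<close>-linear in \<open>k\<close>.\<close>

lemma wronskian_line:
  assumes S: "lie_subalgebra sections S" and sc: "small_core sections S" and a: "a \<in> sections" and f: "smooth f"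
  shows "\<exists>w. w \<noteq> 0 \<and> (\<forall>k. smooth k \<longrightarrow> smul (\<lambda>x. k x * (poly w (f x) * anc a x f)) a \<in> S)"
proof -
  obtain p q :: "real poly" where pq: "p \<noteq> 0" "degree q > degree p"
    and pN: "smul (\<lambda>x. poly p (f x) * 1) a \<in> lie_core sections S"
    and qN: "smul (\<lambda>x. poly q (f x) * 1) a \<in> lie_core sections S"
    by (rule core_polys[OF sc a f smooth_const])
  define P where "P = (\<lambda>x. poly p (f x))"
  define Q where "Q = (\<lambda>x. poly q (f x))"
  have P: "smooth P" and Q: "smooth Q" unfolding P_def Q_def by (intro base.smooth_real_poly f)+
  have aP: "anc a x P = poly (pderiv p) (f x) * anc a x f" and aQ: "anc a x Q = poly (pderiv q) (f x) * anc a x f" for x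
    unfolding P_def Q_def by (rule anchor_poly[OF a f])+
  have "smul (\<lambda>x. k x * (poly (p * pderiv q - q * pderiv p) (f x) * anc a x f)) a \<in> S" if k: "smooth k" for k
  proof -
    let ?X = "vf_bracket (smul P a) (smul (\<lambda>x. Q x * k x) a)" and ?Y = "vf_bracket (smul Q a) (smul (\<lambda>x. P x * k x) a)"
    have X: "?X \<in> S" and Y: "?Y \<in> S"
      using pN qN coreD smul_closed[OF a] smooth_mult P Q k by (simp_all add: P_def Q_def)
    \<comment> \<open>In the difference the terms with the derivative of \<open>k\<close> cancel and
      the Wronskian terms add up, whence the factor 1/2.\<close>
    have "vf_scale (1 / 2) (vf_add ?X (vf_scale (- 1) ?Y)) \<in> S"
      by (rule subalgebraD(3)[OF S subalgebraD(2)[OF S X subalgebraD(3)[OF S Y]]])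
    moreover have "smul (\<lambda>x. k x * (poly (p * pderiv q - q * pderiv p) (f x) * anc a x f)) a =
        vf_scale (1 / 2) (vf_add ?X (vf_scale (- 1) ?Y))"
      by (rule vf_eqI) (simp add: smul_apply vf_add_apply vf_scale_apply bracket_smul_smul[OF a P smooth_mult[OF Q k]]
          bracket_smul_smul[OF a Q smooth_mult[OF P k]] anchor_mult[OF a P k] anchor_mult[OF a Q k] aP aQ,
          simp add: P_def Q_def field_simps)
    ultimately show ?thesis by simp
  qed
  with wronskian_nonzero[OF pq] show ?thesis by blast
qed

text \<open>The brackets \<open>[a, Q b]\<close> and \<open>[a, P b]\<close> are combined with
  weights P t^2 and Q t^2, so that \<open>[a, b]\<close> cancels and the Wronskian is left as a
  coefficient of \<open>b\<close>. The weights are also what brings the two terms into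
  \<open>S\<close>.\<close>

lemma conductor_poly:
  assumes S: "lie_subalgebra sections S" and sc: "small_core sections S" and a: "a \<in> sections" and f: "smooth f"
  shows "\<exists>w. w \<noteq> 0 \<and> (\<lambda>x. poly w (f x) * (anc a x f * anc a x f * anc a x f)) \<in> conductor S"
proof -
  note sub = subalgebraD[OF S]
  define D where "D x = anc a x f" for x
  have D: "smooth D" unfolding D_def[abs_def] by (rule anchor_smooth[OF a f])
  obtain w where w: "w \<noteq> 0" "\<And>k. smooth k \<Longrightarrow> smul (\<lambda>x. k x * (poly w (f x) * D x)) a \<in> S"
    using wronskian_line[OF S sc a f] unfolding D_def by blast
  define t where "t = (\<lambda>x. poly w (f x) * D x)"
  have t: "smooth t" unfolding t_def by (intro smooth_mult base.smooth_real_poly f D)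
  have tS: "smul (\<lambda>x. k x * t x) a \<in> S" if "smooth k" for k using w(2)[OF that] by (simp add: t_def)
  obtain p q :: "real poly" where pq: "p \<noteq> 0" "degree q > degree p"
    and pN: "smul (\<lambda>x. poly p (f x) * (t x * t x)) a \<in> lie_core sections S"
    and qN: "smul (\<lambda>x. poly q (f x) * (t x * t x)) a \<in> lie_core sections S"
    by (rule core_polys[OF sc a f smooth_mult[OF t t]])
  \<comment> \<open>The bracket [r(f) t^2 a, g b] lies in \<open>S\<close> by the core property.
    Pulling the weight out of it costs a multiple of \<open>a\<close> whose coefficient is the
    derivative of r(f) t^2 along g b; this is divisible by \<open>t\<close>, so \<open>tS\<close>
    applies.\<close>
  have Z: "smul (\<lambda>x. poly r (f x) * (t x * t x)) (vf_bracket a (smul g b)) \<in> S"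
    if rN: "smul (\<lambda>x. poly r (f x) * (t x * t x)) a \<in> lie_core sections S" and g: "smooth g" and b: "b \<in> sections"
    for r g b
  proof -
    define R where "R = (\<lambda>x. poly r (f x))"
    have R: "smooth R" unfolding R_def by (intro base.smooth_real_poly f)
    define h where "h = (\<lambda>x. R x * (t x * t x))"
    have h: "smooth h" unfolding h_def by (intro smooth_mult R t)
    \<comment> \<open>The cofactor of \<open>t\<close> in the derivative of \<open>h\<close> along
      \<open>smul g b\<close>.\<close>
    define e where "e = (\<lambda>x. g x * (anc b x R * t x + 2 * (R x * anc b x t)))"
    have e: "smooth e" unfolding e_def
      by (intro smooth_mult smooth_add smooth_const anchor_smooth[OF b] R t g)
    have gb: "smul g b \<in> sections" by (rule smul_closed[OF b g])
    have ah: "anc (smul g b) x h = e x * t x" for x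
      by (simp add: anchor_smul[OF b g] h_def anchor_mult[OF b R smooth_mult[OF t t]] anchor_mult[OF b t t] e_def algebra_simps)
    have "smul h (vf_bracket a (smul g b)) = vf_add (vf_bracket (smul h a) (smul g b)) (smul (\<lambda>x. e x * t x) a)"
      by (rule vf_eqI) (simp add: smul_apply vf_add_apply bracket_smul_left[OF a gb h] ah)
    moreover have "vf_bracket (smul h a) (smul g b) \<in> S"
      using coreD[OF rN gb] by (simp add: h_def R_def)
    ultimately show ?thesis using sub(2)[OF _ tS[OF e]] by (simp add: h_def R_def)
  qed
  define P where "P = (\<lambda>x. poly p (f x))"
  define Q where "Q = (\<lambda>x. poly q (f x))"
  have P: "smooth P" and Q: "smooth Q" unfolding P_def Q_def by (intro base.smooth_real_poly f)+
  have aP: "anc a x P = poly (pderiv p) (f x) * D x" and aQ: "anc a x Q = poly (pderiv q) (f x) * D x" for x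
    unfolding P_def Q_def D_def by (rule anchor_poly[OF a f])+
  let ?w = "w * w * (p * pderiv q - q * pderiv p)"
  have "smul (\<lambda>x. poly ?w (f x) * (D x * D x * D x)) b \<in> S" if b: "b \<in> sections" for b
  proof -
    let ?X = "smul (\<lambda>x. P x * (t x * t x)) (vf_bracket a (smul Q b))"
      and ?Y = "smul (\<lambda>x. Q x * (t x * t x)) (vf_bracket a (smul P b))"
    have "smul (\<lambda>x. poly ?w (f x) * (D x * D x * D x)) b = vf_add ?X (vf_scale (- 1) ?Y)"
      by (rule vf_eqI) (simp add: smul_apply vf_add_apply vf_scale_apply bracket_smul[OF a b P] bracket_smul[OF a b Q]
          aP aQ, simp add: P_def Q_def t_def algebra_simps)
    moreover have "?X \<in> S" using Z[OF pN Q b] by (simp add: P_def)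
    moreover have "?Y \<in> S" using Z[OF qN P b] by (simp add: Q_def)
    ultimately show ?thesis using sub(2,3) by simp
  qed
  moreover have "smooth (\<lambda>x. poly ?w (f x) * (D x * D x * D x))"
    by (intro smooth_mult base.smooth_real_poly f D)
  ultimately have "(\<lambda>x. poly ?w (f x) * (D x * D x * D x)) \<in> conductor S" by (simp add: conductor_def)
  moreover have "?w \<noteq> 0" using w(1) wronskian_nonzero[OF pq] by simp
  ultimately show ?thesis unfolding D_def by blast
qed

text \<open>Differentiate w(f) h along \<open>s\<close>, multiply by h and subtract w(f) h s(h):
  what remains is w'(f) times D h h, of the same shape with a new second factor that is again
  nonzero at \<open>m\<close>. The degree of \<open>w\<close> drops until \<open>f m\<close> is not
  a root.\<close>

lemma conductor_descent:
  assumes S: "lie_subalgebra sections S" and s: "s \<in> S" and f: "smooth f" and nz: "anc s m f \<noteq> 0"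
    and "w \<noteq> 0" "smooth h" "h m \<noteq> 0" "(\<lambda>x. poly w (f x) * h x) \<in> conductor S"
  shows "\<exists>j\<in>conductor S. j m \<noteq> 0"
  using assms(5-)
proof (induction "degree w" arbitrary: w h rule: less_induct)
  case less
  have sL: "s \<in> sections" using subalgebraD(1)[OF S s] .
  show ?case
  proof (cases "poly w (f m) = 0")
    case False
    then show ?thesis using less.prems by (intro bexI[OF _ less.prems(4)]) simp
  next
    case True
    have deg: "degree w \<noteq> 0"
    proof
      assume "degree w = 0"
      then obtain c where "w = [:c:]" by (rule degree_eq_zeroE)
      then show False using True less.prems(1) by simp
    qed
    define D where "D x = anc s x f" for x
    have D: "smooth D" unfolding D_def[abs_def] by (rule anchor_smooth[OF sL f])
    define W where "W = (\<lambda>x. poly w (f x))"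
    have W: "smooth W" unfolding W_def by (rule base.smooth_real_poly[OF f])
    have sW: "anc s x W = poly (pderiv w) (f x) * D x" for x
      unfolding W_def D_def by (rule anchor_poly[OF sL f])
    have h: "smooth h" using less.prems by blast
    have J: "(\<lambda>x. W x * h x) \<in> conductor S" using less.prems(4) by (simp add: W_def)
    have "(\<lambda>x. anc s x (\<lambda>x. W x * h x) * h x - W x * h x * anc s x h) \<in> conductor S"
      by (intro conductor_diff[OF S] conductor_mult conductor_anchor[OF S s] J h anchor_smooth[OF sL h])
    moreover have "anc s x (\<lambda>x. W x * h x) * h x - W x * h x * anc s x h = poly (pderiv w) (f x) * (D x * h x * h x)" for x
      by (simp add: anchor_mult[OF sL W h] sW algebra_simps)
    ultimately have "(\<lambda>x. poly (pderiv w) (f x) * (D x * h x * h x)) \<in> conductor S" by simp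
    moreover have "degree (pderiv w) < degree w" "pderiv w \<noteq> 0"
      using deg by (simp_all add: degree_pderiv pderiv_eq_0_iff)
    moreover have "D m * h m * h m \<noteq> 0" using nz less.prems(3) by (simp add: D_def)
    ultimately show ?thesis
      using less.hyps[of "pderiv w" "\<lambda>x. D x * h x * h x"] smooth_mult D h by simp
  qed
qed

lemma conductor_nonvanishing:
  assumes S: "lie_subalgebra sections S" and sc: "small_core sections S" and "\<not> S \<subseteq> isotropy m"
  shows "\<exists>j\<in>conductor S. j m \<noteq> 0"
proof -
  obtain s where s: "s \<in> S" "s \<notin> isotropy m" using assms(3) by blast
  have sL: "s \<in> sections" using subalgebraD(1)[OF S s(1)] .
  obtain f where f: "smooth f" "anc s m f \<noteq> 0" using s(2) sL by (auto simp: isotropy_iff)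
  obtain w where w: "w \<noteq> 0" "(\<lambda>x. poly w (f x) * (anc s x f * anc s x f * anc s x f)) \<in> conductor S"
    using conductor_poly[OF S sc sL f(1)] by blast
  have "smooth (\<lambda>x. anc s x f * anc s x f * anc s x f)" by (intro smooth_mult anchor_smooth[OF sL f(1)])
  then show ?thesis using conductor_descent[OF S s(1) f w(1) _ _ w(2)] f(2) by simp
qed

text \<open>Cover \<open>K\<close> by finitely many sets on each of which a member of the conductor
  is nonzero. The sum \<open>E\<close> of their squares is positive on \<open>K\<close>, and k = E
  (k / E) lies in the ideal.\<close>

lemma conductor_compact_support:
  assumes S: "lie_subalgebra sections S" and nv: "\<And>m. \<exists>j\<in>conductor S. j m \<noteq> 0"
    and k: "smooth k" "compact K" "\<And>q. q \<notin> K \<Longrightarrow> k q = 0"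
  shows "k \<in> conductor S"
proof -
  obtain J where J: "\<And>m. J m \<in> conductor S" "\<And>m. J m m \<noteq> 0" using nv by metis
  have Js: "smooth (J m)" for m using J(1) by (simp add: conductor_def)
  define V where "V m = {q. J m q \<noteq> 0}" for m
  have V: "open (V m)" for m
    unfolding V_def using base.smooth_real_continuous[OF Js] by (intro open_Collect_neq continuous_on_const)
  have "K \<subseteq> (\<Union>m\<in>K. V m)" using J(2) by (auto simp: V_def)
  with k(2) V obtain C where C: "C \<subseteq> K" "finite C" "K \<subseteq> (\<Union>m\<in>C. V m)"
    using compactE_image[of K K V] by metis
  define E where "E = (\<lambda>q. \<Sum>m\<in>C. J m q * J m q)"
  have "\<And>A. finite A \<Longrightarrow> A \<noteq> {} \<Longrightarrow> (\<lambda>q. \<Sum>m\<in>A. J m q * J m q) \<in> conductor S"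
  proof -
    fix A :: "'m set" assume "finite A" "A \<noteq> {}"
    then show "(\<lambda>q. \<Sum>m\<in>A. J m q * J m q) \<in> conductor S"
    proof (induction A rule: finite_ne_induct)
      case (singleton m)
      then show ?case using conductor_mult[OF J(1) Js] by simp
    next
      case (insert m A)
      then show ?case using conductor_add[OF S conductor_mult[OF J(1) Js, of m m] insert.IH] by simp
    qed
  qed
  moreover have "C \<noteq> {}" if "K \<noteq> {}" using C(3) that by auto
  \<comment> \<open>This serves an empty \<open>K\<close>, for which \<open>E\<close> is an empty
    sum.\<close>
  moreover have "(\<lambda>q. 0) \<in> conductor S" using conductor_mult[OF J(1) smooth_const[of 0]] by simp
  ultimately have E: "E \<in> conductor S" using C(2) by (cases "C = {}") (auto simp: E_def)
  have Es: "smooth E" using E by (simp add: conductor_def)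
  have Epos: "E q \<noteq> 0" if qK: "q \<in> K" for q
  proof -
    obtain m where m: "m \<in> C" "J m q \<noteq> 0" using C(3) qK by (auto simp: V_def)
    then have "0 < J m q * J m q" by (metis not_real_square_gt_zero)
    also have "\<dots> \<le> E q" unfolding E_def by (rule member_le_sum[OF m(1) _ C(2)]) simp
    finally show ?thesis by simp
  qed
  have U: "open {q. E q \<noteq> 0}"
    using base.smooth_real_continuous[OF Es] by (intro open_Collect_neq continuous_on_const)
  have "smooth (\<lambda>q. k q * inverse (E q))"
    by (rule base.smooth_real_extend[OF k(1) base.smooth_real_inverse[OF U smooth_map_on_subset[OF Es]] U
          compact_imp_closed[OF k(2)]]) (use Epos k(3) in auto)
  from conductor_mult[OF E this] have "(\<lambda>q. E q * (k q * inverse (E q))) \<in> conductor S" .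
  moreover have "E q * (k q * inverse (E q)) = k q" for q
    using Epos[of q] k(3)[of q] by (cases "q \<in> K") auto
  ultimately show ?thesis by simp
qed

section \<open>Excluding points at infinity\<close>

definition vanishes_near :: "'p vector_field \<Rightarrow> 'm \<Rightarrow> bool" where
  "vanishes_near a x \<longleftrightarrow> (\<exists>T. open T \<and> x \<in> T \<and> (\<forall>u F. \<pi> u \<in> T \<longrightarrow> a u F = 0))"

lemma vanishes_near_add:
  assumes "vanishes_near X x" "vanishes_near Y x"
  shows "vanishes_near (vf_add X Y) x"
proof -
  obtain T where T: "open T" "x \<in> T" "\<forall>u F. \<pi> u \<in> T \<longrightarrow> X u F = 0"
    using assms(1) unfolding vanishes_near_def by blast
  obtain T' where T': "open T'" "x \<in> T'" "\<forall>u F. \<pi> u \<in> T' \<longrightarrow> Y u F = 0"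
    using assms(2) unfolding vanishes_near_def by blast
  show ?thesis unfolding vanishes_near_def
    using T T' by (intro exI[of _ "T \<inter> T'"]) (auto simp: vf_add_apply)
qed

lemma vanishes_near_scale: "vanishes_near X x \<Longrightarrow> vanishes_near (vf_scale c X) x"
  by (auto simp: vanishes_near_def vf_scale_apply)

lemma vanishes_near_bracket:
  assumes X: "X \<in> sections" and Y: "Y \<in> sections" and "vanishes_near Y x"
  shows "vanishes_near (vf_bracket X Y) x"
proof -
  obtain T where T: "open T" "x \<in> T" "\<forall>u F. \<pi> u \<in> T \<longrightarrow> Y u F = 0"
    using assms(3) unfolding vanishes_near_def by blast
  have op: "open (\<pi> -` T)" by (rule open_vimage_proj[OF T(1)])
  have "vf_bracket X Y u F = 0" if u: "\<pi> u \<in> T" for u F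
  proof (cases "smooth_total F")
    case True
    have "X u (\<lambda>w. Y w F) = X u (\<lambda>w. 0)"
      by (rule total.tangent_local[OF sections_tangent[OF X] sections_smooth[OF Y True]
            total.smooth_real_const[OF open_UNIV] op]) (use T(3) u in auto)
    then show ?thesis using T(3) u by (simp add: vf_bracket_def total.tangent_const[OF sections_tangent[OF X]])
  next
    case False
    then show ?thesis by (rule total.vf_nonsmooth[OF sections_vf[OF bracket_closed[OF X Y]]])
  qed
  with T show ?thesis unfolding vanishes_near_def by blast
qed

text \<open>Ideals of this kind are tested against \<open>countable_ideal_type\<close>; they exist
  because the bracket is local.\<close>

lemma vanishing_ideal: "lie_ideal sections {a \<in> sections. \<forall>x\<in>Q. vanishes_near a x}"
  unfolding lie_ideal_def
  by (auto simp: vanishes_near_add vanishes_near_scale vanishes_near_bracket add_closed scale_closed bracket_closed)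

text \<open>If \<open>a\<close> vanished wherever \<open>h > R\<close>, multiplying it by
  \<open>cutoff (h - R)\<close> would not change it. That factor has compact support because
  \<open>h\<close> is proper, so \<open>a\<close> would lie in \<open>S\<close>.\<close>

lemma unbounded_support:
  assumes h: "smooth h" "\<And>c. \<exists>K. compact K \<and> (\<forall>p. p \<notin> K \<longrightarrow> h p > c)"
    and S: "\<And>k K b. smooth k \<Longrightarrow> compact K \<Longrightarrow> \<forall>q. q \<notin> K \<longrightarrow> k q = 0 \<Longrightarrow> b \<in> sections \<Longrightarrow> smul k b \<in> S"
    and a: "a \<in> sections" "a \<notin> S"
  shows "\<exists>x. h x > R \<and> \<not> vanishes_near a x"
proof (rule ccontr)
  assume "\<not> ?thesis"
  then have van: "a u F = 0" if "h (\<pi> u) > R" for u F using that by (auto simp: vanishes_near_def)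
  let ?k = "\<lambda>q. cutoff (h q - R)"
  have k: "smooth ?k"
    by (rule base.smooth_real_compose[OF open_UNIV smooth_diff[OF h(1) smooth_const] smooth_on_cutoff])
  obtain K where K: "compact K" "\<forall>p. p \<notin> K \<longrightarrow> h p > R + 2" using h(2) by blast
  have "\<forall>q. q \<notin> K \<longrightarrow> ?k q = 0" using K(2) by (auto intro!: cutoff_eq_0)
  then have "smul ?k a \<in> S" by (rule S[OF k K(1) _ a(1)])
  moreover have "smul ?k a = a"
  proof (rule vf_eqI)
    show "smul ?k a u F = a u F" for u F
      using van[of u F] by (cases "h (\<pi> u) > R") (simp_all add: smul_apply cutoff_eq_1)
  qed
  ultimately show False using a(2) by simp
qed

text \<open>A subalgebra containing all compactly supported sections violates the countability condition:
  along a sequence going to infinity, choose for each \<open>i\<close> two points in the support of \<open>A i\<close>, and cut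
  a section outside \<open>S\<close> in two pieces that vanish near one or the other sort of points.\<close>

lemma not_countable_ideal_type:
  assumes sub: "lie_subalgebra sections S" and ct: "countable_ideal_type sections S"
    and S: "\<And>k K b. smooth k \<Longrightarrow> compact K \<Longrightarrow> \<forall>q. q \<notin> K \<longrightarrow> k q = 0 \<Longrightarrow> b \<in> sections \<Longrightarrow> smul k b \<in> S"
  shows False
proof -
  from ct[unfolded countable_ideal_type_def] obtain A where A: "\<forall>i::nat. A i \<in> sections - S"
    and AI: "\<forall>I. lie_ideal sections I \<longrightarrow> \<not> I \<subseteq> S \<longrightarrow> (\<exists>i. A i \<in> I)"
    by (elim exE conjE) (rule that)
  have AL: "A i \<in> sections" and AS: "A i \<notin> S" for i using A by auto
  obtain h where h: "smooth h" "\<And>c. \<exists>K. compact K \<and> (\<forall>p. p \<notin> K \<longrightarrow> h p > c)"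
    by (rule base.proper_function) (rule that, assumption, simp)
  have unb: "\<exists>x. h x > R \<and> \<not> vanishes_near (A i) x" for R i
    by (rule unbounded_support[OF h S AL AS])
  \<comment> \<open>Each \<open>A i\<close> receives the two points with indices 2i and 2i + 1, both
    in its support. The heights grow by more than 2, so that bumps of radius 1 in \<open>h\<close>
    do not overlap.\<close>
  obtain x where x: "\<And>j. \<not> vanishes_near (A (j div 2)) (x j)" "\<And>j. h (x (Suc j)) > h (x j) + 2"
  proof -
    have "\<exists>x. \<forall>j. \<not> vanishes_near (A (j div 2)) (x j) \<and> h (x (Suc j)) > h (x j) + 2"
    proof (rule dependent_nat_choice)
      show "\<exists>x. \<not> vanishes_near (A (0 div 2)) x" using unb by blast
      show "\<exists>y. \<not> vanishes_near (A (Suc j div 2)) y \<and> h y > h x + 2" for x j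
        using unb[of "h x + 2" "Suc j div 2"] by blast
    qed
    then obtain x where "\<forall>j. \<not> vanishes_near (A (j div 2)) (x j) \<and> h (x (Suc j)) > h (x j) + 2" ..
    then show thesis by (intro that[of x]) simp_all
  qed
  define t where "t j = h (x j)" for j
  have mono: "t (j + d) \<ge> t j + 2 * real d" for j d
  proof (induction d)
    case (Suc d)
    then show ?case using x(2)[of "j + d"] by (simp add: t_def)
  qed simp
  have gap: "\<bar>t i - t j\<bar> \<ge> 2" if "i \<noteq> j" for i j
  proof -
    have "t j \<ge> t i + 2" if "i < j" for i j
      using mono[of i "j - i"] that by (simp add: of_nat_diff)
    then show ?thesis using that by (cases i j rule: linorder_cases) fastforce+
  qed
  \<comment> \<open>The argument 2 s^2 is at most 1/2 for |s| < 1/2 and at least 2 for |s| >= 1,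
    which fits the thresholds 1 and 2 of \<open>cutoff\<close>; unlike |s| it is smooth.\<close>
  define \<beta> where "\<beta> s = cutoff (2 * (s * s))" for s :: real
  have \<beta>0: "\<beta> s = 0" if "\<bar>s\<bar> \<ge> 1" for s
  proof -
    have "1 * 1 \<le> \<bar>s\<bar> * \<bar>s\<bar>" using that by (intro mult_mono) auto
    then show ?thesis by (simp add: \<beta>_def cutoff_eq_0)
  qed
  have \<beta>1: "\<beta> s = 1" if "\<bar>s\<bar> < 1 / 2" for s
  proof -
    have "\<bar>s\<bar> * \<bar>s\<bar> \<le> 1 / 2 * (1 / 2)" using that by (intro mult_mono) auto
    then show ?thesis by (simp add: \<beta>_def cutoff_eq_1)
  qed
  have \<beta>s: "smooth (\<lambda>q. \<beta> (h q - c))" for c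
    unfolding \<beta>_def
    by (intro base.smooth_real_compose[OF open_UNIV _ smooth_on_cutoff] smooth_mult smooth_const smooth_diff h(1))
  define e where "e j = (if even j then 1 else 0 :: real)" for j :: nat
  \<comment> \<open>It is 1 near the points of even index and 0 near those of odd index, so
    \<open>v\<close> and \<open>1 - v\<close> each vanish near one of the two points of every
    \<open>A i\<close>.\<close>
  define v where "v q = (\<Sum>j. e j * \<beta> (h q - t j))" for q
  have hc: "continuous_on UNIV h" using base.smooth_real_continuous[OF h(1)] .
  have v: "smooth v"
    unfolding v_def[abs_def]
  proof (rule base.smooth_suminf)
    show "smooth (\<lambda>q. e j * \<beta> (h q - t j))" for j by (intro smooth_mult smooth_const \<beta>s)
    fix p
    obtain n where n: "h p + 2 - t 0 < real n" using reals_Archimedean2 by blast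
    have "e j * \<beta> (h q - t j) = 0" if "j \<ge> n" "h q < h p + 1" for j q
    proof -
      have "real j \<ge> real n" using that(1) by simp
      then have "t j - h q \<ge> 1" using mono[of 0 j] n that(2) by simp
      then show ?thesis using \<beta>0[of "h q - t j"] by simp
    qed
    moreover have "open {q. h q < h p + 1}" by (rule open_Collect_less[OF hc continuous_on_const])
    ultimately show "\<exists>T n. open T \<and> p \<in> T \<and> (\<forall>k\<ge>n. \<forall>q\<in>T. e k * \<beta> (h q - t k) = 0)"
      by (intro exI[of _ "{q. h q < h p + 1}"] exI[of _ n]) simp
  qed
  have near: "v q = e j" if "\<bar>h q - t j\<bar> < 1 / 2" for q j
  proof -
    have "e i * \<beta> (h q - t i) = 0" if "i \<noteq> j" for i
    proof -
      have "\<bar>h q - t i\<bar> \<ge> 1" using gap[OF that] \<open>\<bar>h q - t j\<bar> < 1 / 2\<close> by linarith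
      then show ?thesis using \<beta>0 by simp
    qed
    then have "v q = (\<Sum>i\<in>{j}. e i * \<beta> (h q - t i))"
      unfolding v_def by (intro suminf_finite) auto
    then show ?thesis using \<beta>1[OF that] by simp
  qed
  have van: "vanishes_near (smul k c) (x j)" if k: "\<And>q. \<bar>h q - t j\<bar> < 1 / 2 \<Longrightarrow> k q = 0" for k c j
  proof -
    have "open {q. \<bar>h q - t j\<bar> < 1 / 2}"
      by (intro open_Collect_less continuous_on_const continuous_on_rabs continuous_on_diff hc)
    then show ?thesis
      unfolding vanishes_near_def
      by (intro exI[of _ "{q. \<bar>h q - t j\<bar> < 1 / 2}"]) (simp add: t_def[symmetric] smul_apply k)
  qed
  \<comment> \<open>Otherwise the sections vanishing near all \<open>x j\<close> with
    \<open>r j\<close> form an ideal not contained in \<open>S\<close>. It would contain some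
    \<open>A i\<close>, which does not vanish near its own point among these.\<close>
  have no: "smul k (A 0) \<in> S" if k: "smooth k" and kz: "\<And>j q. r (j :: nat) \<Longrightarrow> \<bar>h q - t j\<bar> < 1 / 2 \<Longrightarrow> k q = 0"
    and r: "\<And>i. \<exists>j. r j \<and> j div 2 = i" for k r
  proof (rule ccontr)
    assume nS: "smul k (A 0) \<notin> S"
    let ?I = "{a \<in> sections. \<forall>y\<in>x ` Collect r. vanishes_near a y}"
    have "vanishes_near (smul k (A 0)) (x j)" if "r j" for j
      by (rule van) (rule kz[OF that])
    then have "smul k (A 0) \<in> ?I" using smul_closed[OF AL k] by auto
    then have "\<not> ?I \<subseteq> S" using nS by blast
    with AI[rule_format, OF vanishing_ideal] obtain i where i: "A i \<in> ?I" by blast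
    obtain j where j: "r j" "j div 2 = i" using r by blast
    then have "vanishes_near (A i) (x j)" using i by blast
    then show False using x(1)[of j] j(2) by simp
  qed
  have 1: "smul v (A 0) \<in> S"
  proof (rule no[OF v, where r = odd])
    show "\<exists>j. odd j \<and> j div 2 = i" for i :: nat by (intro exI[of _ "Suc (2 * i)"]) simp
  qed (simp add: near e_def)
  have 2: "smul (\<lambda>q. 1 - v q) (A 0) \<in> S"
  proof (rule no[OF smooth_diff[OF smooth_const v], where r = even])
    show "\<exists>j. even j \<and> j div 2 = i" for i :: nat by (intro exI[of _ "2 * i"]) simp
  qed (simp add: near e_def)
  have "vf_add (smul v (A 0)) (smul (\<lambda>q. 1 - v q) (A 0)) = A 0"
    by (rule vf_eqI) (simp add: vf_add_apply smul_apply algebra_simps)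
  then show False using subalgebraD(2)[OF sub 1 2] AS[of 0] by simp
qed

lemma point_like_isotropy:
  assumes "point_like sections S"
  shows "\<exists>m. S \<subseteq> isotropy m"
proof (rule ccontr)
  assume none: "\<not> ?thesis"
  have S: "lie_subalgebra sections S" and sc: "small_core sections S" and ct: "countable_ideal_type sections S"
    using assms by (simp_all add: point_like_def)
  have nv: "\<exists>j\<in>conductor S. j m \<noteq> 0" for m
    by (rule conductor_nonvanishing[OF S sc]) (use none in blast)
  show False
  proof (rule not_countable_ideal_type[OF S ct])
    fix k K b assume k: "smooth k" "compact K" "\<forall>q. q \<notin> K \<longrightarrow> k q = 0" and b: "b \<in> sections"
    have "k \<in> conductor S" by (rule conductor_compact_support[OF S nv k(1,2)]) (use k(3) in blast)
    then show "smul k b \<in> S" using b by (simp add: conductor_def)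
  qed
qed

text \<open>For distinct points, a bump at \<open>m'\<close> that is 0 at \<open>m\<close> yields a
  section in \<open>isotropy m\<close> with nonzero anchor at \<open>m'\<close>.\<close>

lemma isotropy_subset_eq:
  assumes "isotropy m \<subseteq> isotropy m'"
  shows "m = m'"
proof (rule ccontr)
  assume "m \<noteq> m'"
  then have UV: "open (- {m})" "m' \<in> - {m}" by auto
  from base.bump[OF UV] obtain k K T where k: "smooth k" "K \<subseteq> - {m}" "\<And>q. q \<notin> K \<Longrightarrow> k q = 0"
    "m' \<in> T" "\<And>q. q \<in> T \<Longrightarrow> k q = 1" by metis
  obtain a f where a: "a \<in> sections" "smooth f" "anc a m' f \<noteq> 0" using anchor_nonzero[of m'] by blast
  have "k m = 0" using k(2) by (intro k(3)) blast
  then have "smul k a \<in> isotropy m" by (simp add: isotropy_iff smul_closed[OF a(1) k(1)] anchor_smul[OF a(1) k(1)])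
  then have "smul k a \<in> isotropy m'" using assms by blast
  then have "k m' * anc a m' f = 0" using a(2) by (simp add: isotropy_iff anchor_smul[OF a(1) k(1)])
  then show False using k(5)[OF k(4)] a(3) by simp
qed

end

section \<open>Isomorphisms\<close>

text \<open>Bumps on the target show that preimages of open sets are open. Coordinates of the
  target, cut off to global functions, then show that the coordinate expressions are smooth.\<close>

lemma smooth_map_by_functions:
  assumes "smooth_manifold \<A>" "smooth_manifold \<B>"
    and pull: "\<And>g. smooth_fun \<B> g \<Longrightarrow> smooth_fun \<A> (\<lambda>p. g (\<phi> p))"
  shows "smooth_map \<A> \<B> \<phi>"
proof -
  interpret A: smooth_manifold \<A> by fact
  interpret B: smooth_manifold \<B> by fact
  have vimage: "open (\<phi> -` V)" if V: "open V" for V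
    unfolding open_subopen[of "\<phi> -` V"]
  proof
    fix p assume "p \<in> \<phi> -` V"
    then have "\<phi> p \<in> V" by simp
    from B.bump[OF V this] obtain g K T where g: "smooth_fun \<B> g" "K \<subseteq> V" "\<And>q. q \<notin> K \<Longrightarrow> g q = 0"
      "\<phi> p \<in> T" "\<And>q. q \<in> T \<Longrightarrow> g q = 1" by metis
    have "open {q. g (\<phi> q) \<noteq> 0}"
      using A.smooth_real_continuous[OF pull[OF g(1)]] by (intro open_Collect_neq continuous_on_const)
    then show "\<exists>T. open T \<and> p \<in> T \<and> T \<subseteq> \<phi> -` V"
      using g by (intro exI[of _ "{q. g (\<phi> q) \<noteq> 0}"]) (auto simp: subset_iff)
  qed
  have "smooth_on (\<psi> ` (U \<inter> UNIV \<inter> \<phi> -` V)) (\<eta> \<circ> \<phi> \<circ> inv_into U \<psi>)"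
    if U: "(U, \<psi>) \<in> \<A>" and V: "(V, \<eta>) \<in> \<B>" for U \<psi> V \<eta>
  proof (rule smooth_on_local)
    fix x assume "x \<in> \<psi> ` (U \<inter> UNIV \<inter> \<phi> -` V)"
    then obtain p where p: "x = \<psi> p" "p \<in> U" "\<phi> p \<in> V" by blast
    have chU: "is_chart (U, \<psi>)" and chV: "is_chart (V, \<eta>)" using A.charts B.charts U V by blast+
    have opV: "open V" by (rule is_chart_open[OF chV])
    from B.bump[OF opV p(3)] obtain k K T where k: "smooth_fun \<B> k" "compact K" "K \<subseteq> V" "\<And>q. q \<notin> K \<Longrightarrow> k q = 0"
      "open T" "\<phi> p \<in> T" "\<And>q. q \<in> T \<Longrightarrow> k q = 1" by metis
    define W where "W = \<psi> ` (U \<inter> \<phi> -` T)"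
    have W: "open W" unfolding W_def by (rule is_chart_open_image[OF chU vimage[OF k(5)]])
    have "smooth_on W (\<eta> \<circ> \<phi> \<circ> inv_into U \<psi>)"
    proof (rule smooth_on_euclideanI[OF W])
      fix b :: 'd
      have "smooth_fun \<B> (\<lambda>q. k q * (\<eta> q \<bullet> b))"
        by (rule B.smooth_cut_coordinate[OF V k(1) compact_imp_closed[OF k(2)] k(3,4)])
      from A.smooth_real_chart[OF pull[OF this] U]
      have "smooth_on W ((\<lambda>p. k (\<phi> p) * (\<eta> (\<phi> p) \<bullet> b)) \<circ> inv_into U \<psi>)"
        by (rule smooth_on_subset) (auto simp: W_def)
      then show "smooth_on W (\<lambda>x. (\<eta> \<circ> \<phi> \<circ> inv_into U \<psi>) x \<bullet> b)"
        by (rule smooth_on_cong[OF W]) (auto simp: W_def is_chart_inv[OF chU] k(7))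
    qed
    then show "\<exists>T. open T \<and> x \<in> T \<and> smooth_on T (\<eta> \<circ> \<phi> \<circ> inv_into U \<psi>)"
      using W p k(6) by (intro exI[of _ W]) (auto simp: W_def)
  qed
  then show ?thesis
    using vimage by (auto simp: smooth_map_on_def continuous_on_open_vimage)
qed

lemma lie_isoD:
  assumes "lie_iso L L' \<Phi>"
  shows "inj_on \<Phi> L" "\<Phi> ` L = L'"
    "X \<in> L \<Longrightarrow> Y \<in> L \<Longrightarrow> \<Phi> (vf_add X Y) = vf_add (\<Phi> X) (\<Phi> Y)"
    "X \<in> L \<Longrightarrow> \<Phi> (vf_scale c X) = vf_scale c (\<Phi> X)"
    "X \<in> L \<Longrightarrow> Y \<in> L \<Longrightarrow> \<Phi> (vf_bracket X Y) = vf_bracket (\<Phi> X) (\<Phi> Y)"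
  using assms by (auto simp: lie_iso_def bij_betw_def)

lemma lie_iso_inverse:
  assumes iso: "lie_iso L L' \<Phi>" and L: "lie_subalgebra L L"
  shows "lie_iso L' L (inv_into L \<Phi>)"
proof -
  note I = lie_isoD[OF iso]
  have cl: "X \<in> L \<Longrightarrow> Y \<in> L \<Longrightarrow> vf_add X Y \<in> L" "X \<in> L \<Longrightarrow> vf_scale c X \<in> L"
    "X \<in> L \<Longrightarrow> Y \<in> L \<Longrightarrow> vf_bracket X Y \<in> L" for X Y c
    using L by (simp_all add: lie_subalgebra_def)
  have inv: "inv_into L \<Phi> (\<Phi> X) = X" if "X \<in> L" for X using inv_into_f_f[OF I(1) that] .
  have "bij_betw \<Phi> L L'" using iso by (simp add: lie_iso_def)
  then have "bij_betw (inv_into L \<Phi>) L' L" by (rule bij_betw_inv_into)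
  then show ?thesis
    unfolding lie_iso_def I(2)[symmetric]
    using inv cl by (simp add: I(3-5)[symmetric])
qed

lemma lie_iso_restrict:
  assumes "lie_iso L L' \<Phi>" "S \<subseteq> L"
  shows "lie_iso S (\<Phi> ` S) \<Phi>"
  using assms unfolding lie_iso_def by (auto simp: bij_betw_def subset_iff intro: inj_on_subset)

text \<open>The three conditions speak only of sums, scalar multiples and brackets in
  \<open>L\<close>; test sequences and ideals of \<open>L'\<close> are pulled back along
  \<Phi>.\<close>

lemma point_like_image:
  assumes iso: "lie_iso L L' \<Phi>" and L: "lie_subalgebra L L" and S: "point_like L S"
  shows "point_like L' (\<Phi> ` S)"
proof -
  note I = lie_isoD[OF iso]
  have cl: "X \<in> L \<Longrightarrow> Y \<in> L \<Longrightarrow> vf_add X Y \<in> L" "X \<in> L \<Longrightarrow> vf_scale c X \<in> L"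
    "X \<in> L \<Longrightarrow> Y \<in> L \<Longrightarrow> vf_bracket X Y \<in> L" for X Y c
    using L by (simp_all add: lie_subalgebra_def)
  have sub: "lie_subalgebra L S" and sc: "small_core L S" and ct: "countable_ideal_type L S"
    using S by (simp_all add: point_like_def)
  have SL: "S \<subseteq> L" using sub by (simp add: lie_subalgebra_def)
  have mem: "\<Phi> X \<in> \<Phi> ` S \<longleftrightarrow> X \<in> S" if "X \<in> L" for X
    using inj_on_image_mem_iff[OF I(1) that SL] .
  have "lie_subalgebra L' (\<Phi> ` S)"
    using sub SL I(2) by (auto simp: lie_subalgebra_def subset_iff I(3-5)[symmetric])
  moreover have "small_core L' (\<Phi> ` S)"
    unfolding small_core_def
  proof (intro allI impI)
    fix X' :: "nat \<Rightarrow> 'b vector_field" assume X': "\<forall>i. X' i \<in> L'"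
    define X where "X i = inv_into L \<Phi> (X' i)" for i
    have X: "X i \<in> L" and \<Phi>X: "\<Phi> (X i) = X' i" for i
      using X' I(2) f_inv_into_f[of "X' i" \<Phi> L] inv_into_into[of "X' i" \<Phi> L] by (simp_all add: X_def)
    have lin: "vf_lincomb c X n \<in> L \<and> \<Phi> (vf_lincomb c X n) = vf_lincomb c X' n" for c n
      by (induction n) (simp_all add: X \<Phi>X cl I(3,4))
    from sc[unfolded small_core_def, THEN spec[of _ X], THEN mp] X
    obtain p where p: "p \<noteq> 0" "vf_lincomb (coeff p) X (degree p) \<in> lie_core L S" by blast
    have "vf_lincomb (coeff p) X' (degree p) \<in> lie_core L' (\<Phi> ` S)"
      using p(2) SL lin[of "coeff p" "degree p"]
      by (auto simp: lie_core_def I(2)[symmetric] I(5)[symmetric] subset_iff simp flip: conjunct2[OF lin])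
    with p(1) show "\<exists>p. p \<noteq> 0 \<and> vf_lincomb (coeff p) X' (degree p) \<in> lie_core L' (\<Phi> ` S)" by blast
  qed
  moreover have "countable_ideal_type L' (\<Phi> ` S)"
  proof -
    from ct[unfolded countable_ideal_type_def] obtain A where A: "\<forall>i::nat. A i \<in> L - S"
      and AI: "\<forall>I. lie_ideal L I \<longrightarrow> \<not> I \<subseteq> S \<longrightarrow> (\<exists>i. A i \<in> I)"
      by (elim exE conjE) (rule that)
    show ?thesis unfolding countable_ideal_type_def
    proof (intro exI[of _ "\<lambda>i. \<Phi> (A i)"] conjI allI impI)
      show "\<Phi> (A i) \<in> L' - \<Phi> ` S" for i
        using A mem[of "A i"] I(2) by auto
      fix J assume J: "lie_ideal L' J" "\<not> J \<subseteq> \<Phi> ` S"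
      let ?I = "{X \<in> L. \<Phi> X \<in> J}"
      have "lie_ideal L ?I"
        using J(1) cl I(2) by (auto simp: lie_ideal_def I(3-5))
      moreover have "\<not> ?I \<subseteq> S"
      proof
        assume "?I \<subseteq> S"
        moreover obtain Y where "Y \<in> J" "Y \<notin> \<Phi> ` S" using J(2) by blast
        moreover then obtain X where "X \<in> L" "Y = \<Phi> X" using J(1) I(2) by (auto simp: lie_ideal_def)
        ultimately show False by blast
      qed
      ultimately obtain i where "A i \<in> ?I" using AI by blast
      then show "\<exists>i. \<Phi> (A i) \<in> J" by blast
    qed
  qed
  ultimately show ?thesis by (simp add: point_like_def)
qed

lemma (in principal_bundle) sections_subalgebra: "lie_subalgebra sections sections"
  by (simp add: lie_subalgebra_def add_closed scale_closed bracket_closed)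

section \<open>The diffeomorphism induced by an isomorphism\<close>

locale algebroid_iso =
  B1: principal_bundle G1 \<G>1 \<P>1 \<M>1 \<pi>1 act1 + B2: principal_bundle G2 \<G>2 \<P>2 \<M>2 \<pi>2 act2
  for G1 :: "'g1::{t2_space, second_countable_topology} monoid"
    and \<G>1 :: "('g1, 'h1::euclidean_space) chart set"
    and \<P>1 :: "('p1::{t2_space, second_countable_topology}, 'd1::euclidean_space) chart set"
    and \<M>1 :: "('m1::{t2_space, second_countable_topology}, 'e1::euclidean_space) chart set"
    and \<pi>1 :: "'p1 \<Rightarrow> 'm1"
    and act1 :: "'p1 \<Rightarrow> 'g1 \<Rightarrow> 'p1"
    and G2 :: "'g2::{t2_space, second_countable_topology} monoid"
    and \<G>2 :: "('g2, 'h2::euclidean_space) chart set"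
    and \<P>2 :: "('p2::{t2_space, second_countable_topology}, 'd2::euclidean_space) chart set"
    and \<M>2 :: "('m2::{t2_space, second_countable_topology}, 'e2::euclidean_space) chart set"
    and \<pi>2 :: "'p2 \<Rightarrow> 'm2"
    and act2 :: "'p2 \<Rightarrow> 'g2 \<Rightarrow> 'p2" +
  fixes \<Phi> :: "'p1 vector_field \<Rightarrow> 'p2 vector_field"
  assumes iso: "lie_iso (atiyah_sections \<P>1 act1) (atiyah_sections \<P>2 act2) \<Phi>"
begin

abbreviation \<Psi> where "\<Psi> \<equiv> inv_into B1.sections \<Phi>"

lemmas \<Phi> = lie_isoD[OF iso]

text \<open>The locale is symmetric, so each of its lemmas is available for the inverse too;
  \<open>bij_\<phi>\<close>, \<open>smooth_pull\<close> and \<open>lie_iso_kernel\<close> draw on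
  this.\<close>

lemma inverse: "algebroid_iso G2 \<G>2 \<P>2 \<M>2 \<pi>2 act2 G1 \<G>1 \<P>1 \<M>1 \<pi>1 act1 \<Psi>"
  by (intro algebroid_iso.intro algebroid_iso_axioms.intro B1.principal_bundle_axioms B2.principal_bundle_axioms
      lie_iso_inverse[OF iso B1.sections_subalgebra])

lemma \<Phi>_closed: "a \<in> B1.sections \<Longrightarrow> \<Phi> a \<in> B2.sections"
  using \<Phi>(2) by blast

lemma \<Phi>_\<Psi>: "c \<in> B2.sections \<Longrightarrow> \<Phi> (\<Psi> c) = c"
  and \<Psi>_closed: "c \<in> B2.sections \<Longrightarrow> \<Psi> c \<in> B1.sections"
  using \<Phi>(2) f_inv_into_f[of c \<Phi> B1.sections] inv_into_into[of c \<Phi> B1.sections] by simp_all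

lemma \<Psi>_\<Phi>: "a \<in> B1.sections \<Longrightarrow> \<Psi> (\<Phi> a) = a"
  by (rule inv_into_f_f[OF \<Phi>(1)])

text \<open>\<open>point_like_isotropy\<close> gives an inclusion only. Applied on one side and then
  on the other it encloses A_m in some A_m'', hence m = m'' by \<open>isotropy_subset_eq\<close>,
  and both inclusions are equalities.\<close>

lemma isotropy_image: "\<exists>m'. \<Phi> ` B1.isotropy m = B2.isotropy m'"
proof -
  have L: "B1.isotropy m \<subseteq> B1.sections" and L': "B2.isotropy m' \<subseteq> B2.sections" for m m'
    by (auto simp: isotropy_sections_def)
  obtain m' where m': "\<Phi> ` B1.isotropy m \<subseteq> B2.isotropy m'"
    using B2.point_like_isotropy[OF point_like_image[OF iso B1.sections_subalgebra B1.isotropy_point_like]] by blast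
  obtain m'' where m'': "\<Psi> ` B2.isotropy m' \<subseteq> B1.isotropy m''"
    using B1.point_like_isotropy[OF point_like_image[OF lie_iso_inverse[OF iso B1.sections_subalgebra]
          B2.sections_subalgebra B2.isotropy_point_like]] by blast
  have "B1.isotropy m \<subseteq> \<Psi> ` \<Phi> ` B1.isotropy m" using L[of m] \<Psi>_\<Phi> by force
  also have "\<dots> \<subseteq> \<Psi> ` B2.isotropy m'" using m' by blast
  also note m''
  finally have "m = m''" by (rule B1.isotropy_subset_eq)
  have "c \<in> \<Phi> ` B1.isotropy m" if c: "c \<in> B2.isotropy m'" for c
  proof -
    have "\<Psi> c \<in> B1.isotropy m" using m'' c \<open>m = m''\<close> by blast
    moreover have "c = \<Phi> (\<Psi> c)" using \<Phi>_\<Psi> L' c by (simp add: subset_iff)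
    ultimately show ?thesis by blast
  qed
  with m' have "\<Phi> ` B1.isotropy m = B2.isotropy m'" by blast
  then show ?thesis ..
qed

text \<open>The choice is unambiguous by \<open>isotropy_subset_eq\<close>.\<close>

definition \<phi> :: "'m1 \<Rightarrow> 'm2" where
  "\<phi> m = (SOME m'. \<Phi> ` B1.isotropy m = B2.isotropy m')"

lemma \<phi>: "\<Phi> ` B1.isotropy m = B2.isotropy (\<phi> m)"
  unfolding \<phi>_def by (rule someI_ex[OF isotropy_image])

lemma isotropy_iff_\<phi>: "a \<in> B1.sections \<Longrightarrow> \<Phi> a \<in> B2.isotropy (\<phi> m) \<longleftrightarrow> a \<in> B1.isotropy m"
  unfolding \<phi>[symmetric] by (rule inj_on_image_mem_iff[OF \<Phi>(1)]) (auto simp: isotropy_sections_def)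

lemma \<phi>_inverse: "algebroid_iso.\<phi> \<P>2 \<M>2 \<pi>2 act2 \<P>1 \<M>1 \<pi>1 act1 \<Psi> (\<phi> m) = m"
  (is "?\<psi> (\<phi> m) = m")
proof -
  have "\<Psi> ` \<Phi> ` B1.isotropy m = B1.isotropy (?\<psi> (\<phi> m))"
    unfolding \<phi> by (rule algebroid_iso.\<phi>[OF inverse])
  moreover have "B1.isotropy m \<subseteq> \<Psi> ` \<Phi> ` B1.isotropy m"
  proof
    fix a assume a: "a \<in> B1.isotropy m"
    then have "a = \<Psi> (\<Phi> a)" using \<Psi>_\<Phi> by (simp add: isotropy_sections_def)
    with a show "a \<in> \<Psi> ` \<Phi> ` B1.isotropy m" by blast
  qed
  ultimately show ?thesis using B1.isotropy_subset_eq by metis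
qed

lemma anchor_\<Phi>_smul:
  assumes a: "a \<in> B1.sections" and f: "B1.smooth f"
  shows "B2.anc (\<Phi> (B1.smul f a)) (\<phi> m) g = f m * B2.anc (\<Phi> a) (\<phi> m) g"
proof -
  have fa: "B1.smul f a \<in> B1.sections" by (rule B1.smul_closed[OF a f])
  let ?d = "vf_add (B1.smul f a) (vf_scale (- f m) a)"
  have sc: "vf_scale (- f m) a \<in> B1.sections" by (rule B1.scale_closed[OF a])
  have "?d \<in> B1.isotropy m"
    by (simp add: B1.isotropy_iff B1.add_closed[OF fa sc] B1.anchor_add[OF fa sc] B1.anchor_scale[OF a]
        B1.anchor_smul[OF a f])
  then have "\<Phi> ?d \<in> B2.isotropy (\<phi> m)" using \<phi> by blast
  then have "B2.anc (\<Phi> ?d) (\<phi> m) g = 0" by (simp add: isotropy_sections_def)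
  moreover have "\<Phi> ?d = vf_add (\<Phi> (B1.smul f a)) (vf_scale (- f m) (\<Phi> a))"
    by (simp add: \<Phi>(3)[OF fa sc] \<Phi>(4)[OF a])
  ultimately show ?thesis
    by (simp add: B2.anchor_add B2.anchor_scale \<Phi>_closed a fa B2.scale_closed)
qed

lemma bij_\<phi>: "bij \<phi>"
proof -
  let ?\<psi> = "algebroid_iso.\<phi> \<P>2 \<M>2 \<pi>2 act2 \<P>1 \<M>1 \<pi>1 act1 \<Psi>"
  have "\<phi> (?\<psi> q) = q" for q
  proof -
    have "\<Phi> ` \<Psi> ` B2.isotropy q = B2.isotropy (\<phi> (?\<psi> q))"
      unfolding algebroid_iso.\<phi>[OF inverse] by (rule \<phi>)
    moreover have "B2.isotropy q \<subseteq> \<Phi> ` \<Psi> ` B2.isotropy q"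
    proof
      fix a assume a: "a \<in> B2.isotropy q"
      then have "a = \<Phi> (\<Psi> a)" using \<Phi>_\<Psi> by (simp add: isotropy_sections_def)
      with a show "a \<in> \<Phi> ` \<Psi> ` B2.isotropy q" by blast
    qed
    ultimately show ?thesis using B2.isotropy_subset_eq by metis
  qed
  then show ?thesis using \<phi>_inverse by (intro o_bij[of ?\<psi>]) auto
qed

lemma smooth_pull_inverse:
  assumes f: "B1.smooth f"
  shows "B2.smooth (\<lambda>q. f (inv_into UNIV \<phi> q))"
proof (rule B2.base.smooth_real_local)
  fix q
  \<comment> \<open>This supplies the denominator: a function of the point that is nonzero at
    \<open>q\<close> and therefore nearby.\<close>
  obtain c g where c: "c \<in> B2.sections" "B2.smooth g" "B2.anc c q g \<noteq> 0" using B2.anchor_nonzero[of q] by blast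
  define a where "a = \<Psi> c"
  have a: "a \<in> B1.sections" and ac: "\<Phi> a = c" using \<Psi>_closed \<Phi>_\<Psi> c(1) by (simp_all add: a_def)
  define V where "V = {q. B2.anc c q g \<noteq> 0}"
  have cs: "B2.smooth (\<lambda>q. B2.anc c q g)" by (rule B2.anchor_smooth[OF c(1,2)])
  have V: "open V" unfolding V_def
    using B2.base.smooth_real_continuous[OF cs] by (intro open_Collect_neq continuous_on_const)
  have fa: "\<Phi> (B1.smul f a) \<in> B2.sections" by (rule \<Phi>_closed[OF B1.smul_closed[OF a f]])
  have "B2.base.smooth_real V (\<lambda>q. B2.anc (\<Phi> (B1.smul f a)) q g * inverse (B2.anc c q g))"
  proof (rule B2.base.smooth_real_mult[OF V])
    show "B2.base.smooth_real V (\<lambda>q. B2.anc (\<Phi> (B1.smul f a)) q g)"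
      by (rule smooth_map_on_subset[OF B2.anchor_smooth[OF fa c(2)] subset_UNIV])
    show "B2.base.smooth_real V (\<lambda>q. inverse (B2.anc c q g))"
      by (rule B2.base.smooth_real_inverse[OF V smooth_map_on_subset[OF cs subset_UNIV]]) (simp add: V_def)
  qed
  moreover have "B2.anc (\<Phi> (B1.smul f a)) q g * inverse (B2.anc c q g) = f (inv_into UNIV \<phi> q)" if "q \<in> V" for q
    using anchor_\<Phi>_smul[OF a f, of "inv_into UNIV \<phi> q" g] that bij_\<phi>
    by (simp add: ac V_def bij_is_surj surj_f_inv_f)
  ultimately have "B2.base.smooth_real V (\<lambda>q. f (inv_into UNIV \<phi> q))"
    by (rule B2.base.smooth_real_cong[OF V])
  then show "\<exists>T. open T \<and> q \<in> T \<and> B2.base.smooth_real T (\<lambda>q. f (inv_into UNIV \<phi> q))"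
    using V c(3) by (intro exI[of _ V]) (simp add: V_def)
qed simp

text \<open>This is \<open>smooth_pull_inverse\<close> for the inverse isomorphism, whose point map
  is inverse to \<phi>.\<close>

lemma smooth_pull:
  assumes "B2.smooth g"
  shows "B1.smooth (\<lambda>m. g (\<phi> m))"
proof -
  let ?\<psi> = "algebroid_iso.\<phi> \<P>2 \<M>2 \<pi>2 act2 \<P>1 \<M>1 \<pi>1 act1 \<Psi>"
  have "bij ?\<psi>" by (rule algebroid_iso.bij_\<phi>[OF inverse])
  then have "inv_into UNIV ?\<psi> m = \<phi> m" for m
    using \<phi>_inverse[of m] by (metis bij_inv_eq_iff)
  then show ?thesis using algebroid_iso.smooth_pull_inverse[OF inverse assms] by simp
qed

lemma diffeomorphism_\<phi>: "diffeomorphism \<M>1 \<M>2 \<phi>"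
  unfolding diffeomorphism_def
proof (intro conjI bij_\<phi>)
  show "smooth_map \<M>1 \<M>2 \<phi>"
    by (rule smooth_map_by_functions[OF B1.base.smooth_manifold_axioms B2.base.smooth_manifold_axioms])
      (rule smooth_pull)
  show "smooth_map \<M>2 \<M>1 (inv_into UNIV \<phi>)"
    by (rule smooth_map_by_functions[OF B2.base.smooth_manifold_axioms B1.base.smooth_manifold_axioms])
      (rule smooth_pull_inverse)
qed

section \<open>The induced isomorphism of vector fields, and the kernels\<close>

text \<open>The anchor of the image of [a, k b] is computed twice, expanding the bracket in the
  source and in the target. Both results contain f(q) times the anchor of the image of [a, b]; what
  remains equates the derivatives of \<open>f\<close> and \<open>k\<close> up to the nonzero factor
  \<open>?D q\<close>.\<close>

lemma anchor_\<Phi>: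
  assumes a: "a \<in> B1.sections"
  shows "B2.anc (\<Phi> a) = pushforward \<phi> (B1.anc a)"
proof (rule vf_eqI)
  fix q f
  define m where "m = inv_into UNIV \<phi> q"
  have q: "q = \<phi> m" using bij_\<phi> by (simp add: m_def bij_is_surj surj_f_inv_f)
  have inv: "inv_into UNIV \<phi> (\<phi> x) = x" for x using bij_\<phi> by (simp add: bij_is_inj)
  have "B2.anc (\<Phi> a) (\<phi> m) f = B1.anc a m (\<lambda>x. f (\<phi> x))"
  proof (cases "B2.smooth f")
    case True
    define k where "k = (\<lambda>x. f (\<phi> x))"
    have k: "B1.smooth k" unfolding k_def by (rule smooth_pull[OF True])
    obtain c g where c: "c \<in> B2.sections" "B2.smooth g" "B2.anc c q g \<noteq> 0" using B2.anchor_nonzero[of q] by blast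
    define b where "b = \<Psi> c"
    have b: "b \<in> B1.sections" and bc: "\<Phi> b = c" using \<Psi>_closed \<Phi>_\<Psi> c(1) by (simp_all add: b_def)
    have A: "\<Phi> a \<in> B2.sections" by (rule \<Phi>_closed[OF a])
    have kb: "B1.smul k b \<in> B1.sections" by (rule B1.smul_closed[OF b k])
    have ak: "B1.smooth (\<lambda>x. B1.anc a x k)" by (rule B1.anchor_smooth[OF a k])
    have ab: "vf_bracket a b \<in> B1.sections" by (rule B1.bracket_closed[OF a b])
    let ?D = "\<lambda>x. B2.anc c x g"
    have D: "B2.smooth ?D" by (rule B2.anchor_smooth[OF c(1,2)])
    \<comment> \<open>The identity is wanted at all points, since its right side is differentiated
      along \<open>\<Phi> a\<close> below.\<close>
    have val: "B2.anc (\<Phi> (B1.smul k b)) x h = f x * B2.anc c x h" for x h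
      using anchor_\<Phi>_smul[OF b k, of "inv_into UNIV \<phi> x" h] bij_\<phi>
      by (simp add: bc k_def bij_is_surj surj_f_inv_f)
    have "B2.anc (\<Phi> (vf_bracket a (B1.smul k b))) q g = B2.anc (\<Phi> a) q (\<lambda>x. f x * ?D x) - f q * B2.anc c q (\<lambda>x. B2.anc (\<Phi> a) x g)"
      by (simp add: \<Phi>(5)[OF a kb] B2.anchor_bracket[OF A \<Phi>_closed[OF kb] c(2)] val)
    also have "\<dots> = B2.anc (\<Phi> a) q f * ?D q + f q * B2.anc (\<Phi> (vf_bracket a b)) q g"
      by (simp add: B2.anchor_mult[OF A True D] \<Phi>(5)[OF a b] bc B2.anchor_bracket[OF A c(1,2)] algebra_simps)
    finally have 1: "B2.anc (\<Phi> (vf_bracket a (B1.smul k b))) q g =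
      B2.anc (\<Phi> a) q f * ?D q + f q * B2.anc (\<Phi> (vf_bracket a b)) q g" .
    have "vf_bracket a (B1.smul k b) = vf_add (B1.smul k (vf_bracket a b)) (B1.smul (\<lambda>x. B1.anc a x k) b)"
      by (rule vf_eqI) (simp add: B1.bracket_smul[OF a b k] vf_add_apply B1.smul_apply)
    then have "B2.anc (\<Phi> (vf_bracket a (B1.smul k b))) q g = k m * B2.anc (\<Phi> (vf_bracket a b)) q g + B1.anc a m k * ?D q"
      using anchor_\<Phi>_smul[OF ab k, of m g] anchor_\<Phi>_smul[OF b ak, of m g]
      by (simp add: q bc \<Phi>(3) B1.smul_closed ab k b ak B2.anchor_add \<Phi>_closed)
    with 1 have "B2.anc (\<Phi> a) q f * ?D q = B1.anc a m k * ?D q" by (simp add: k_def q)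
    then show ?thesis using c(3) by (simp add: q k_def)
  next
    case False
    \<comment> \<open>Both sides are 0 by the convention for nonsmooth arguments, once composing
      with \<phi> is known not to turn a nonsmooth function into a smooth one.\<close>
    have "\<not> B1.smooth (\<lambda>x. f (\<phi> x))"
    proof
      assume "B1.smooth (\<lambda>x. f (\<phi> x))"
      from smooth_pull_inverse[OF this] have "B2.smooth (\<lambda>q. f (\<phi> (inv_into UNIV \<phi> q)))" .
      then show False using False bij_\<phi> by (simp add: bij_is_surj surj_f_inv_f)
    qed
    then show ?thesis using False by (simp add: B1.anchor_nonsmooth[OF a] B2.anchor_nonsmooth[OF \<Phi>_closed[OF a]])
  qed
  then show "B2.anc (\<Phi> a) q f = pushforward \<phi> (B1.anc a) q f"
    by (simp add: pushforward_def q inv o_def)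
qed

text \<open>That vector fields are pushed onto vector fields is seen by lifting: if \<open>v\<close>
  is the anchor of \<open>a\<close>, its push-forward is the anchor of
  \<open>\<Phi> a\<close>.\<close>

lemma lie_iso_pushforward: "lie_iso (vector_fields \<M>1) (vector_fields \<M>2) (pushforward \<phi>)"
proof -
  have inv: "inv_into UNIV \<phi> (\<phi> x) = x" and inv': "\<phi> (inv_into UNIV \<phi> y) = y" for x y
    using bij_\<phi> by (simp_all add: bij_is_inj bij_is_surj surj_f_inv_f)
  have "inj_on (pushforward \<phi>) (vector_fields \<M>1)"
  proof (rule inj_onI)
    fix v w assume eq: "pushforward \<phi> v = pushforward \<phi> w"
    show "v = w"
    proof (rule vf_eqI)
      fix m f
      have "pushforward \<phi> v (\<phi> m) (f \<circ> inv_into UNIV \<phi>) = pushforward \<phi> w (\<phi> m) (f \<circ> inv_into UNIV \<phi>)"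
        by (simp only: eq)
      then show "v m f = w m f" by (simp add: pushforward_def o_def inv)
    qed
  qed
  moreover have "pushforward \<phi> ` vector_fields \<M>1 = vector_fields \<M>2"
  proof (intro equalityI subsetI)
    fix w assume "w \<in> pushforward \<phi> ` vector_fields \<M>1"
    then obtain v where v: "v \<in> vector_fields \<M>1" "w = pushforward \<phi> v" by blast
    obtain a where a: "a \<in> B1.sections" "B1.anc a = v" by (rule B1.anchor_surj[OF v(1)])
    then show "w \<in> vector_fields \<M>2"
      using B2.anchor_vector_field[OF \<Phi>_closed[OF a(1)]] anchor_\<Phi>[OF a(1)] v(2) by simp
  next
    fix w assume "w \<in> vector_fields \<M>2"
    then obtain c where c: "c \<in> B2.sections" "B2.anc c = w" by (rule B2.anchor_surj)
    have "w = pushforward \<phi> (B1.anc (\<Psi> c))"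
      using anchor_\<Phi>[OF \<Psi>_closed[OF c(1)]] c \<Phi>_\<Psi> by simp
    then show "w \<in> pushforward \<phi> ` vector_fields \<M>1"
      using B1.anchor_vector_field[OF \<Psi>_closed[OF c(1)]] by blast
  qed
  ultimately show ?thesis
    unfolding lie_iso_def bij_betw_def
    by (auto simp: pushforward_def vf_add_def vf_scale_def vf_bracket_def o_def inv)
qed

lemma kernel_iff: "a \<in> anchor_kernel \<P>1 \<M>1 \<pi>1 act1 \<longleftrightarrow> (\<forall>m. a \<in> B1.isotropy m)"
  by (auto simp: anchor_kernel_def isotropy_sections_def fun_eq_iff)

text \<open>The kernel is the intersection of all isotropy subalgebras, and \<Phi> matches those of
  the two sides along the bijection \<phi>.\<close>

lemma lie_iso_kernel: "lie_iso (anchor_kernel \<P>1 \<M>1 \<pi>1 act1) (anchor_kernel \<P>2 \<M>2 \<pi>2 act2) \<Phi>"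
proof -
  let ?K1 = "anchor_kernel \<P>1 \<M>1 \<pi>1 act1" and ?K2 = "anchor_kernel \<P>2 \<M>2 \<pi>2 act2"
  have sub: "?K1 \<subseteq> B1.sections" "?K2 \<subseteq> B2.sections" by (auto simp: anchor_kernel_def)
  have iff: "\<Phi> a \<in> ?K2 \<longleftrightarrow> a \<in> ?K1" if a: "a \<in> B1.sections" for a
  proof -
    have "\<Phi> a \<in> ?K2 \<longleftrightarrow> (\<forall>q. \<Phi> a \<in> B2.isotropy q)" by (rule algebroid_iso.kernel_iff[OF inverse])
    also have "\<dots> \<longleftrightarrow> (\<forall>m. \<Phi> a \<in> B2.isotropy (\<phi> m))" using bij_\<phi> by (metis bij_pointE)
    also have "\<dots> \<longleftrightarrow> a \<in> ?K1" by (simp add: isotropy_iff_\<phi>[OF a] kernel_iff)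
    finally show ?thesis .
  qed
  have "\<Phi> ` ?K1 = ?K2"
  proof (intro equalityI subsetI)
    fix c assume c: "c \<in> ?K2"
    then have cL: "c \<in> B2.sections" using sub by blast
    then have "\<Psi> c \<in> ?K1" using iff[OF \<Psi>_closed[OF cL]] c \<Phi>_\<Psi>[OF cL] by simp
    then show "c \<in> \<Phi> ` ?K1" using \<Phi>_\<Psi>[OF cL] by (metis imageI)
  qed (use iff sub in blast)
  then show ?thesis using lie_iso_restrict[OF iso sub(1)] by simp
qed

end

theorem theorem2:
  fixes G1 :: "'g1::{t2_space, second_countable_topology} monoid"
    and \<G>1 :: "('g1, 'h1::euclidean_space) chart set"
    and \<P>1 :: "('p1::{t2_space, second_countable_topology}, 'd1::euclidean_space) chart set"
    and \<M>1 :: "('m1::{t2_space, second_countable_topology}, 'e1::euclidean_space) chart set"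
    and \<pi>1 :: "'p1 \<Rightarrow> 'm1"
    and act1 :: "'p1 \<Rightarrow> 'g1 \<Rightarrow> 'p1"
    and G2 :: "'g2::{t2_space, second_countable_topology} monoid"
    and \<G>2 :: "('g2, 'h2::euclidean_space) chart set"
    and \<P>2 :: "('p2::{t2_space, second_countable_topology}, 'd2::euclidean_space) chart set"
    and \<M>2 :: "('m2::{t2_space, second_countable_topology}, 'e2::euclidean_space) chart set"
    and \<pi>2 :: "'p2 \<Rightarrow> 'm2"
    and act2 :: "'p2 \<Rightarrow> 'g2 \<Rightarrow> 'p2"
    and \<Phi> :: "'p1 vector_field \<Rightarrow> 'p2 vector_field"
  assumes bundle1: "principal_bundle G1 \<G>1 \<P>1 \<M>1 \<pi>1 act1"
    and bundle2: "principal_bundle G2 \<G>2 \<P>2 \<M>2 \<pi>2 act2"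
    and iso: "lie_iso (atiyah_sections \<P>1 act1) (atiyah_sections \<P>2 act2) \<Phi>"
  shows "lie_iso (anchor_kernel \<P>1 \<M>1 \<pi>1 act1) (anchor_kernel \<P>2 \<M>2 \<pi>2 act2) \<Phi> \<and>
    (\<exists>\<Phi>'. lie_iso (vector_fields \<M>1) (vector_fields \<M>2) \<Phi>' \<and>
      (\<forall>a\<in>atiyah_sections \<P>1 act1. \<Phi>' (anchor \<M>1 \<pi>1 a) = anchor \<M>2 \<pi>2 (\<Phi> a)) \<and>
      (\<forall>\<Psi>. (\<forall>a\<in>atiyah_sections \<P>1 act1. \<Psi> (anchor \<M>1 \<pi>1 a) = anchor \<M>2 \<pi>2 (\<Phi> a)) \<longrightarrow>
           (\<forall>v\<in>vector_fields \<M>1. \<Psi> v = \<Phi>' v)) \<and>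
      (\<exists>\<phi>. diffeomorphism \<M>1 \<M>2 \<phi> \<and>
        (\<forall>v\<in>vector_fields \<M>1. \<Phi>' v = pushforward \<phi> v) \<and>
        (\<forall>m. \<Phi> ` isotropy_sections \<P>1 \<M>1 \<pi>1 act1 m = isotropy_sections \<P>2 \<M>2 \<pi>2 act2 (\<phi> m))))"
proof -
  interpret algebroid_iso G1 \<G>1 \<P>1 \<M>1 \<pi>1 act1 G2 \<G>2 \<P>2 \<M>2 \<pi>2 act2 \<Phi>
    by (intro algebroid_iso.intro algebroid_iso_axioms.intro assms)
  \<comment> \<open>Uniqueness on all of \<open>vector_fields \<M>1\<close> rests on the
    surjectivity of the anchor.\<close>
  have unique: "\<Psi>' v = pushforward \<phi> v"
    if \<Psi>': "\<forall>a\<in>B1.sections. \<Psi>' (B1.anc a) = B2.anc (\<Phi> a)" and v: "v \<in> vector_fields \<M>1" for \<Psi>' v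
  proof -
    obtain a where "a \<in> B1.sections" "B1.anc a = v" by (rule B1.anchor_surj[OF v])
    then show ?thesis using \<Psi>' anchor_\<Phi> by auto
  qed
  \<comment> \<open>The bound \<phi> hides the constant of that name, which is therefore called
    \<open>local.\<phi>\<close> inside.\<close>
  have "\<exists>\<phi>. diffeomorphism \<M>1 \<M>2 \<phi> \<and>
      (\<forall>v\<in>vector_fields \<M>1. pushforward local.\<phi> v = pushforward \<phi> v) \<and>
      (\<forall>m. \<Phi> ` B1.isotropy m = B2.isotropy (\<phi> m))"
    by (rule exI[of _ \<phi>]) (simp add: diffeomorphism_\<phi> \<phi>)
  moreover have "\<forall>a\<in>B1.sections. pushforward \<phi> (B1.anc a) = B2.anc (\<Phi> a)"
    using anchor_\<Phi> by simp
  moreover have "\<forall>\<Psi>'. (\<forall>a\<in>B1.sections. \<Psi>' (B1.anc a) = B2.anc (\<Phi> a)) \<longrightarrow>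
      (\<forall>v\<in>vector_fields \<M>1. \<Psi>' v = pushforward \<phi> v)"
    using unique by simp
  ultimately show ?thesis
    by (intro conjI lie_iso_kernel exI[of _ "pushforward \<phi>"] lie_iso_pushforward)
qed

end
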